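(* Let $i\in\{0,1,\ldots,n\}$ and $x=\zeta_i(b_1,b_2)$, the parameters $a_1,a_2,b_1,b_2\in\mathbb{C}^*$, $t=q^\tau$ being generic and such that the sums below converge absolutely. Then for $j=1,2$ $$T_{a_j}\bar J(x)=(-a_j)^n\prod_{k=1}^n \frac{(1-a_j^{-1}b_1^{-1}t^{-(k-1)})(1-a_j^{-1}b_2^{-1}t^{-(k-1)})}{1-a_1^{-1}a_2^{-1}b_1^{-1}b_2^{-1}t^{-(n+k-2)}}\,\bar J(x),$$ $$T_{b_j}\bar J(x)=(-b_j^{-1})^n\prod_{k=1}^n \frac{(1-a_1b_jt^{k-1})(1-a_2b_jt^{k-1})}{1-a_1a_2b_1b_2t^{n+k-2}}\,\bar J(x).$$ In other words, for $j=1,2$ the regularization $\bar{\mathcal{J}}$ satisfies $$T_{a_j}\bar{\mathcal{J}}(x)=\prod_{k=1}^n \frac{(1-a_j^{-1}b_1^{-1}t^{-(k-1)})(1-a_j^{-1}b_2^{-1}t^{-(k-1)})}{1-a_1^{-1}a_2^{-1}b_1^{-1}b_2^{-1}t^{-(n+k-2)}}\,\bar{\mathcal{J}}(x),$$ $$T_{b_j}\bar{\mathcal{J}}(x)=\prod_{k=1}^n \frac{(1-a_1^{-1}b_j^{-1}t^{-(k-1)})(1-a_2^{-1}b_j^{-1}t^{-(k-1)})}{1-a_1^{-1}a_2^{-1}b_1^{-1}b_2^{-1}t^{-(n+k-2)}}\,\bar{\mathcal{J}}(x).$$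
   Context: Fix $0<q<1$ and an integer $n\ge1$. Put $(a)_\infty=\prod_{i\ge0}(1-q^ia)$, $\theta(a)=(a)_\infty(q/a)_\infty$, $t=q^\tau$, $a_i=q^{\alpha_i}$, $b_i=q^{\beta_i}$, $$\bar\Phi(z)=\prod_{i=1}^n z_i^{1-\alpha_1-\alpha_2-\beta_1-\beta_2-2(n-1)\tau}\frac{(qb_1^{-1}z_i)_\infty(qb_2^{-1}z_i)_\infty}{(a_1z_i)_\infty(a_2z_i)_\infty}\prod_{1\le j<k\le n}z_j^{2\tau-1}\frac{(qt^{-1}z_k/z_j)_\infty}{(tz_k/z_j)_\infty},$$ $\Delta(z)=\prod_{1\le i<j\le n}(z_i-z_j)$, and $\bar J(x)=(1-q)^n\sum_{\nu\in\mathbb{Z}^n}\bar\Phi(xq^\nu)\Delta(xq^\nu)$ with $xq^\nu=(x_1q^{\nu_1},\ldots,x_nq^{\nu_n})$. Further $$\bar{\mathcal{J}}(x)=\frac{\bar J(x)}{\bar h(x)},\qquad \bar h(x)=\prod_{i=1}^n\frac{x_i^{1-\alpha_1-\alpha_2-\beta_1-\beta_2-2(n-1)\tau}}{\theta(a_1x_i)\theta(a_2x_i)}\prod_{1\le j<k\le n}x_j^{2\tau}\frac{\theta(x_k/x_j)}{\theta(tx_k/x_j)}.$$ For $0\le i\le n$, $\zeta_i(x_1,x_2)=(x_1,x_1t,\ldots,x_1t^{i-1},x_2,x_2t,\ldots,x_2t^{n-i-1})$. At $x=\zeta_i(b_1,b_2)$ (generic parameters) only the terms with $0\le\nu_1\le\cdots\le\nu_i$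 and $0\le\nu_{i+1}\le\cdots\le\nu_n$ are nonzero. $T_{a_j}$ and $T_{b_j}$ are the operators replacing $a_j$ by $qa_j$ (i.e. $\alpha_j$ by $\alpha_j+1$), respectively $b_j$ by $qb_j$ (i.e. $\beta_j$ by $\beta_j+1$, including in the point $x=\zeta_i(b_1,b_2)$), with the other parameters fixed. Complex powers: $\log q$ real, $\log a_j=\alpha_j\log q$, $\log b_j=\beta_j\log q$, $\log t=\tau\log q$, logarithms additive on products. *)

theory Defs
  imports "HOL-Analysis.Analysis"
begin

text \<open>
  Complex powers and the choice of logarithms.  The parameters are given by exponents: the
  functions \<open>\<alpha>\<close>, \<open>\<beta>\<close> are used at the indices 1 and 2 only, and
  \<open>a\<^sub>j = q\<^sup>\<alpha>\<^sup>j\<close>, \<open>b\<^sub>j = q\<^sup>\<beta>\<^sup>j\<close>, \<open>t = q\<^sup>\<tau>\<close>.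
  A point \<open>z\<close> of the \<open>n\<close>-dimensional algebraic torus is likewise given by an exponent vector
  \<open>\<xi>\<close>, with \<open>z\<^sub>k = q\<^sup>\<xi>\<^sup>k\<close> and \<open>log z\<^sub>k = \<xi>\<^sub>k log q\<close> for \<open>1 \<le> k \<le> n\<close>.  Multi-valued powers
  \<open>z\<^sub>k\<^sup>s\<close> are then \<open>q powr (s * \<xi>\<^sub>k)\<close>, so that logarithms are additive on products.
\<close>

definition qpow :: "real \<Rightarrow> complex \<Rightarrow> complex" where
  "qpow q s = complex_of_real q powr s"

definition qpoch_inf :: "real \<Rightarrow> complex \<Rightarrow> complex" where
  "qpoch_inf q a = (\<Prod>i. 1 - complex_of_real q ^ i * a)"

definition qtheta :: "real \<Rightarrow> complex \<Rightarrow> complex" where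
  "qtheta q a = qpoch_inf q a * qpoch_inf q (complex_of_real q / a)"

definition lead_exponent ::
    "nat \<Rightarrow> (nat \<Rightarrow> complex) \<Rightarrow> (nat \<Rightarrow> complex) \<Rightarrow> complex \<Rightarrow> complex" where
  "lead_exponent n \<alpha> \<beta> \<tau> = 1 - \<alpha> 1 - \<alpha> 2 - \<beta> 1 - \<beta> 2 - 2 * (of_nat n - 1) * \<tau>"

definition Phi_bar ::
    "real \<Rightarrow> nat \<Rightarrow> (nat \<Rightarrow> complex) \<Rightarrow> (nat \<Rightarrow> complex) \<Rightarrow> complex \<Rightarrow> (nat \<Rightarrow> complex) \<Rightarrow> complex" where
  "Phi_bar q n \<alpha> \<beta> \<tau> \<xi> =
     (let a = (\<lambda>j. qpow q (\<alpha> j)); b = (\<lambda>j. qpow q (\<beta> j)); t = qpow q \<tau>;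
          z = (\<lambda>k. qpow q (\<xi> k)); Q = complex_of_real q
      in (\<Prod>i=1..n. qpow q (lead_exponent n \<alpha> \<beta> \<tau> * \<xi> i)
            * (qpoch_inf q (Q * inverse (b 1) * z i) * qpoch_inf q (Q * inverse (b 2) * z i))
            / (qpoch_inf q (a 1 * z i) * qpoch_inf q (a 2 * z i)))
       * (\<Prod>j=1..n. \<Prod>k=Suc j..n. qpow q ((2 * \<tau> - 1) * \<xi> j)
            * qpoch_inf q (Q * inverse t * z k / z j) / qpoch_inf q (t * z k / z j)))"

definition Vandermonde_Delta :: "nat \<Rightarrow> (nat \<Rightarrow> complex) \<Rightarrow> complex" where
  "Vandermonde_Delta n z = (\<Prod>i=1..n. \<Prod>j=Suc i..n. z i - z j)"

text \<open>
  The summand of the bilateral sum; the index set \<open>\<int>\<^sup>n\<close> is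
  rendered as \<open>{1..n} \<rightarrow>\<^sub>E UNIV\<close>.  Replacing \<open>x\<close> by \<open>x q\<^sup>\<nu>\<close> adds \<open>\<nu>\<close> to the exponent vector.
\<close>

definition J_term ::
    "real \<Rightarrow> nat \<Rightarrow> (nat \<Rightarrow> complex) \<Rightarrow> (nat \<Rightarrow> complex) \<Rightarrow> complex \<Rightarrow> (nat \<Rightarrow> complex) \<Rightarrow> (nat \<Rightarrow> int) \<Rightarrow> complex" where
  "J_term q n \<alpha> \<beta> \<tau> \<xi> \<nu> =
     Phi_bar q n \<alpha> \<beta> \<tau> (\<lambda>k. \<xi> k + of_int (\<nu> k))
     * Vandermonde_Delta n (\<lambda>k. qpow q (\<xi> k + of_int (\<nu> k)))"

definition J_bar ::
    "real \<Rightarrow> nat \<Rightarrow> (nat \<Rightarrow> complex) \<Rightarrow> (nat \<Rightarrow> complex) \<Rightarrow> complex \<Rightarrow> (nat \<Rightarrow> complex) \<Rightarrow> complex" where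
  "J_bar q n \<alpha> \<beta> \<tau> \<xi> =
     (1 - complex_of_real q) ^ n
     * (\<Sum>\<^sub>\<infinity>\<nu>\<in>{1..n} \<rightarrow>\<^sub>E (UNIV :: int set). J_term q n \<alpha> \<beta> \<tau> \<xi> \<nu>)"

definition J_converges ::
    "real \<Rightarrow> nat \<Rightarrow> (nat \<Rightarrow> complex) \<Rightarrow> (nat \<Rightarrow> complex) \<Rightarrow> complex \<Rightarrow> (nat \<Rightarrow> complex) \<Rightarrow> bool" where
  "J_converges q n \<alpha> \<beta> \<tau> \<xi> \<longleftrightarrow>
     (\<lambda>\<nu>. norm (J_term q n \<alpha> \<beta> \<tau> \<xi> \<nu>)) summable_on ({1..n} \<rightarrow>\<^sub>E (UNIV :: int set))"

definition h_bar ::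
    "real \<Rightarrow> nat \<Rightarrow> (nat \<Rightarrow> complex) \<Rightarrow> (nat \<Rightarrow> complex) \<Rightarrow> complex \<Rightarrow> (nat \<Rightarrow> complex) \<Rightarrow> complex" where
  "h_bar q n \<alpha> \<beta> \<tau> \<xi> =
     (let a = (\<lambda>j. qpow q (\<alpha> j)); t = qpow q \<tau>; x = (\<lambda>k. qpow q (\<xi> k))
      in (\<Prod>i=1..n. qpow q (lead_exponent n \<alpha> \<beta> \<tau> * \<xi> i)
            / (qtheta q (a 1 * x i) * qtheta q (a 2 * x i)))
       * (\<Prod>j=1..n. \<Prod>k=Suc j..n. qpow q (2 * \<tau> * \<xi> j)
            * qtheta q (x k / x j) / qtheta q (t * x k / x j)))"

definition J_reg ::
    "real \<Rightarrow> nat \<Rightarrow> (nat \<Rightarrow> complex) \<Rightarrow> (nat \<Rightarrow> complex) \<Rightarrow> complex \<Rightarrow> (nat \<Rightarrow> complex) \<Rightarrow> complex" where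
  "J_reg q n \<alpha> \<beta> \<tau> \<xi> = J_bar q n \<alpha> \<beta> \<tau> \<xi> / h_bar q n \<alpha> \<beta> \<tau> \<xi>"

text \<open>
  The exponent vector of \<open>\<zeta>\<^sub>i(x\<^sub>1, x\<^sub>2) =
  (x\<^sub>1, x\<^sub>1 t, \<dots>, x\<^sub>1 t\<^sup>i\<^sup>-\<^sup>1, x\<^sub>2, x\<^sub>2 t, \<dots>, x\<^sub>2 t\<^sup>n\<^sup>-\<^sup>i\<^sup>-\<^sup>1)\<close>,
  where \<open>x\<^sub>1\<close>, \<open>x\<^sub>2\<close> have exponents \<open>\<xi>\<^sub>1\<close>, \<open>\<xi>\<^sub>2\<close>; only the coordinates \<open>1 \<le> k \<le> n\<close> matter.
\<close>

definition zeta_pt :: "nat \<Rightarrow> complex \<Rightarrow> complex \<Rightarrow> complex \<Rightarrow> nat \<Rightarrow> complex" where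
  "zeta_pt i \<tau> \<xi>\<^sub>1 \<xi>\<^sub>2 k =
     (if k \<le> i then \<xi>\<^sub>1 + (of_nat k - 1) * \<tau> else \<xi>\<^sub>2 + (of_nat k - of_nat i - 1) * \<tau>)"

text \<open>
  The shift operators act on functions of the parameters \<open>\<alpha>\<close>, \<open>\<beta>\<close>; in particular they also act
  on a point of evaluation that depends on the parameters.
\<close>

definition T_a ::
    "nat \<Rightarrow> ((nat \<Rightarrow> complex) \<Rightarrow> (nat \<Rightarrow> complex) \<Rightarrow> 'r) \<Rightarrow> (nat \<Rightarrow> complex) \<Rightarrow> (nat \<Rightarrow> complex) \<Rightarrow> 'r" where
  "T_a j F \<alpha> \<beta> = F (\<alpha>(j := \<alpha> j + 1)) \<beta>"

definition T_b ::
    "nat \<Rightarrow> ((nat \<Rightarrow> complex) \<Rightarrow> (nat \<Rightarrow> complex) \<Rightarrow> 'r) \<Rightarrow> (nat \<Rightarrow> complex) \<Rightarrow> (nat \<Rightarrow> complex) \<Rightarrow> 'r" where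
  "T_b j F \<alpha> \<beta> = F \<alpha> (\<beta>(j := \<beta> j + 1))"

definition q_lattice :: "real \<Rightarrow> complex set" where
  "q_lattice q = range (\<lambda>l::int. complex_of_real q powi l)"

text \<open>
  Genericity: the summands have no poles at \<open>\<zeta>\<^sub>i(b\<^sub>1, b\<^sub>2) q\<^sup>\<nu>\<close>, the function \<open>h_bar\<close> has neither
  zeros nor poles there, the coordinates of \<open>\<zeta>\<^sub>i(b\<^sub>1, b\<^sub>2) q\<^sup>\<nu>\<close> are pairwise distinct, and the
  denominators of the shift factors do not vanish, for all \<open>0 \<le> i \<le> n\<close>.  The first three
  conditions are invariant under the shifts.
\<close>

definition generic_params ::
    "real \<Rightarrow> nat \<Rightarrow> (nat \<Rightarrow> complex) \<Rightarrow> (nat \<Rightarrow> complex) \<Rightarrow> complex \<Rightarrow> bool" where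
  "generic_params q n \<alpha> \<beta> \<tau> \<longleftrightarrow>
     (let a = (\<lambda>j. qpow q (\<alpha> j)); b = (\<lambda>j. qpow q (\<beta> j)); t = qpow q \<tau>
      in (\<forall>j\<in>{1,2}. \<forall>k\<in>{1,2}. \<forall>m<n. a j * b k * t ^ m \<notin> q_lattice q)
       \<and> (\<forall>m\<in>{1..n}. t ^ m \<notin> q_lattice q)
       \<and> (\<forall>m::int. \<bar>m\<bar> \<le> int n \<longrightarrow> b 1 / b 2 * t powi m \<notin> q_lattice q)
       \<and> (\<forall>k\<in>{1..n}. a 1 * a 2 * b 1 * b 2 * t ^ (n + k - 2) \<noteq> 1))"

end

theory Submission
  imports Defs "HOL-Computational_Algebra.Polynomial"
begin

text \<open>
  In the variables \<open>w\<^sub>m = 1 / z\<^sub>m\<close> and \<open>B\<^sub>j = 1 / b\<^sub>j\<close>, each parameter shift multiplies the summand by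
  \<open>\<Prod>\<^sub>m (w\<^sub>m - c)\<close> with \<open>c = a\<^sub>j\<close> or \<open>c = B\<^sub>j\<close> (the shift of the point \<open>\<zeta>\<^sub>i(b\<^sub>1, b\<^sub>2)\<close> only relabels the lattice).
  So everything is contained in the polynomial \<open>G(c) = \<Sum>\<^sub>\<nu> J(\<nu>) \<Prod>\<^sub>m (w\<^sub>m - c)\<close> of degree \<open>n\<close>, whose leading
  coefficient is the unshifted sum up to sign. Translation invariance of the lattice sum, used
  in each coordinate for an Aomoto-type test function and combined by Lagrange interpolation at the
  nodes \<open>w\<^sub>m\<close>, gives a second-order \<open>t\<close>-difference equation for \<open>G\<close> (that of the big \<open>t\<close>-Jacobi polynomials).
  In the Newton basis with nodes \<open>B\<^sub>j t\<^sup>-\<^sup>r\<close>, respectively \<open>a\<^sub>j t\<^sup>r\<close>, it becomes a two-term recurrence, which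
  yields the ratio of \<open>G(B\<^sub>j)\<close>, respectively \<open>G(a\<^sub>j)\<close>, to the leading coefficient. The regularized
  statement then follows from the quasi-periodicity of \<open>\<theta>\<close>.
\<close>

section \<open>Polynomial solutions of the t-difference equation\<close>

text \<open>The difference equation closes for a reason of degrees. After symmetrization its
  right-hand side is a polynomial in c of degree at most n + 2, while the n nodes determine only
  polynomials of degree below n. Three coefficients cancel: that of c^(n+2) by the choice of t^n +
  \<kappa>, and those of c^0 and c^1 by the relation for \<kappa> together with the linear
  coefficient. The value of \<kappa> is in turn dictated by the exponent of the power factor in the
  summand. What is left is c^2 times an interpolated sum.

  Two obstacles shape the analytic part. The summand vanishes outside a cone, so quotients of
  neighbouring summands may be undefined; the shift identities are therefore equalities of products.
  Moreover, more sums are rearranged than are assumed to converge. All are dominated by the sum with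
  a_1 raised: its summand is comparable to J(\<nu>) \<Prod> w_m, and on the cone the |w_m| are
  bounded below.\<close>

lemma newton_basis_poly:
  fixes x :: "nat \<Rightarrow> 'a::idom"
  shows "degree (\<Prod>j<m. [:- x j, 1:]) = m \<and> coeff (\<Prod>j<m. [:- x j, 1:]) m = 1"
proof (induction m)
  case (Suc m)
  have "degree ((\<Prod>j<m. [:- x j, 1:]) * [:- x m, 1:]) = Suc m"
    using Suc by (subst degree_mult_eq) auto
  moreover from this have "coeff ((\<Prod>j<m. [:- x j, 1:]) * [:- x m, 1:]) (Suc m) = 1"
    using Suc lead_coeff_mult[of "\<Prod>j<m. [:- x j, 1:]" "[:- x m, 1:]"] by simp
  ultimately show ?case by simp
qed simp

text \<open>The Newton polynomials are monic, so subtracting \<open>coeff p n\<close> times the top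
  one lowers the degree bound. The identity \<open>g n = coeff p n\<close> later ties the end of the
  recurrence to the unshifted sum.\<close>

lemma newton_expansion:
  fixes p :: "'a::idom poly"
  assumes "degree p \<le> n"
  shows "\<exists>g. g n = coeff p n \<and> (\<forall>c. poly p c = (\<Sum>r\<le>n. g r * (\<Prod>j<r. c - x j)))"
  using assms
proof (induction n arbitrary: p)
  case 0
  then have "poly p c = coeff p 0" for c
    by (metis coeff_pCons_0 degree_eq_zeroE le_zero_eq mult_zero_right add.right_neutral poly_0 poly_pCons)
  then show ?case by (intro exI[of _ "\<lambda>_. coeff p 0"]) simp
next
  case (Suc n)
  let ?N = "\<Prod>j<Suc n. [:- x j, 1:]" and ?k = "coeff p (Suc n)"
  define p' where "p' = p - smult ?k ?N"
  have N: "degree ?N = Suc n" "coeff ?N (Suc n) = 1"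
    using newton_basis_poly[of x "Suc n"] by auto
  have "degree p' \<le> Suc n"
    unfolding p'_def by (metis N(1) Suc.prems degree_diff_le degree_smult_le)
  moreover have "coeff p' (Suc n) = 0"
    unfolding p'_def by (simp only: coeff_diff coeff_smult N)  simp
  ultimately have "degree p' \<le> n"
    by (metis degree_0 le_SucE leading_coeff_0_iff zero_le)
  from Suc.IH[OF this] obtain g where g: "\<And>c. poly p' c = (\<Sum>r\<le>n. g r * (\<Prod>j<r. c - x j))"
    by blast
  have pN: "poly ?N c = (\<Prod>j<Suc n. c - x j)" for c
    by (simp only: poly_prod) (simp add: algebra_simps)
  have "poly p c = (\<Sum>r\<le>n. g r * (\<Prod>j<r. c - x j)) + ?k * (\<Prod>j<Suc n. c - x j)" for c
    unfolding g[symmetric] pN[symmetric] p'_def by simp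
  then show ?case
    by (intro exI[of _ "g(Suc n := ?k)"]) auto
qed

text \<open>Connects the two ends of a two-term recurrence. It is kept cross-multiplied because the
  factors may vanish for special parameters.\<close>

lemma prod_telescope_recurrence:
  fixes g :: "nat \<Rightarrow> 'a::comm_semiring_1"
  assumes "\<And>r. r < n \<Longrightarrow> g r * u r = g (Suc r) * v r"
  shows "g 0 * (\<Prod>r<n. u r) = g n * (\<Prod>r<n. v r)"
  using assms
proof (induction n)
  case (Suc n)
  then have IH: "g 0 * (\<Prod>r<n. u r) = g n * (\<Prod>r<n. v r)" by simp
  have "g 0 * (\<Prod>r<Suc n. u r) = (g 0 * (\<Prod>r<n. u r)) * u n"
    by (simp add: mult_ac)
  also have "\<dots> = (g n * u n) * (\<Prod>r<n. v r)"
    unfolding IH by (simp add: mult_ac)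
  also have "\<dots> = g (Suc n) * (\<Prod>r<Suc n. v r)"
    unfolding Suc.prems[OF lessI] by (simp add: mult_ac)
  finally show ?case .
qed simp

text \<open>Triangularity: at \<open>x s\<close> every Newton product with r > s vanishes, and the
  lower coefficients are already known to be zero. Testing at nodes matters because the identity to
  be tested arises by dividing by c^2, so it is available only for c \<noteq> 0.\<close>

lemma newton_coeffs_zero:
  fixes x :: "nat \<Rightarrow> 'a::idom"
  assumes "\<And>s. s \<le> n \<Longrightarrow> (\<Sum>r\<le>n. h r * (\<Prod>j<r. x s - x j)) = 0"
    and "\<And>j s. j < s \<Longrightarrow> s \<le> n \<Longrightarrow> x s \<noteq> x j"
    and "s \<le> n"
  shows "h s = 0"
  using \<open>s \<le> n\<close>
proof (induction s rule: less_induct)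
  case (less s)
  have "(\<Sum>r\<le>n. h r * (\<Prod>j<r. x s - x j)) = (\<Sum>r\<in>{s}. h r * (\<Prod>j<r. x s - x j))"
  proof (rule sum.mono_neutral_right)
    show "\<forall>r\<in>{..n} - {s}. h r * (\<Prod>j<r. x s - x j) = 0"
    proof
      fix r assume "r \<in> {..n} - {s}"
      then consider "r < s" | "s < r" "r \<le> n" by fastforce
      then show "h r * (\<Prod>j<r. x s - x j) = 0"
        using less by cases auto
    qed
  qed (use less in auto)
  then have "h s * (\<Prod>j<s. x s - x j) = 0"
    using assms(1)[of s] less by simp
  moreover have "(\<Prod>j<s. x s - x j) \<noteq> 0"
    using assms(2) less.prems by auto
  ultimately show ?case by simp
qed

text \<open>With nodes B1 / t^j, the factor c - B1 completes the product at t c to the next Newton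
  polynomial, and the product at c / t is the previous one times a linear factor. Hence the operator
  is bidiagonal in this basis, up to the factor c^2. Since p(B1) is the Newton coefficient with
  index 0 and \<open>coeff p n\<close> the one with index n, the resulting recurrence gives their
  ratio.\<close>

lemma t_difference_special_value:
  fixes p :: "complex poly" and a1 a2 B1 B2 t :: complex
  assumes deg: "degree p \<le> n"
    and nz: "t \<noteq> 0" "a1 \<noteq> 0" "a2 \<noteq> 0" "B1 \<noteq> 0" "B2 \<noteq> 0"
    and t: "\<And>m. m \<in> {1..n} \<Longrightarrow> t ^ m \<noteq> 1"
    and M: "M = B1 * B2 / (a1 * a2)"
    and eq: "\<And>c. (c - B1) * (c - B2) * poly p (t * c) + t * M * ((c - a1) * (c - a2)) * poly p (c / t)
       = (B1 * B2 * (1 + t) - (B1 + B2 + t * M * (a1 + a2)) * c + (t ^ n + M * t / t ^ n) * c\<^sup>2) * poly p c"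
  shows "poly p B1 * (\<Prod>r<n. 1 - t ^ (n + r) / (M * t))
    = coeff p n * (B1 ^ n * (\<Prod>r<n. (1 - a1 * t ^ r / B1) * (1 - a2 * t ^ r / B1)))"
proof -
  define x where "x j = B1 / t ^ j" for j :: nat
  define \<phi> where "\<phi> r c = (\<Prod>j<r. c - x j)" for r c
  obtain g where g: "g n = coeff p n" "\<And>c. poly p c = (\<Sum>r\<le>n. g r * \<phi> r c)"
    using newton_expansion[OF deg, of x] unfolding \<phi>_def by blast
  define L where "L c = B1 * B2 * (1 + t) - (B1 + B2 + t * M * (a1 + a2)) * c + (t ^ n + M * t / t ^ n) * c\<^sup>2" for c
  have M0: "M \<noteq> 0" using M nz by simp
  \<comment> \<open>\<open>\<mu> r\<close> is the top coefficient t^r + M t / t^r - (t^n + M t /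
    t^n) in factored form; it vanishes at r = n. \<open>\<nu> r\<close> is found by putting c = x r,
    which removes all other terms.\<close>
  define \<mu> where "\<mu> r = (t ^ r - t ^ n) * (1 - M * t / (t ^ r * t ^ n))" for r
  define \<nu> where "\<nu> r = M * (1 - t ^ Suc r) * (x r - a1) * (x r - a2) / (t ^ r * x r)" for r
  have \<phi>_up: "\<phi> r (t * c) * (c - B1) = t ^ r * \<phi> (Suc r) c" for r c
  proof -
    have "\<phi> r (t * c) = (\<Prod>j<r. t * (c - x (Suc j)))"
      unfolding \<phi>_def x_def using nz by (intro prod.cong refl) (simp add: field_simps)
    also have "\<dots> = t ^ r * (\<Prod>j<r. c - x (Suc j))" by (simp add: prod.distrib)
    finally show ?thesis
      unfolding \<phi>_def by (subst prod.lessThan_Suc_shift) (simp add: x_def mult_ac)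
  qed
  have \<phi>_down: "\<phi> (Suc r) (c / t) = (c - t * B1) * \<phi> r c / t ^ Suc r" for r c
  proof -
    have "\<phi> (Suc r) (c / t) = (c / t - B1) * (\<Prod>j<r. (c - x j) / t)"
      unfolding \<phi>_def by (subst prod.lessThan_Suc_shift) (use nz in \<open>simp add: x_def diff_divide_distrib mult.commute\<close>)
    also have "\<dots> = (c / t - B1) * (\<phi> r c / t ^ r)" by (simp add: prod_dividef \<phi>_def)
    finally show ?thesis using nz by (simp add: field_simps)
  qed
  define T where "T r c = (c - B1) * (c - B2) * \<phi> r (t * c) + t * M * ((c - a1) * (c - a2)) * \<phi> r (c / t) - L c * \<phi> r c" for r c
  have T0: "T 0 c = c\<^sup>2 * (\<mu> 0 * \<phi> 0 c)" for c
    unfolding T_def \<phi>_def \<mu>_def L_def M using nz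
    by (simp add: field_simps power2_eq_square)
  have factor: "A * (D * (E * (F * f))) + G * (H * f) - K * (N * f) = f * (A * (D * (E * F)) + G * H - K * N)"
    for A D E F G H K N f :: complex by (simp add: algebra_simps)
  have TS: "T (Suc r) c = c\<^sup>2 * (\<mu> (Suc r) * \<phi> (Suc r) c + \<nu> r * \<phi> r c)" for r c
  proof -
    define u where "u = t ^ r"
    define v where "v = t ^ n"
    have uv: "u \<noteq> 0" "v \<noteq> 0" using nz by (auto simp: u_def v_def)
    have xr: "x r = B1 / u" "x (Suc r) = B1 / (t * u)" by (simp_all add: x_def u_def)
    have s1: "\<phi> (Suc r) c = (c - B1 / u) * \<phi> r c" by (simp add: \<phi>_def xr mult.commute)
    have s2: "\<phi> (Suc (Suc r)) c = (c - B1 / (t * u)) * ((c - B1 / u) * \<phi> r c)"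
      by (simp add: \<phi>_def xr mult.commute)
    have "(c - B1) * \<phi> (Suc r) (t * c) = t * u * ((c - B1 / (t * u)) * ((c - B1 / u) * \<phi> r c))"
      using \<phi>_up[of "Suc r" c] unfolding s2 by (simp add: u_def mult.commute)
    then have "T (Suc r) c = (c - B2) * (t * u * ((c - B1 / (t * u)) * ((c - B1 / u) * \<phi> r c)))
        + t * M * ((c - a1) * (c - a2)) * ((c - t * B1) / (t * u) * \<phi> r c) - L c * ((c - B1 / u) * \<phi> r c)"
      unfolding T_def \<phi>_down s1 by (simp add: u_def mult_ac)
    also have "\<dots> = \<phi> r c * ((c - B2) * (t * u * ((c - B1 / (t * u)) * (c - B1 / u)))
        + t * M * ((c - a1) * (c - a2)) * ((c - t * B1) / (t * u)) - L c * (c - B1 / u))"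
      by (rule factor)
    also have "(c - B2) * (t * u * ((c - B1 / (t * u)) * (c - B1 / u)))
        + t * M * ((c - a1) * (c - a2)) * ((c - t * B1) / (t * u)) - L c * (c - B1 / u)
        = c\<^sup>2 * (\<mu> (Suc r) * (c - B1 / u) + \<nu> r)"
      unfolding \<mu>_def \<nu>_def xr L_def power_Suc u_def[symmetric] v_def[symmetric] M
      using nz uv by (simp add: divide_simps) (simp add: algebra_simps power2_eq_square)
    finally show ?thesis unfolding s1 by (simp add: algebra_simps)
  qed
  \<comment> \<open>The coefficient of \<open>\<phi> r\<close> in the image of \<open>p\<close>
    after division by c^2. The expansion of \<open>p\<close> stops at n, so \<open>\<nu>\<close>
    contributes only for r < n.\<close>
  define h where "h r = g r * \<mu> r + (if r < n then g (Suc r) * \<nu> r else 0)" for r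
  have n_split: "{..n} = insert n {..<n}" by auto
  have sum0: "(\<Sum>r\<le>n. h r * \<phi> r c) = 0" if "c \<noteq> 0" for c
  proof -
    have "0 = (c - B1) * (c - B2) * poly p (t * c) + t * M * ((c - a1) * (c - a2)) * poly p (c / t) - L c * poly p c"
      using eq[of c] by (simp add: L_def)
    also have "\<dots> = (\<Sum>r\<le>n. g r * T r c)"
      unfolding g(2) T_def by (simp add: sum_distrib_left sum.distrib sum_subtractf algebra_simps)
    also have "\<dots> = g 0 * T 0 c + (\<Sum>r<n. g (Suc r) * T (Suc r) c)"
      by (subst sum.atMost_shift) simp
    also have "\<dots> = c\<^sup>2 * ((g 0 * \<mu> 0 * \<phi> 0 c + (\<Sum>r<n. g (Suc r) * \<mu> (Suc r) * \<phi> (Suc r) c))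
        + (\<Sum>r<n. g (Suc r) * \<nu> r * \<phi> r c))"
      unfolding T0 TS by (simp add: sum_distrib_left sum.distrib algebra_simps)
    also have "g 0 * \<mu> 0 * \<phi> 0 c + (\<Sum>r<n. g (Suc r) * \<mu> (Suc r) * \<phi> (Suc r) c) = (\<Sum>r\<le>n. g r * \<mu> r * \<phi> r c)"
      by (subst sum.atMost_shift) simp
    also have "(\<Sum>r\<le>n. g r * \<mu> r * \<phi> r c) + (\<Sum>r<n. g (Suc r) * \<nu> r * \<phi> r c) = (\<Sum>r\<le>n. h r * \<phi> r c)"
      unfolding n_split h_def by (simp add: sum.distrib algebra_simps)
    finally show ?thesis using that by simp
  qed
  have x_ne: "x s \<noteq> x j" if "j < s" "s \<le> n" for j s
  proof
    assume "x s = x j"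
    then have "t ^ s = t ^ j" unfolding x_def using nz by (simp add: field_simps)
    then have "t ^ (s - j) * t ^ j = t ^ j" using that by (simp flip: power_add)
    moreover have "s - j \<in> {1..n}" using that by auto
    ultimately show False using t nz by simp
  qed
  have h0: "h r = 0" if "r \<le> n" for r
    using newton_coeffs_zero[of n h x r] sum0 x_ne that nz unfolding \<phi>_def by (auto simp: x_def)
  define N where "N r = (1 - a1 * t ^ r / B1) * (1 - a2 * t ^ r / B1)" for r
  define D where "D r = 1 - t ^ (n + r) / (M * t)" for r
  \<comment> \<open>This is \<open>h r = 0\<close> times a factor chosen so that the surplus factors
    cancel in the product over r < n: 1 - t^(n-r) against 1 - t^(r+1) by reversal, and t^(2r)
    against t^(n-1) by pairing r with n - 1 - r.\<close>
  have rec: "g r * ((1 - t ^ (n - r)) * (t ^ r * t ^ r) * D r) = g (Suc r) * ((1 - t ^ Suc r) * (B1 * t ^ (n - 1)) * N r)"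
    if r: "r < n" for r
  proof -
    define u where "u = t ^ r"
    define v where "v = t ^ (n - r)"
    have uv: "u \<noteq> 0" "v \<noteq> 0" "t ^ n = u * v" using nz r by (auto simp: u_def v_def simp flip: power_add)
    have tn1: "t ^ (n - 1) = u * v / t"
      using nz r uv(3) by (metis (no_types, lifting) One_nat_def Suc_pred gr_zeroI less_zeroE nonzero_mult_div_cancel_left power_Suc)
    have "g r * \<mu> r = - g (Suc r) * \<nu> r"
      using h0[of r] r by (simp add: h_def eq_neg_iff_add_eq_0)
    then have *: "g r * ((u - u * v) * (1 - M * t / (u * (u * v))))
       = - g (Suc r) * (M * (1 - t * u) * (B1 / u - a1) * (B1 / u - a2) / (u * (B1 / u)))"
      unfolding \<mu>_def \<nu>_def x_def power_Suc u_def[symmetric] uv(3) .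
    have "g r * ((1 - v) * (u * u) * (1 - u * v * u / (M * t)))
       = g r * ((u - u * v) * (1 - M * t / (u * (u * v)))) * (- u * u * u * v / (M * t))"
      using nz M0 uv by (simp add: field_simps)
    also have "\<dots> = g (Suc r) * ((1 - t * u) * (B1 * (u * v / t)) * ((1 - a1 * u / B1) * (1 - a2 * u / B1)))"
      unfolding * using nz M0 uv by (simp add: field_simps)
    finally show ?thesis
      unfolding D_def N_def power_Suc power_add u_def[symmetric] v_def[symmetric] tn1 uv(3) .
  qed
  have "g 0 * (\<Prod>r<n. (1 - t ^ (n - r)) * (t ^ r * t ^ r) * D r) = g n * (\<Prod>r<n. (1 - t ^ Suc r) * (B1 * t ^ (n - 1)) * N r)"
    using prod_telescope_recurrence[of n g, OF rec] by simp
  moreover have "(\<Prod>r<n. 1 - t ^ (n - r)) = (\<Prod>r<n. 1 - t ^ Suc r)"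
    by (subst prod.nat_diff_reindex[symmetric]) (auto intro!: prod.cong)
  moreover have "(\<Prod>r<n. t ^ r * t ^ r) = (\<Prod>r<n. t ^ (n - 1))"
  proof -
    have "(\<Prod>r<n. t ^ r * t ^ r) = (\<Prod>r<n. t ^ r) * (\<Prod>r<n. t ^ (n - Suc r))"
      by (simp only: prod.distrib prod.nat_diff_reindex)
    also have "\<dots> = (\<Prod>r<n. t ^ (n - 1))"
      by (simp only: prod.distrib[symmetric] power_add[symmetric]) (auto intro!: prod.cong)
    finally show ?thesis .
  qed
  moreover have "(\<Prod>r<n. 1 - t ^ Suc r) \<noteq> 0" using t[of "Suc _"] by (auto simp del: power_Suc)
  moreover have "(\<Prod>r<n. t ^ (n - 1)) \<noteq> 0" using nz by simp
  ultimately have "g 0 * (\<Prod>r<n. D r) = g n * (B1 ^ n * (\<Prod>r<n. N r))"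
    by (simp add: prod.distrib mult_ac del: power_Suc prod_constant)
       (use nz in \<open>simp add: mult_ac\<close>)
  moreover have "poly p B1 = g 0"
  proof -
    have "\<phi> r B1 = 0" if "0 < r" for r
      using that by (auto simp: \<phi>_def x_def intro!: bexI[of _ 0])
    then have "poly p B1 = (\<Sum>r\<in>{0}. g r * \<phi> r B1)"
      unfolding g(2) by (intro sum.mono_neutral_right) auto
    then show ?thesis by (simp add: \<phi>_def)
  qed
  ultimately show ?thesis unfolding D_def N_def g(1) by simp
qed

section \<open>Symmetrization of the shift operators\<close>

lemma lagrange_interpolation:
  fixes p :: "'a::field poly"
  assumes "finite A" "inj_on x A" "degree p < card A"
  shows "poly p c = (\<Sum>k\<in>A. poly p (x k) * (\<Prod>m\<in>A - {k}. (c - x m) / (x k - x m)))"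
proof -
  define l where "l k = (\<Prod>m\<in>A - {k}. smult (inverse (x k - x m)) [:- x m, 1:])" for k
  have poly_l: "poly (l k) c = (\<Prod>m\<in>A - {k}. (c - x m) / (x k - x m))" for k c
    unfolding l_def poly_prod by (intro prod.cong refl) (simp add: divide_simps)
  have deg_l: "degree (l k) < card A" if "k \<in> A" for k
  proof -
    have "degree (l k) \<le> (\<Sum>m\<in>A - {k}. degree (smult (inverse (x k - x m)) [:- x m, 1:]))"
      unfolding l_def using assms(1) by (intro order.trans[OF degree_prod_sum_le]) auto
    also have "\<dots> \<le> (\<Sum>m\<in>A - {k}. 1)"
      by (intro sum_mono order.trans[OF degree_smult_le]) simp
    also have "\<dots> < card A" using card_Diff1_less[OF assms(1) that] by simp
    finally show ?thesis .
  qed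
  define r where "r = (\<Sum>k\<in>A. smult (poly p (x k)) (l k))"
  have "degree r < card A"
    unfolding r_def using assms(1,3) deg_l
    by (intro degree_sum_less) (auto intro: le_less_trans[OF degree_smult_le])
  moreover have "poly p (x j) = poly r (x j)" if "j \<in> A" for j
  proof -
    have "poly (l k) (x j) = (if k = j then 1 else 0)" if "k \<in> A" for k
    proof (cases "k = j")
      case True
      have "(x j - x m) / (x k - x m) = 1" if "m \<in> A - {k}" for m
        using inj_onD[OF assms(2), of j m] that \<open>j \<in> A\<close> True by auto
      then show ?thesis unfolding poly_l using True by simp
    next
      case False
      then show ?thesis unfolding poly_l using \<open>j \<in> A\<close> assms(1) by auto
    qed
    then show ?thesis
      unfolding r_def using that assms(1) by (simp add: poly_sum if_distrib[of "(*) _"] sum.delta cong: if_cong)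
  qed
  moreover have "card (x ` A) = card A" using assms(2) by (simp add: card_image)
  ultimately have "p = r"
    using assms(3) by (intro poly_eqI_degree[of "x ` A"]) auto
  then have "poly p c = poly r c" by simp
  then show ?thesis unfolding r_def by (simp add: poly_sum poly_l)
qed

lemma degree_prod_linear_le:
  fixes w :: "'b \<Rightarrow> 'a::comm_ring_1"
  assumes "finite A"
  shows "degree (\<Prod>m\<in>A. [:x * w m, y:]) \<le> card A"
proof -
  have "degree (\<Prod>m\<in>A. [:x * w m, y:]) \<le> (\<Sum>m\<in>A. degree [:x * w m, y:])"
    using assms by (intro order.trans[OF degree_prod_sum_le]) auto
  also have "\<dots> \<le> (\<Sum>m\<in>A. 1)" by (intro sum_mono) simp
  finally show ?thesis by simp
qed

lemma coeff_prod_linear: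
  fixes w :: "'b \<Rightarrow> 'a::comm_ring_1"
  assumes "finite A"
  shows "coeff (\<Prod>m\<in>A. [:x * w m, y:]) 0 = x ^ card A * (\<Prod>m\<in>A. w m)"
    and "coeff (\<Prod>m\<in>A. [:x * w m, y:]) (card A) = y ^ card A"
proof -
  show "coeff (\<Prod>m\<in>A. [:x * w m, y:]) 0 = x ^ card A * (\<Prod>m\<in>A. w m)"
    using assms by (induction A rule: finite_induct) (simp_all add: mult_ac)
  show "coeff (\<Prod>m\<in>A. [:x * w m, y:]) (card A) = y ^ card A"
    using assms
  proof (induction A rule: finite_induct)
    case (insert k A)
    have "coeff (\<Prod>m\<in>A. [:x * w m, y:]) (Suc (card A)) = 0"
      using degree_prod_linear_le[OF insert(1), of x w y] by (intro coeff_eq_0) simp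
    then show ?case using insert by simp
  qed simp
qed

text \<open>\<open>E\<close> is the elementary symmetric polynomial of degree
  \<open>card A - 1\<close> in the values of \<open>w\<close> (0 for empty \<open>A\<close>). It is
  the same for all x and y, so the linear coefficients of three different products can be
  compared.\<close>

lemma coeff_1_prod_linear:
  fixes w :: "'b \<Rightarrow> 'a::comm_ring_1"
  assumes "finite A"
  shows "\<exists>E. \<forall>x y. coeff (\<Prod>m\<in>A. [:x * w m, y:]) 1 = x ^ (card A - 1) * y * E"
  using assms
proof (induction A rule: finite_induct)
  case empty
  then show ?case by (intro exI[of _ 0]) simp
next
  case (insert k A)
  then obtain E where E: "\<And>x y. coeff (\<Prod>m\<in>A. [:x * w m, y:]) 1 = x ^ (card A - 1) * y * E"
    by blast
  show ?case
  proof (cases "A = {}")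
    case True
    then show ?thesis by (intro exI[of _ 1]) simp
  next
    case False
    then have "card A \<noteq> 0" using insert by simp
    then obtain c where c: "card A = Suc c" using not0_implies_Suc by blast
    show ?thesis
    proof (intro exI[of _ "w k * E + (\<Prod>m\<in>A. w m)"] allI)
      fix x y
      show "coeff (\<Prod>m\<in>insert k A. [:x * w m, y:]) 1
          = x ^ (card (insert k A) - 1) * y * (w k * E + (\<Prod>m\<in>A. w m))"
        using insert c coeff_prod_linear(1)[OF insert(1), of x w y] E[of x y]
        by (simp add: algebra_simps)
    qed
  qed
qed

lemma coeff_quadratic_mult:
  fixes p :: "'a::comm_ring_1 poly"
  shows "coeff ([:u, v, s:] * p) 0 = u * coeff p 0"
    and "coeff ([:u, v, s:] * p) 1 = u * coeff p 1 + v * coeff p 0"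
    and "degree p \<le> n \<Longrightarrow> coeff ([:u, v, s:] * p) (Suc (Suc n)) = s * coeff p n"
    and "degree p \<le> n \<Longrightarrow> degree ([:u, v, s:] * p) \<le> Suc (Suc n)"
proof -
  assume p: "degree p \<le> n"
  then have z: "coeff p (Suc n) = 0" "coeff p (Suc (Suc n)) = 0" by (auto intro: coeff_eq_0)
  show "coeff ([:u, v, s:] * p) (Suc (Suc n)) = s * coeff p n"
    by (simp add: z)
  show "degree ([:u, v, s:] * p) \<le> Suc (Suc n)"
    using order.trans[OF degree_mult_le[of "[:u, v, s:]" p] add_mono[OF _ p, of _ 2]]
    by (simp add: numeral_2_eq_2)
qed simp_all

text \<open>Apart from the sign, the right-hand side is a polynomial P in c. The hypothesis on
  \<kappa> and the shape of the quadratic kill its coefficients at 0, 1 and n + 2, where n =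
  \<open>card A\<close>. So P = c^2 S with degree of S below n, and the left-hand side is the
  Lagrange interpolation of S at the nodes \<open>w k\<close>, where the third product
  vanishes.\<close>

lemma shift_operator_symmetrization:
  fixes w :: "nat \<Rightarrow> complex"
  assumes fin: "finite A" "A \<noteq> {}" and inj: "inj_on w A" and w0: "\<And>k. k \<in> A \<Longrightarrow> w k \<noteq> 0"
    and \<kappa>: "\<kappa> * (a1 * a2) * t ^ card A = t * (B1 * B2)" and t0: "t \<noteq> 0"
  shows "(1 - t) * c\<^sup>2 * (\<Sum>k\<in>A.
        (w k - B1) * (w k - B2) / w k * (\<Prod>m\<in>A - {k}. (w m - t * w k) / (w k - w m) * (w m - c))
        - \<kappa> * ((w k - a1) * (w k - a2)) / w k * (\<Prod>m\<in>A - {k}. (t * w m - w k) / (w k - w m) * (w m - c)))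
    = (-1) ^ (card A - 1) * ((c - B1) * (c - B2) * (\<Prod>m\<in>A. w m - t * c)
        + \<kappa> * ((c - a1) * (c - a2)) * (\<Prod>m\<in>A. t * w m - c)
        - (B1 * B2 * (1 + t) - (B1 + B2 + \<kappa> * t ^ card A * (a1 + a2)) * c + (t ^ card A + \<kappa>) * c\<^sup>2)
          * (\<Prod>m\<in>A. w m - c))"
proof -
  define n where "n = card A"
  have n: "n \<noteq> 0" using fin by (simp add: n_def)
  define P1 where "P1 = (\<Prod>m\<in>A. [:1 * w m, - t:])"
  define P2 where "P2 = (\<Prod>m\<in>A. [:t * w m, - 1:])"
  define P3 where "P3 = (\<Prod>m\<in>A. [:1 * w m, - 1:])"
  define P where "P = [:B1 * B2, - (B1 + B2), 1:] * P1
      + ([:\<kappa> * (a1 * a2), - (\<kappa> * (a1 + a2)), \<kappa>:] * P2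
      - [:B1 * B2 * (1 + t), - (B1 + B2 + \<kappa> * t ^ n * (a1 + a2)), t ^ n + \<kappa>:] * P3)"
  have P_eval: "poly P c = (c - B1) * (c - B2) * (\<Prod>m\<in>A. w m - t * c)
        + \<kappa> * ((c - a1) * (c - a2)) * (\<Prod>m\<in>A. t * w m - c)
        - (B1 * B2 * (1 + t) - (B1 + B2 + \<kappa> * t ^ n * (a1 + a2)) * c + (t ^ n + \<kappa>) * c\<^sup>2)
          * (\<Prod>m\<in>A. w m - c)" for c
  proof -
    have "poly P1 c = (\<Prod>m\<in>A. w m - t * c)" "poly P2 c = (\<Prod>m\<in>A. t * w m - c)" "poly P3 c = (\<Prod>m\<in>A. w m - c)"
      by (simp_all add: P1_def P2_def P3_def poly_prod mult.commute)
    then show ?thesis unfolding P_def by (simp add: algebra_simps power2_eq_square)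
  qed
  obtain E where E: "\<And>x y. coeff (\<Prod>m\<in>A. [:x * w m, y:]) 1 = x ^ (n - 1) * y * E"
    using coeff_1_prod_linear[OF fin(1), of w] unfolding n_def by blast
  have deg: "degree P1 \<le> n" "degree P2 \<le> n" "degree P3 \<le> n"
    unfolding P1_def P2_def P3_def n_def using degree_prod_linear_le[OF fin(1)] by blast+
  define W where "W = (\<Prod>m\<in>A. w m)"
  have c0: "coeff P1 0 = W" "coeff P2 0 = t ^ n * W" "coeff P3 0 = W"
    unfolding P1_def P2_def P3_def n_def coeff_prod_linear(1)[OF fin(1)] W_def by simp_all
  have c1: "coeff P1 1 = - (t * E)" "coeff P2 1 = - (t ^ (n - 1) * E)" "coeff P3 1 = - E"
    unfolding P1_def P2_def P3_def E by simp_all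
  have cn: "coeff P1 n = (- t) ^ n" "coeff P2 n = (-1) ^ n" "coeff P3 n = (-1) ^ n"
    unfolding P1_def P2_def P3_def n_def coeff_prod_linear(2)[OF fin(1)] by simp_all
  have \<kappa>': "\<kappa> * (a1 * a2) * t ^ n = t * (B1 * B2)" using \<kappa> by (simp add: n_def)
  have \<kappa>'': "\<kappa> * (a1 * a2) * t ^ (n - 1) = B1 * B2"
    using \<kappa>' n t0 by (cases n) (simp_all add: mult_ac)
  have "coeff P 0 = B1 * B2 * W + (\<kappa> * (a1 * a2) * t ^ n) * W - B1 * B2 * (1 + t) * W"
    unfolding P_def coeff_add coeff_diff coeff_quadratic_mult c0 by simp
  also have "\<dots> = 0" unfolding \<kappa>' by (simp add: algebra_simps)
  finally have P0: "coeff P 0 = 0" .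
  have "coeff P 1 = B1 * B2 * (E - t * E) + (B1 * B2 * t * E - (\<kappa> * (a1 * a2) * t ^ (n - 1)) * E)"
    unfolding P_def coeff_add coeff_diff coeff_quadratic_mult(2) c0 c1 by (simp add: algebra_simps)
  also have "\<dots> = 0" unfolding \<kappa>'' by (simp add: algebra_simps)
  finally have P1: "coeff P 1 = 0" .
  have "coeff P (Suc (Suc n)) = 0"
    unfolding P_def coeff_add coeff_diff coeff_quadratic_mult(3)[OF deg(1)] coeff_quadratic_mult(3)[OF deg(2)]
      coeff_quadratic_mult(3)[OF deg(3)] cn
    by (simp add: algebra_simps flip: power_mult_distrib)
  moreover have "degree P \<le> Suc (Suc n)"
    unfolding P_def by (intro degree_add_le degree_diff_le coeff_quadratic_mult(4) deg)
  ultimately have degP: "degree P \<le> Suc n"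
    by (metis degree_0 le_SucE leading_coeff_0_iff zero_le)
  obtain S where S: "P = pCons 0 (pCons 0 S)"
  proof -
    obtain x R where R: "P = pCons x R" by (cases P)
    obtain y S where S: "R = pCons y S" by (cases R)
    have "x = 0" "y = 0" using P0 P1 unfolding R S by simp_all
    then show ?thesis using that R S by blast
  qed
  have PS: "poly P c = c\<^sup>2 * poly S c" for c unfolding S by (simp add: power2_eq_square)
  have degS: "degree S < n"
    using degP n unfolding S by (cases "S = 0") auto
  \<comment> \<open>The value of P at \<open>w k\<close> without the factor m = k. That factor is (1
    - t) w k in the first product and -(1 - t) w k in the second, whence the minus sign.\<close>
  define br where "br k = (w k - B1) * (w k - B2) * (\<Prod>m\<in>A - {k}. w m - t * w k)
      - \<kappa> * ((w k - a1) * (w k - a2)) * (\<Prod>m\<in>A - {k}. t * w m - w k)" for k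
  have P_node: "poly S (w k) = (1 - t) * (br k / w k)" if k: "k \<in> A" for k
  proof -
    have z: "(\<Prod>m\<in>A. w m - w k) = 0" using fin k by auto
    have "poly P (w k) = (1 - t) * w k * br k"
      unfolding P_eval br_def z prod.remove[OF fin(1) k] by (simp add: algebra_simps)
    then have "poly S (w k) * (w k)\<^sup>2 = (1 - t) * w k * br k" unfolding PS by (simp add: mult.commute)
    then have "poly S (w k) = (1 - t) * w k * br k / (w k)\<^sup>2" using w0[OF k] by (simp add: eq_divide_eq)
    then show ?thesis using w0[OF k] by (simp add: power2_eq_square)
  qed
  define X where "X k = (w k - B1) * (w k - B2) / w k * (\<Prod>m\<in>A - {k}. (w m - t * w k) / (w k - w m) * (w m - c))
        - \<kappa> * ((w k - a1) * (w k - a2)) / w k * (\<Prod>m\<in>A - {k}. (t * w m - w k) / (w k - w m) * (w m - c))" for k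
  have "(\<Sum>k\<in>A. (1 - t) * X k)
    = (\<Sum>k\<in>A. (-1) ^ (n - 1) * (poly S (w k) * (\<Prod>m\<in>A - {k}. (c - w m) / (w k - w m))))"
  proof (rule sum.cong[OF refl])
    fix k assume k: "k \<in> A"
    have "card (A - {k}) = n - 1" using k fin by (simp add: n_def)
    note card_remove = this
    \<comment> \<open>The n - 1 differences stand as w m - c in the claim and as c - w m in the
      interpolation formula.\<close>
    have sgn: "(-1) ^ (n - 1) * (\<Prod>m\<in>A - {k}. (c - w m) / (w k - w m)) = (\<Prod>m\<in>A - {k}. (w m - c) / (w k - w m))"
      unfolding card_remove[symmetric] prod_uminus[symmetric] minus_divide_left minus_diff_eq
      by (rule refl)
    have factor: "(1 - t) * (p / z * (X * V) - s / z * (Y * V)) = (1 - t) * ((p * X - s * Y) / z) * V"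
      for p z X V s Y :: complex by (simp add: diff_divide_distrib algebra_simps)
    have fac: "(\<Prod>m\<in>A - {k}. f m / (w k - w m) * (w m - c))
        = (\<Prod>m\<in>A - {k}. f m) * (\<Prod>m\<in>A - {k}. (w m - c) / (w k - w m))" for f
      by (simp flip: prod.distrib)
    show "(1 - t) * X k = (-1) ^ (n - 1) * (poly S (w k) * (\<Prod>m\<in>A - {k}. (c - w m) / (w k - w m)))"
      unfolding fac mult.left_commute[of "(-1) ^ (n - 1)"] sgn P_node[OF k] br_def X_def
      by (rule factor)
  qed
  also have "\<dots> = (-1) ^ (n - 1) * poly S c"
    unfolding sum_distrib_left[symmetric] using lagrange_interpolation[OF fin(1) inj degS[unfolded n_def], of c] by simp
  finally have X: "(1 - t) * (\<Sum>k\<in>A. X k) = (-1) ^ (n - 1) * poly S c"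
    unfolding sum_distrib_left .
  have "(1 - t) * c\<^sup>2 * (\<Sum>k\<in>A. X k) = c\<^sup>2 * ((1 - t) * (\<Sum>k\<in>A. X k))"
    by (simp only: mult_ac)
  also have "\<dots> = (-1) ^ (n - 1) * poly P c"
    unfolding X PS by (simp only: mult_ac)
  finally show ?thesis unfolding X_def P_eval n_def .
qed

text \<open>Spreads a product over the partners of k over all pairs j < l, with 1 at the pairs that
  avoid k. Products over pairs can then be compared factor by factor.\<close>

lemma prod_pairs_containing:
  fixes c :: "nat \<Rightarrow> 'a::comm_monoid_mult"
  assumes k: "k \<in> {1..n}"
  shows "(\<Prod>j=1..n. \<Prod>l=Suc j..n. if j = k then c l else if l = k then c j else 1) = (\<Prod>m\<in>{1..n} - {k}. c m)"
proof -
  have "(\<Prod>l=Suc j..n. if j = k then c l else if l = k then c j else 1)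
      = (if j = k then \<Prod>l=Suc k..n. c l else if j < k then c j else 1)" if "j \<in> {1..n}" for j
    using k that by (cases "j = k") (auto simp: prod.delta)
  then have "(\<Prod>j=1..n. \<Prod>l=Suc j..n. if j = k then c l else if l = k then c j else 1)
      = (\<Prod>j=1..n. if j = k then \<Prod>l=Suc k..n. c l else if j < k then c j else 1)"
    by (intro prod.cong) auto
  also have "\<dots> = (\<Prod>l=Suc k..n. c l) * (\<Prod>j\<in>{1..n} - {k}. if j < k then c j else 1)"
    using k by (subst prod.remove[of _ k]) (auto intro!: arg_cong2[where f="(*)"] prod.cong)
  also have "(\<Prod>j\<in>{1..n} - {k}. if j < k then c j else 1) = (\<Prod>j=1..<k. c j)"
    using k by (intro prod.mono_neutral_cong_right) auto
  also have "(\<Prod>l=Suc k..n. c l) * (\<Prod>j=1..<k. c j) = (\<Prod>m\<in>{1..n} - {k}. c m)"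
    using k by (subst prod.union_disjoint[symmetric]) (auto intro!: prod.cong)
  finally show ?thesis .
qed

text \<open>Moving coordinate k changes only the pairs that contain k. Both \<open>d\<close> and
  \<open>e\<close> are indexed by the partner alone, so k may stand first or second in the
  pair.\<close>

lemma prod_pairs_shift:
  fixes f f' :: "nat \<Rightarrow> nat \<Rightarrow> 'a::comm_monoid_mult"
  assumes k: "k \<in> {1..n}"
    and fst: "\<And>l. k < l \<Longrightarrow> l \<le> n \<Longrightarrow> f' k l * d l = f k l * e l"
    and snd: "\<And>j. 1 \<le> j \<Longrightarrow> j < k \<Longrightarrow> f' j k * d j = f j k * e j"
    and other: "\<And>j l. 1 \<le> j \<Longrightarrow> j < l \<Longrightarrow> l \<le> n \<Longrightarrow> j \<noteq> k \<Longrightarrow> l \<noteq> k \<Longrightarrow> f' j l = f j l"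
  shows "(\<Prod>j=1..n. \<Prod>l=Suc j..n. f' j l) * (\<Prod>m\<in>{1..n} - {k}. d m)
    = (\<Prod>j=1..n. \<Prod>l=Suc j..n. f j l) * (\<Prod>m\<in>{1..n} - {k}. e m)"
  unfolding prod_pairs_containing[OF k, symmetric] prod.distrib[symmetric]
  using k fst snd other by (intro prod.cong refl) auto

section \<open>Powers and theta products\<close>

lemma qpow_nonzero [simp]: "0 < q \<Longrightarrow> qpow q s \<noteq> 0"
  by (simp add: qpow_def)

lemma qpow_add: "qpow q (x + y) = qpow q x * qpow q y"
  by (simp add: qpow_def powr_add)

lemma qpow_diff: "qpow q (x - y) = qpow q x / qpow q y"
  by (simp add: qpow_def powr_diff)

lemma qpow_0 [simp]: "0 < q \<Longrightarrow> qpow q 0 = 1"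
  by (simp add: qpow_def)

lemma qpow_1 [simp]: "0 < q \<Longrightarrow> qpow q 1 = complex_of_real q"
  by (simp add: qpow_def)

lemma qpow_int_mult: "0 < q \<Longrightarrow> qpow q (of_int l * s) = qpow q s powi l"
  by (simp add: qpow_def powr_def exp_power_int mult.assoc)

lemma qpow_of_int: "0 < q \<Longrightarrow> qpow q (of_int l) = complex_of_real q powi l"
  using qpow_int_mult[of q l 1] by simp

lemma qpoch_convergent:
  assumes "0 < q" "q < 1"
  shows "convergent_prod (\<lambda>i. 1 - complex_of_real q ^ i * a)"
proof (rule abs_convergent_prod_imp_convergent_prod)
  have "summable (\<lambda>i. norm (complex_of_real q ^ i * a))"
    using assms by (simp add: norm_mult norm_power summable_mult2 summable_geometric)
  then show "abs_convergent_prod (\<lambda>i. 1 - complex_of_real q ^ i * a)"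
    by (intro summable_imp_abs_convergent_prod) simp
qed

lemma qpoch_inf_step:
  assumes "0 < q" "q < 1"
  shows "qpoch_inf q a = (1 - a) * qpoch_inf q (complex_of_real q * a)"
proof -
  let ?Q = "complex_of_real q"
  have "(\<lambda>n. \<Prod>i\<le>n. 1 - ?Q ^ i * (?Q * a)) \<longlonglongrightarrow> qpoch_inf q (?Q * a)"
    unfolding qpoch_inf_def using assms by (intro convergent_prod_LIMSEQ qpoch_convergent)
  then have "(\<lambda>n. (1 - a) * (\<Prod>i\<le>n. 1 - ?Q ^ i * (?Q * a))) \<longlonglongrightarrow> (1 - a) * qpoch_inf q (?Q * a)"
    by (intro tendsto_mult_left)
  also have "(\<lambda>n. (1 - a) * (\<Prod>i\<le>n. 1 - ?Q ^ i * (?Q * a))) = (\<lambda>n. \<Prod>i\<le>Suc n. 1 - ?Q ^ i * a)"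
    by (subst prod.atMost_Suc_shift) (simp add: mult_ac)
  finally have "(\<lambda>n. \<Prod>i\<le>Suc n. 1 - ?Q ^ i * a) \<longlonglongrightarrow> (1 - a) * qpoch_inf q (?Q * a)" .
  then have "(\<lambda>n. \<Prod>i\<le>n. 1 - ?Q ^ i * a) \<longlonglongrightarrow> (1 - a) * qpoch_inf q (?Q * a)"
    by (rule LIMSEQ_imp_Suc)
  moreover have "(\<lambda>n. \<Prod>i\<le>n. 1 - ?Q ^ i * a) \<longlonglongrightarrow> qpoch_inf q a"
    unfolding qpoch_inf_def using assms by (intro convergent_prod_LIMSEQ qpoch_convergent)
  ultimately show ?thesis using LIMSEQ_unique by blast
qed

text \<open>The factor with index -l is 1 - 1, and a zero factor makes a convergent infinite product
  0. This is the source of the truncation of the lattice sum.\<close>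

lemma qpoch_inf_eq_0:
  assumes "0 < q" "q < 1" "l \<le> 0"
  shows "qpoch_inf q (complex_of_real q powi l) = 0"
proof -
  let ?Q = "complex_of_real q"
  have "?Q ^ nat (- l) * ?Q powi l = ?Q powi (- l) * ?Q powi l"
    using assms(3) by (simp add: power_int_def)
  also have "\<dots> = 1" using assms(1) by (simp add: power_int_minus)
  finally have "1 - ?Q ^ nat (- l) * ?Q powi l = 0" by simp
  then show ?thesis
    unfolding qpoch_inf_def
    using has_prod_zeroI[OF convergent_prod_has_prod[OF qpoch_convergent[OF assms(1,2)]]] by blast
qed

lemma q_lattice_powi: "complex_of_real q powi l \<in> q_lattice q"
  by (simp add: q_lattice_def)

lemma q_lattice_mult_iff:
  assumes "0 < q"
  shows "x * complex_of_real q powi l \<in> q_lattice q \<longleftrightarrow> x \<in> q_lattice q"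
proof
  assume "x * complex_of_real q powi l \<in> q_lattice q"
  then obtain k where "x * complex_of_real q powi l = complex_of_real q powi k"
    by (auto simp: q_lattice_def)
  then have "x = complex_of_real q powi (k - l)"
    using assms by (simp add: power_int_diff field_simps)
  then show "x \<in> q_lattice q" by (simp add: q_lattice_powi)
next
  assume "x \<in> q_lattice q"
  then obtain k where "x = complex_of_real q powi k" by (auto simp: q_lattice_def)
  then have "x * complex_of_real q powi l = complex_of_real q powi (k + l)"
    using assms by (simp add: power_int_add)
  then show "x * complex_of_real q powi l \<in> q_lattice q" by (simp add: q_lattice_powi)
qed

lemma q_lattice_inverse_iff: "inverse x \<in> q_lattice q \<longleftrightarrow> x \<in> q_lattice q"
proof -
  have "inverse x \<in> q_lattice q" if x: "x \<in> q_lattice q" for x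
  proof -
    obtain k where "x = complex_of_real q powi k" using x by (auto simp: q_lattice_def)
    then have "inverse x = complex_of_real q powi (- k)" by (simp add: power_int_minus)
    then show ?thesis using q_lattice_powi by metis
  qed
  from this[of x] this[of "inverse x"] show ?thesis by auto
qed

lemma one_in_q_lattice: "1 \<in> q_lattice q"
  using q_lattice_powi[of q 0] by simp

text \<open>The numbers x q^l accumulate only at 0 and at infinity. Once |x| q^l is at most 1/2 or
  at least 2, the distance to 1 is at least 1/2, and the finitely many other distances are positive.
  The resulting bound is uniform in l, as estimates over the lattice require.\<close>

lemma bounded_away_from_lattice:
  assumes q: "0 < q" "q < 1" and x: "x \<notin> q_lattice q"
  shows "\<exists>\<delta>>0. \<forall>l::int. \<delta> \<le> norm (1 - x * complex_of_real q powi l)"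
proof (cases "x = 0")
  case True
  then show ?thesis by (intro exI[of _ 1]) auto
next
  case False
  define f where "f l = norm (1 - x * complex_of_real q powi l)" for l :: int
  obtain L where L: "q ^ L < 1 / (2 * norm x)"
    using real_arch_pow_inv[of "1 / (2 * norm x)" q] q False by auto
  obtain K where K: "q ^ K < norm x / 2"
    using real_arch_pow_inv[of "norm x / 2" q] q False by auto
  have f_ge: "f l \<ge> \<bar>1 - norm x * q powi l\<bar>" for l
    unfolding f_def using norm_triangle_ineq3[of 1 "x * complex_of_real q powi l"] q
    by (simp add: norm_mult norm_power_int)
  have nz: "f l > 0" for l
  proof -
    have "x * complex_of_real q powi l \<noteq> 1"
      using x one_in_q_lattice[of q] q_lattice_mult_iff[OF q(1), of x l] by auto
    then show ?thesis by (simp add: f_def)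
  qed
  define m where "m = Min (insert (1 / 2) (f ` {- int K .. int L}))"
  have "m > 0" unfolding m_def using nz by (subst Min_gr_iff) auto
  moreover have "m \<le> f l" for l
  proof -
    consider "l \<in> {- int K .. int L}" | "l > int L" | "l < - int K" by fastforce
    then show ?thesis
    proof cases
      case 1
      then show ?thesis unfolding m_def by (intro Min_le) auto
    next
      case 2
      have "q powi l \<le> q powi int L" using q 2 by (intro power_int_decreasing) auto
      then have "norm x * q powi l \<le> norm x * (1 / (2 * norm x))"
        using L by (intro mult_left_mono) auto
      then have "norm x * q powi l \<le> 1 / 2" using False by simp
      then have "1 / 2 \<le> f l" using f_ge[of l] by linarith
      moreover have "m \<le> 1 / 2" unfolding m_def by (intro Min_le) auto
      ultimately show ?thesis by linarith
    next
      case 3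
      have "q powi (- int K) \<le> q powi l" using q 3 by (intro power_int_decreasing) auto
      moreover have "2 / norm x < q powi (- int K)"
        using K q False by (simp add: power_int_minus field_simps)
      ultimately have "norm x * (2 / norm x) \<le> norm x * q powi l"
        by (intro mult_left_mono) auto
      then have "2 \<le> norm x * q powi l" using False by simp
      then have "1 / 2 \<le> f l" using f_ge[of l] by linarith
      moreover have "m \<le> 1 / 2" unfolding m_def by (intro Min_le) auto
      ultimately show ?thesis by linarith
    qed
  qed
  ultimately show ?thesis unfolding f_def by blast
qed

lemma qtheta_shift:
  assumes "0 < q" "q < 1" "u \<noteq> 0"
  shows "qtheta q (complex_of_real q * u) = - qtheta q u / u"
proof -
  let ?Q = "complex_of_real q"
  have Q: "?Q \<noteq> 0" using assms by simp
  have 1: "qpoch_inf q u = (1 - u) * qpoch_inf q (?Q * u)"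
    by (rule qpoch_inf_step[OF assms(1,2)])
  have 2: "qpoch_inf q (?Q / (?Q * u)) = (1 - 1 / u) * qpoch_inf q (?Q / u)"
    using qpoch_inf_step[OF assms(1,2), of "1 / u"] Q by simp
  show ?thesis
    unfolding qtheta_def 1 2 using assms(3) by (simp add: field_simps)
qed

section \<open>The factors of the summand under shifts\<close>

text \<open>The pair factor includes the corresponding factor of the Vandermonde product.\<close>

definition J_single ::
    "real \<Rightarrow> nat \<Rightarrow> (nat \<Rightarrow> complex) \<Rightarrow> (nat \<Rightarrow> complex) \<Rightarrow> complex \<Rightarrow> complex \<Rightarrow> complex" where
  "J_single q n \<alpha> \<beta> \<tau> x = qpow q (lead_exponent n \<alpha> \<beta> \<tau> * x)
     * (qpoch_inf q (complex_of_real q * inverse (qpow q (\<beta> 1)) * qpow q x)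
        * qpoch_inf q (complex_of_real q * inverse (qpow q (\<beta> 2)) * qpow q x))
     / (qpoch_inf q (qpow q (\<alpha> 1) * qpow q x) * qpoch_inf q (qpow q (\<alpha> 2) * qpow q x))"

definition J_pair :: "real \<Rightarrow> complex \<Rightarrow> complex \<Rightarrow> complex \<Rightarrow> complex" where
  "J_pair q \<tau> x y = qpow q ((2 * \<tau> - 1) * x)
     * qpoch_inf q (complex_of_real q * inverse (qpow q \<tau>) * qpow q y / qpow q x)
     / qpoch_inf q (qpow q \<tau> * qpow q y / qpow q x) * (qpow q x - qpow q y)"

lemma J_term_factorization:
  "J_term q n \<alpha> \<beta> \<tau> \<xi> \<nu> = (\<Prod>m=1..n. J_single q n \<alpha> \<beta> \<tau> (\<xi> m + of_int (\<nu> m)))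
     * (\<Prod>j=1..n. \<Prod>l=Suc j..n. J_pair q \<tau> (\<xi> j + of_int (\<nu> j)) (\<xi> l + of_int (\<nu> l)))"
  unfolding J_term_def Phi_bar_def Let_def Vandermonde_Delta_def J_single_def J_pair_def
  by (simp only: prod.distrib mult.assoc)

lemma J_term_cong:
  assumes "\<And>m. m \<in> {1..n} \<Longrightarrow> \<xi> m + of_int (\<nu> m) = \<xi>' m + of_int (\<nu>' m)"
  shows "J_term q n \<alpha> \<beta> \<tau> \<xi> \<nu> = J_term q n \<alpha> \<beta> \<tau> \<xi>' \<nu>'"
  unfolding J_term_factorization using assms by (intro arg_cong2[where f="(*)"] prod.cong) auto

lemma lead_exponent_shift:
  assumes "j \<in> {1, 2}"
  shows "lead_exponent n (\<alpha>(j := \<alpha> j + 1)) \<beta> \<tau> = lead_exponent n \<alpha> \<beta> \<tau> - 1"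
    and "lead_exponent n \<alpha> (\<beta>(j := \<beta> j + 1)) \<tau> = lead_exponent n \<alpha> \<beta> \<tau> - 1"
  using assms by (auto simp: lead_exponent_def)

lemma qpow_lead_exponent:
  assumes "0 < q" "1 \<le> n"
  shows "qpow q (lead_exponent n \<alpha> \<beta> \<tau>)
    = complex_of_real q / (qpow q (\<alpha> 1) * qpow q (\<alpha> 2) * qpow q (\<beta> 1) * qpow q (\<beta> 2) * (qpow q \<tau> ^ (n - 1))\<^sup>2)"
proof -
  have "2 * (of_nat n - 1) * \<tau> = of_int (2 * (int n - 1)) * \<tau>" by simp
  then have "qpow q (2 * (of_nat n - 1) * \<tau>) = qpow q \<tau> powi (2 * (int n - 1))"
    using qpow_int_mult[OF assms(1)] by metis
  also have "2 * (int n - 1) = int (2 * (n - 1))" using assms(2) by simp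
  also have "qpow q \<tau> powi int (2 * (n - 1)) = qpow q \<tau> ^ (2 * (n - 1))" by (rule power_int_of_nat)
  finally show ?thesis
    unfolding lead_exponent_def qpow_diff using assms(1) by (simp add: power_even_eq)
qed

text \<open>The lead exponent drops by 1, which gives 1/z, and the denominator loses its factor 1 -
  a z; together they give 1/z - a.\<close>

lemma J_single_shift_alpha:
  assumes "0 < q" "q < 1" "j \<in> {1, 2}" and pole: "qpow q (\<alpha> j) * qpow q x \<noteq> 1"
  shows "J_single q n (\<alpha>(j := \<alpha> j + 1)) \<beta> \<tau> x = (inverse (qpow q x) - qpow q (\<alpha> j)) * J_single q n \<alpha> \<beta> \<tau> x"
proof -
  let ?z = "qpow q x" and ?a = "qpow q (\<alpha> j)" and ?l = "lead_exponent n \<alpha> \<beta> \<tau>"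
  have l: "qpow q ((?l - 1) * x) = qpow q (?l * x) / ?z"
    by (simp add: left_diff_distrib qpow_diff)
  have "qpow q (\<alpha> j + 1) * ?z = complex_of_real q * (?a * ?z)"
    using assms(1) by (simp add: qpow_add)
  note e = this
  have p: "qpoch_inf q (?a * ?z) = (1 - ?a * ?z) * qpoch_inf q (qpow q (\<alpha> j + 1) * ?z)"
    unfolding e by (rule qpoch_inf_step[OF assms(1,2)])
  have w: "inverse ?z - ?a = (1 - ?a * ?z) / ?z" using assms(1) by (simp add: field_simps)
  have nz: "1 - ?a * ?z \<noteq> 0" using pole by simp
  have cancel: "(e / z) * B / (P * R) = (d / z) * (e * B / ((d * P) * R))"
    "(e / z) * B / (R * P) = (d / z) * (e * B / (R * (d * P)))" if "d \<noteq> 0" for e z B P R d :: complex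
    using that by simp_all
  show ?thesis
  proof (cases "j = 1")
    case True
    show ?thesis
      unfolding J_single_def lead_exponent_shift(1)[OF assms(3)] l w
      using True p nz cancel by simp
  next
    case False
    then have "j = 2" using assms(3) by simp
    then show ?thesis
      unfolding J_single_def lead_exponent_shift(1)[OF assms(3)] l w using p nz cancel by simp
  qed
qed

text \<open>Again the exponent gives 1/z, but now the numerator gains 1 - z/b. No division by this
  factor occurs, so z = b is allowed.\<close>

lemma J_single_shift_beta:
  assumes "0 < q" "q < 1" "j \<in> {1, 2}"
  shows "J_single q n \<alpha> (\<beta>(j := \<beta> j + 1)) \<tau> x
    = (inverse (qpow q x) - inverse (qpow q (\<beta> j))) * J_single q n \<alpha> \<beta> \<tau> x"
proof -
  let ?z = "qpow q x" and ?b = "qpow q (\<beta> j)" and ?l = "lead_exponent n \<alpha> \<beta> \<tau>" and ?Q = "complex_of_real q"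
  have l: "qpow q ((?l - 1) * x) = qpow q (?l * x) / ?z"
    by (simp add: left_diff_distrib qpow_diff)
  have "?Q * inverse (qpow q (\<beta> j + 1)) * ?z = inverse ?b * ?z"
    using assms(1) by (simp add: qpow_add)
  note e = this
  have e': "?Q * inverse ?b * ?z = ?Q * (inverse ?b * ?z)" by (rule mult.assoc)
  have p: "qpoch_inf q (?Q * inverse (qpow q (\<beta> j + 1)) * ?z)
      = (1 - inverse ?b * ?z) * qpoch_inf q (?Q * inverse ?b * ?z)"
    unfolding e e' by (rule qpoch_inf_step[OF assms(1,2)])
  have w: "inverse ?z - inverse ?b = (1 - inverse ?b * ?z) / ?z" using assms(1) by (simp add: field_simps)
  consider "j = 1" | "j = 2" using assms(3) by auto
  then show ?thesis
  proof cases
    case 1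
    show ?thesis
      unfolding J_single_def lead_exponent_shift(2)[OF assms(3)] l w
      using p unfolding 1 by (simp only: fun_upd_apply if_True) simp
  next
    case 2
    show ?thesis
      unfolding J_single_def lead_exponent_shift(2)[OF assms(3)] l w
      using p unfolding 2 by (simp only: fun_upd_apply if_True) simp
  qed
qed

text \<open>In passing from z to q z the numerator loses (1 - q B_1 z)(1 - q B_2 z) and the
  denominator loses (1 - a_1 z)(1 - a_2 z). The weights restore these factors, and the power of z
  gives the constant. The equality also holds where the summand vanishes.\<close>

lemma J_single_shift_point:
  fixes q :: real and \<alpha> \<beta> :: "nat \<Rightarrow> complex"
  defines "a \<equiv> \<lambda>j. qpow q (\<alpha> j)" and "B \<equiv> \<lambda>j. inverse (qpow q (\<beta> j))"
  assumes q: "0 < q" "q < 1"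
    and pole: "a 1 * qpow q x \<noteq> 1" "a 2 * qpow q x \<noteq> 1"
    and w: "w = inverse (qpow q x)" "w' = inverse (qpow q (x + 1))"
  shows "J_single q n \<alpha> \<beta> \<tau> (x + 1) * ((w' - B 1) * (w' - B 2) / w')
    = J_single q n \<alpha> \<beta> \<tau> x
      * (qpow q (lead_exponent n \<alpha> \<beta> \<tau>) / complex_of_real q * ((w - a 1) * (w - a 2)) / w)"
proof -
  let ?Q = "complex_of_real q" and ?l = "lead_exponent n \<alpha> \<beta> \<tau>"
  define z where "z = qpow q x"
  have z: "z \<noteq> 0" "?Q \<noteq> 0" "qpow q (x + 1) = ?Q * z" using q by (auto simp: z_def qpow_add)
  have l: "qpow q (?l * (x + 1)) = qpow q (?l * x) * qpow q ?l"
    by (simp add: distrib_left qpow_add)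
  have Pb: "qpoch_inf q (?Q * B j * z) = (1 - ?Q * B j * z) * qpoch_inf q (?Q * B j * (?Q * z))" for j
    using qpoch_inf_step[OF q, of "?Q * B j * z"] by (simp add: mult_ac)
  have Pa: "qpoch_inf q (a j * z) = (1 - a j * z) * qpoch_inf q (a j * (?Q * z))" for j
    using qpoch_inf_step[OF q, of "a j * z"] by (simp add: mult_ac)
  have fold_ab: "qpow q (\<alpha> j) = a j" "inverse (qpow q (\<beta> j)) = B j" for j
    by (simp_all add: a_def B_def)
  have nz: "1 - a 1 * z \<noteq> 0" "1 - a 2 * z \<noteq> 0" using pole by (auto simp: z_def)
  define u1 where "u1 = 1 - a 1 * z"
  define u2 where "u2 = 1 - a 2 * z"
  define v1 where "v1 = 1 - ?Q * B 1 * z"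
  define v2 where "v2 = 1 - ?Q * B 2 * z"
  have f1: "(w' - B 1) * (w' - B 2) / w' = v1 * v2 / (?Q * z)"
    unfolding w z(3) v1_def v2_def using z by (simp add: field_simps)
  have f2: "(w - a 1) * (w - a 2) / w = u1 * u2 / z"
    unfolding w z_def[symmetric] u1_def u2_def using z by (simp add: field_simps)
  have cancel: "e * l * (p1 * p2) / (r1 * r2) * (v1 * v2 / (y * z))
      = e * ((v1 * p1) * (v2 * p2)) / ((u1 * r1) * (u2 * r2)) * (l / y * (u1 * u2 / z))"
    for e l p1 p2 r1 r2 y :: complex
    using nz unfolding u1_def[symmetric] u2_def[symmetric] by (simp add: mult_ac)
  show ?thesis
    unfolding J_single_def z(3) l fold_ab z_def[symmetric] Pb[of 1] Pb[of 2] Pa[of 1] Pa[of 2]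
      f1 times_divide_eq_right[symmetric, of _ "_ * _" w] f2
    unfolding u1_def[symmetric] u2_def[symmetric] v1_def[symmetric] v2_def[symmetric]
    by (rule cancel)
qed

text \<open>The power of the first coordinate contributes t^2 / q, the symbols and the Vandermonde
  factor the rest. The excluded value q is the zero of the factor 1 - t Y / (q X) that the shifted
  denominator gains.\<close>

lemma J_pair_shift_fst:
  assumes q: "0 < q" "q < 1"
    and pole: "qpow q \<tau> * qpow q y / qpow q x \<noteq> complex_of_real q"
    and ne: "qpow q y \<noteq> qpow q x" "qpow q y \<noteq> qpow q (x + 1)"
    and w: "w = inverse (qpow q x)" "w' = inverse (qpow q (x + 1))" "v = inverse (qpow q y)" and t: "t = qpow q \<tau>"
  shows "J_pair q \<tau> (x + 1) y * ((v - t * w') / (w' - v)) = J_pair q \<tau> x y * (t * ((t * v - w) / (w - v)))"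
proof -
  let ?Q = "complex_of_real q"
  define X where "X = qpow q x"
  define Y where "Y = qpow q y"
  have nz: "X \<noteq> 0" "Y \<noteq> 0" "?Q \<noteq> 0" "t \<noteq> 0" using q by (auto simp: X_def Y_def t)
  have X1: "qpow q (x + 1) = ?Q * X" using q by (simp add: X_def qpow_add)
  have ne': "Y \<noteq> X" "Y \<noteq> ?Q * X" using ne by (simp_all add: X1 flip: X_def Y_def)
  have "qpow q ((2 * \<tau> - 1) * (x + 1)) = qpow q ((2 * \<tau> - 1) * x + (\<tau> + \<tau> - 1))"
    by (simp add: algebra_simps)
  then have l: "qpow q ((2 * \<tau> - 1) * (x + 1)) = qpow q ((2 * \<tau> - 1) * x) * (t * t / ?Q)"
    unfolding qpow_add qpow_diff t using q by simp
  define p where "p = qpoch_inf q (?Q * inverse t * Y / X)"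
  define r where "r = qpoch_inf q (t * Y / X)"
  have "?Q * inverse t * Y / (?Q * X) = inverse t * Y / X" using nz by simp
  then have p1: "qpoch_inf q (?Q * inverse t * Y / (?Q * X)) = (1 - inverse t * Y / X) * p"
    unfolding p_def using qpoch_inf_step[OF q, of "inverse t * Y / X"] by (simp add: mult.assoc)
  have r1: "qpoch_inf q (t * Y / (?Q * X)) = (1 - t * Y / (?Q * X)) * r"
    unfolding r_def using qpoch_inf_step[OF q, of "t * Y / (?Q * X)"] nz by simp
  have d: "?Q * X - t * Y \<noteq> 0" using pole nz by (auto simp: t X_def Y_def field_simps)
  define d where "d = ?Q * X - t * Y"
  have d1: "1 - t * Y / (?Q * X) = d / (?Q * X)" unfolding d_def using nz by (simp add: field_simps)
  have d2: "(v - t * w') / (w' - v) = d / (Y - ?Q * X)"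
    unfolding w X1 Y_def[symmetric] d_def using nz ne' by (simp add: divide_simps)
  have d3: "(t * v - w) / (w - v) = (t * X - Y) / (Y - X)"
    unfolding w X_def[symmetric] Y_def[symmetric] using nz ne' by (simp add: divide_simps)
  have d4: "1 - inverse t * Y / X = (t * X - Y) / (t * X)" using nz by (simp add: field_simps)
  have s: "(?Q * X - Y) / (Y - ?Q * X) = -1" "(X - Y) / (Y - X) = -1"
    using ne' by (simp_all add: divide_simps)
  have "J_pair q \<tau> (x + 1) y * ((v - t * w') / (w' - v))
     = qpow q ((2 * \<tau> - 1) * x) * (t * t / ?Q) * ((t * X - Y) / (t * X) * p) / (d / (?Q * X) * r)
        * d * ((?Q * X - Y) / (Y - ?Q * X))"
    unfolding J_pair_def X1 Y_def[symmetric] t[symmetric] l p1 r1 d1 d2 d4 by simp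
  also have "\<dots> = qpow q ((2 * \<tau> - 1) * x) * p / r * t * (t * X - Y) * ((X - Y) / (Y - X))"
    unfolding s using nz d[folded d_def] by (simp add: divide_simps)
  also have "\<dots> = J_pair q \<tau> x y * (t * ((t * v - w) / (w - v)))"
    unfolding J_pair_def X_def[symmetric] Y_def[symmetric] t[symmetric] p_def[symmetric] r_def[symmetric] d3 by simp
  finally show ?thesis .
qed

text \<open>Now the power is unchanged and the denominator loses 1 - t X / Y. The weights
  nevertheless agree with those of \<open>J_pair_shift_fst\<close>, which is why the test functions
  below need not distinguish the partners before k from those after k.\<close>

lemma J_pair_shift_snd:
  assumes q: "0 < q" "q < 1"
    and pole: "qpow q \<tau> * qpow q x / qpow q y \<noteq> 1"
    and ne: "qpow q y \<noteq> qpow q x" "qpow q y \<noteq> qpow q (x + 1)"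
    and w: "w = inverse (qpow q x)" "w' = inverse (qpow q (x + 1))" "v = inverse (qpow q y)" and t: "t = qpow q \<tau>"
  shows "J_pair q \<tau> y (x + 1) * ((v - t * w') / (w' - v)) = J_pair q \<tau> y x * (t * ((t * v - w) / (w - v)))"
proof -
  let ?Q = "complex_of_real q"
  define X where "X = qpow q x"
  define Y where "Y = qpow q y"
  have nz: "X \<noteq> 0" "Y \<noteq> 0" "?Q \<noteq> 0" "t \<noteq> 0" using q by (auto simp: X_def Y_def t)
  have X1: "qpow q (x + 1) = ?Q * X" using q by (simp add: X_def qpow_add)
  have ne': "Y \<noteq> X" "Y \<noteq> ?Q * X" using ne by (simp_all add: X1 flip: X_def Y_def)
  define p where "p = qpoch_inf q (?Q * inverse t * (?Q * X) / Y)"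
  define r where "r = qpoch_inf q (t * (?Q * X) / Y)"
  have p1: "qpoch_inf q (?Q * inverse t * X / Y) = (1 - ?Q * inverse t * X / Y) * p"
    unfolding p_def using qpoch_inf_step[OF q, of "?Q * inverse t * X / Y"] by (simp add: mult_ac)
  have r1: "qpoch_inf q (t * X / Y) = (1 - t * X / Y) * r"
    unfolding r_def using qpoch_inf_step[OF q, of "t * X / Y"] by (simp add: mult_ac)
  have d: "Y - t * X \<noteq> 0" using pole nz by (auto simp: t X_def Y_def field_simps)
  define d where "d = Y - t * X"
  have d1: "1 - t * X / Y = d / Y" unfolding d_def using nz by (simp add: field_simps)
  have d2: "(v - t * w') / (w' - v) = (?Q * X - t * Y) / (Y - ?Q * X)"
    unfolding w X1 Y_def[symmetric] using nz ne' by (simp add: divide_simps)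
  have d3: "(t * v - w) / (w - v) = - d / (Y - X)"
    unfolding w X_def[symmetric] Y_def[symmetric] d_def using nz ne' by (simp add: divide_simps)
  have d4: "1 - ?Q * inverse t * X / Y = (t * Y - ?Q * X) / (t * Y)" using nz by (simp add: field_simps)
  have "J_pair q \<tau> y (x + 1) * ((v - t * w') / (w' - v))
     = qpow q ((2 * \<tau> - 1) * y) * p / r * (Y - ?Q * X) * ((?Q * X - t * Y) / (Y - ?Q * X))"
    unfolding J_pair_def X1 Y_def[symmetric] t[symmetric] p_def[symmetric] r_def[symmetric] d2 ..
  also have "\<dots> = qpow q ((2 * \<tau> - 1) * y) * p / r * (?Q * X - t * Y)"
    using ne' by simp
  also have "\<dots> = qpow q ((2 * \<tau> - 1) * y) * ((t * Y - ?Q * X) / (t * Y) * p) / (d / Y * r) * (- t * d)"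
    \<comment> \<open>\<open>r\<close> is not known to be nonzero here; if it is 0, both sides are 0
      by the convention for division.\<close>
    using nz d[folded d_def] by (cases "r = 0") (simp_all add: field_simps)
  also have "\<dots> = qpow q ((2 * \<tau> - 1) * y) * ((t * Y - ?Q * X) / (t * Y) * p) / (d / Y * r) * (Y - X)
      * (t * (- d / (Y - X)))"
    using ne' by simp
  also have "\<dots> = J_pair q \<tau> y x * (t * ((t * v - w) / (w - v)))"
    unfolding J_pair_def X_def[symmetric] Y_def[symmetric] t[symmetric] d3 p1 r1 d1 d4 ..
  finally show ?thesis .
qed

section \<open>Neighbouring summands along one lattice direction\<close>

locale jackson_point =
  fixes q :: real and n :: nat and \<alpha> \<beta> :: "nat \<Rightarrow> complex" and \<tau> :: complex and \<xi> :: "nat \<Rightarrow> complex"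
  assumes q: "0 < q" "q < 1" and n: "1 \<le> n"
    and a_pole: "\<And>j m. j \<in> {1, 2} \<Longrightarrow> m \<in> {1..n} \<Longrightarrow> qpow q (\<alpha> j) * qpow q (\<xi> m) \<notin> q_lattice q"
    and t_pole: "\<And>j l. 1 \<le> j \<Longrightarrow> j < l \<Longrightarrow> l \<le> n \<Longrightarrow> qpow q \<tau> * (qpow q (\<xi> l) / qpow q (\<xi> j)) \<notin> q_lattice q"
    and no_collision: "\<And>j l. 1 \<le> j \<Longrightarrow> j < l \<Longrightarrow> l \<le> n \<Longrightarrow> qpow q (\<xi> l) / qpow q (\<xi> j) \<notin> q_lattice q"
begin

abbreviation t where "t \<equiv> qpow q \<tau>"
abbreviation a where "a j \<equiv> qpow q (\<alpha> j)"
abbreviation B where "B j \<equiv> inverse (qpow q (\<beta> j))"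
abbreviation J where "J \<equiv> J_term q n \<alpha> \<beta> \<tau> \<xi>"
abbreviation lattice where "lattice \<equiv> {1..n} \<rightarrow>\<^sub>E (UNIV :: int set)"

definition w :: "(nat \<Rightarrow> int) \<Rightarrow> nat \<Rightarrow> complex" where
  "w \<nu> m = inverse (qpow q (\<xi> m + of_int (\<nu> m)))"

text \<open>The constant produced by raising one coordinate by 1: the single factor gives the first
  quotient, and each of the n - 1 pairs containing the coordinate gives one t.\<close>

definition \<kappa> :: complex where
  "\<kappa> = qpow q (lead_exponent n \<alpha> \<beta> \<tau>) / complex_of_real q * t ^ (n - 1)"

lemma \<kappa>_relation: "\<kappa> * (a 1 * a 2) * t ^ n = t * (B 1 * B 2)"
proof -
  have "t ^ n = t * t ^ (n - 1)" using n by (cases n) auto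
  then show ?thesis
    unfolding \<kappa>_def qpow_lead_exponent[OF q(1) n] using q
    by (simp add: field_simps power2_eq_square)
qed

lemma qpow_point: "qpow q (x + of_int l) = qpow q x * complex_of_real q powi l"
  using q by (simp add: qpow_add qpow_of_int)

lemma w_nonzero: "w \<nu> m \<noteq> 0"
  using q by (simp add: w_def)

lemma ratio_not_lattice:
  assumes "j \<in> {1..n}" "l \<in> {1..n}" "j \<noteq> l"
  shows "qpow q (\<xi> l) / qpow q (\<xi> j) \<notin> q_lattice q"
proof (cases "j < l")
  case True
  then show ?thesis using no_collision assms by auto
next
  case False
  then have "qpow q (\<xi> j) / qpow q (\<xi> l) \<notin> q_lattice q"
    using no_collision[of l j] assms by auto
  then show ?thesis using q_lattice_inverse_iff[of "qpow q (\<xi> j) / qpow q (\<xi> l)" q] by simp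
qed

lemma point_ratio:
  "qpow q (\<xi> l + of_int (\<nu> l)) / qpow q (\<xi> j + of_int (\<nu> j))
    = qpow q (\<xi> l) / qpow q (\<xi> j) * complex_of_real q powi (\<nu> l - \<nu> j)"
  using q by (simp add: qpow_point power_int_diff)

lemma w_inj: "inj_on (w \<nu>) {1..n}"
proof (rule inj_onI, rule ccontr)
  fix j l assume jl: "j \<in> {1..n}" "l \<in> {1..n}" and eq: "w \<nu> j = w \<nu> l" and "j \<noteq> l"
  have "qpow q (\<xi> l + of_int (\<nu> l)) / qpow q (\<xi> j + of_int (\<nu> j)) = 1"
    using eq q by (simp add: w_def)
  then have "qpow q (\<xi> l) / qpow q (\<xi> j) * complex_of_real q powi (\<nu> l - \<nu> j) = 1"
    by (simp only: point_ratio)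
  then show False
    using ratio_not_lattice[OF jl \<open>j \<noteq> l\<close>] q_lattice_mult_iff[OF q(1)] one_in_q_lattice by metis
qed

lemma a_no_pole:
  assumes "j \<in> {1, 2}" "m \<in> {1..n}"
  shows "a j * qpow q (\<xi> m + of_int (\<nu> m)) \<noteq> 1"
proof
  assume "a j * qpow q (\<xi> m + of_int (\<nu> m)) = 1"
  then have "a j * qpow q (\<xi> m) * complex_of_real q powi \<nu> m = 1"
    by (simp only: qpow_point mult.assoc)
  then show False
    using a_pole[OF assms] q_lattice_mult_iff[OF q(1)] one_in_q_lattice by metis
qed

lemma t_no_pole:
  assumes "1 \<le> j" "j < l" "l \<le> n"
  shows "t * qpow q (\<xi> l + of_int (\<nu> l)) / qpow q (\<xi> j + of_int (\<nu> j)) \<noteq> complex_of_real q powi s"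
proof
  assume "t * qpow q (\<xi> l + of_int (\<nu> l)) / qpow q (\<xi> j + of_int (\<nu> j)) = complex_of_real q powi s"
  then have "t * (qpow q (\<xi> l) / qpow q (\<xi> j)) * complex_of_real q powi (\<nu> l - \<nu> j) = complex_of_real q powi s"
    by (simp only: point_ratio mult.assoc times_divide_eq_right[symmetric])
  then show False
    using t_pole[OF assms] q_lattice_mult_iff[OF q(1)] q_lattice_powi by metis
qed

text \<open>The Aomoto-type test functions. Apart from the spectators \<open>w \<nu> m - c\<close>,
  a step in direction k multiplies the summand by \<open>R'\<close> at the old point over
  \<open>R\<close> at the new one. The spectators omit coordinate k, so the step leaves them
  unchanged; after symmetrization they become the products in \<open>G\<close>.\<close>

definition R :: "complex \<Rightarrow> nat \<Rightarrow> (nat \<Rightarrow> int) \<Rightarrow> complex" where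
  "R c k \<nu> = (w \<nu> k - B 1) * (w \<nu> k - B 2) / w \<nu> k
     * (\<Prod>m\<in>{1..n} - {k}. (w \<nu> m - t * w \<nu> k) / (w \<nu> k - w \<nu> m) * (w \<nu> m - c))"

definition R' :: "complex \<Rightarrow> nat \<Rightarrow> (nat \<Rightarrow> int) \<Rightarrow> complex" where
  "R' c k \<nu> = \<kappa> * ((w \<nu> k - a 1) * (w \<nu> k - a 2)) / w \<nu> k
     * (\<Prod>m\<in>{1..n} - {k}. (t * w \<nu> m - w \<nu> k) / (w \<nu> k - w \<nu> m) * (w \<nu> m - c))"

text \<open>The single factor of coordinate k yields the quotient in front, the n - 1 pairs yield
  the products, and their factors t are absorbed into \<open>\<kappa>\<close>. In this form the
  translation by one step can be carried through a sum over the whole lattice.\<close>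

lemma J_shift:
  assumes k: "k \<in> {1..n}"
  shows "J (\<nu>(k := \<nu> k + 1)) * R c k (\<nu>(k := \<nu> k + 1)) = J \<nu> * R' c k \<nu>"
proof -
  define \<nu>' where "\<nu>' = \<nu>(k := \<nu> k + 1)"
  define y where "y m = \<xi> m + of_int (\<nu> m)" for m
  define y' where "y' m = \<xi> m + of_int (\<nu>' m)" for m
  have yk: "y' k = y k + 1" and ym: "\<And>m. m \<noteq> k \<Longrightarrow> y' m = y m"
    by (auto simp: y_def y'_def \<nu>'_def)
  have wk: "w \<nu>' k = inverse (qpow q (y k + 1))" and wk0: "w \<nu> k = inverse (qpow q (y k))"
    and wm: "\<And>m. m \<noteq> k \<Longrightarrow> w \<nu>' m = w \<nu> m" and wm0: "\<And>m. w \<nu> m = inverse (qpow q (y m))"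
    by (auto simp: w_def y_def \<nu>'_def algebra_simps)
  define S where "S = J_single q n \<alpha> \<beta> \<tau>"
  define F where "F = J_pair q \<tau>"
  define D where "D = (w \<nu>' k - B 1) * (w \<nu>' k - B 2) / w \<nu>' k"
  define E where "E = qpow q (lead_exponent n \<alpha> \<beta> \<tau>) / complex_of_real q * ((w \<nu> k - a 1) * (w \<nu> k - a 2)) / w \<nu> k"
  define d where "d m = (w \<nu> m - t * w \<nu>' k) / (w \<nu>' k - w \<nu> m)" for m
  define e where "e m = t * ((t * w \<nu> m - w \<nu> k) / (w \<nu> k - w \<nu> m))" for m
  have single: "(\<Prod>m=1..n. S (y' m)) * D = (\<Prod>m=1..n. S (y m)) * E"
  proof -
    have "S (y k + 1) * D = S (y k) * E"
      unfolding S_def D_def E_def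
      by (rule J_single_shift_point[OF q _ _ wk0 wk]) (use a_no_pole[OF _ k, of _ \<nu>] in \<open>auto simp: y_def\<close>)
    moreover have "(\<Prod>m\<in>{1..n} - {k}. S (y' m)) = (\<Prod>m\<in>{1..n} - {k}. S (y m))"
      using ym by (intro prod.cong) auto
    ultimately show ?thesis
      unfolding prod.remove[OF finite_atLeastAtMost k] yk by (simp add: mult_ac)
  qed
  have ne: "qpow q (y m) \<noteq> qpow q (y k)" "qpow q (y m) \<noteq> qpow q (y k + 1)" if "m \<in> {1..n}" "m \<noteq> k" for m
  proof -
    show "qpow q (y m) \<noteq> qpow q (y k)"
      using inj_onD[OF w_inj[of \<nu>], of m k] that k by (auto simp: wm0)
    show "qpow q (y m) \<noteq> qpow q (y k + 1)"
      using inj_onD[OF w_inj[of \<nu>'], of m k] that k by (auto simp: wk wm wm0)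
  qed
  have pairs: "(\<Prod>j=1..n. \<Prod>l=Suc j..n. F (y' j) (y' l)) * (\<Prod>m\<in>{1..n} - {k}. d m)
      = (\<Prod>j=1..n. \<Prod>l=Suc j..n. F (y j) (y l)) * (\<Prod>m\<in>{1..n} - {k}. e m)"
  proof (rule prod_pairs_shift[OF k])
    fix l assume l: "k < l" "l \<le> n"
    have "t * qpow q (y l) / qpow q (y k) \<noteq> complex_of_real q"
      using t_no_pole[of k l \<nu> 1] k l by (simp add: y_def)
    then show "F (y' k) (y' l) * d l = F (y k) (y l) * e l"
      unfolding yk ym[OF less_imp_neq[OF l(1), symmetric]] F_def d_def e_def
      using l k by (intro J_pair_shift_fst[OF q _ _ _ wk0 wk wm0 refl] ne) auto
  next
    fix j assume j: "1 \<le> j" "j < k"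
    have "t * qpow q (y k) / qpow q (y j) \<noteq> 1"
      using t_no_pole[of j k \<nu> 0] k j by (simp add: y_def)
    then show "F (y' j) (y' k) * d j = F (y j) (y k) * e j"
      unfolding yk ym[OF less_imp_neq[OF j(2)]] F_def d_def e_def
      using j k by (intro J_pair_shift_snd[OF q _ _ _ wk0 wk wm0 refl] ne) auto
  qed (simp add: ym)
  have R: "R c k \<nu>' = D * (\<Prod>m\<in>{1..n} - {k}. d m) * (\<Prod>m\<in>{1..n} - {k}. w \<nu> m - c)"
  proof -
    have "(\<Prod>m\<in>{1..n} - {k}. (w \<nu>' m - t * w \<nu>' k) / (w \<nu>' k - w \<nu>' m) * (w \<nu>' m - c))
        = (\<Prod>m\<in>{1..n} - {k}. d m * (w \<nu> m - c))"
      by (intro prod.cong) (auto simp: d_def wm)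
    then show ?thesis unfolding R_def D_def by (simp add: prod.distrib mult.assoc)
  qed
  have R': "R' c k \<nu> = E * (\<Prod>m\<in>{1..n} - {k}. e m) * (\<Prod>m\<in>{1..n} - {k}. w \<nu> m - c)"
  proof -
    have "(\<Prod>m\<in>{1..n} - {k}. e m) = t ^ (n - 1) * (\<Prod>m\<in>{1..n} - {k}. (t * w \<nu> m - w \<nu> k) / (w \<nu> k - w \<nu> m))"
      using k unfolding e_def prod.distrib by simp
    then show ?thesis unfolding R'_def E_def \<kappa>_def prod.distrib by (simp add: mult_ac)
  qed
  have J': "J \<nu>' = (\<Prod>m=1..n. S (y' m)) * (\<Prod>j=1..n. \<Prod>l=Suc j..n. F (y' j) (y' l))"
    and J0: "J \<nu> = (\<Prod>m=1..n. S (y m)) * (\<Prod>j=1..n. \<Prod>l=Suc j..n. F (y j) (y l))"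
    unfolding J_term_factorization S_def F_def y'_def y_def by (rule refl)+
  have "J \<nu>' * R c k \<nu>' = ((\<Prod>m=1..n. S (y' m)) * D)
      * ((\<Prod>j=1..n. \<Prod>l=Suc j..n. F (y' j) (y' l)) * (\<Prod>m\<in>{1..n} - {k}. d m)) * (\<Prod>m\<in>{1..n} - {k}. w \<nu> m - c)"
    unfolding R J' by (simp only: mult_ac)
  also have "\<dots> = J \<nu> * R' c k \<nu>"
    unfolding single pairs R' J0 by (simp only: mult_ac)
  finally show ?thesis unfolding \<nu>'_def .
qed

lemma sum_R_diff:
  "(1 - t) * c\<^sup>2 * (\<Sum>k=1..n. R c k \<nu> - R' c k \<nu>)
    = (-1) ^ (n - 1) * ((c - B 1) * (c - B 2) * (\<Prod>m=1..n. w \<nu> m - t * c)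
        + \<kappa> * ((c - a 1) * (c - a 2)) * (\<Prod>m=1..n. t * w \<nu> m - c)
        - (B 1 * B 2 * (1 + t) - (B 1 + B 2 + \<kappa> * t ^ n * (a 1 + a 2)) * c + (t ^ n + \<kappa>) * c\<^sup>2)
          * (\<Prod>m=1..n. w \<nu> m - c))"
  using shift_operator_symmetrization[of "{1..n}" "w \<nu>" \<kappa> "a 1" "a 2" t "B 1" "B 2" c] n q w_inj w_nonzero \<kappa>_relation
  unfolding R_def R'_def by simp

lemma J_shift_parameters:
  assumes "j \<in> {1, 2}"
  shows "J_term q n (\<alpha>(j := \<alpha> j + 1)) \<beta> \<tau> \<xi> \<nu> = J \<nu> * (\<Prod>m=1..n. w \<nu> m - a j)"
    and "J_term q n \<alpha> (\<beta>(j := \<beta> j + 1)) \<tau> \<xi> \<nu> = J \<nu> * (\<Prod>m=1..n. w \<nu> m - B j)"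
proof -
  have "(\<Prod>m=1..n. J_single q n (\<alpha>(j := \<alpha> j + 1)) \<beta> \<tau> (\<xi> m + of_int (\<nu> m)))
      = (\<Prod>m=1..n. (w \<nu> m - a j) * J_single q n \<alpha> \<beta> \<tau> (\<xi> m + of_int (\<nu> m)))"
    unfolding w_def using a_no_pole[OF assms, of _ \<nu>] by (intro prod.cong refl J_single_shift_alpha[OF q assms]) auto
  then show "J_term q n (\<alpha>(j := \<alpha> j + 1)) \<beta> \<tau> \<xi> \<nu> = J \<nu> * (\<Prod>m=1..n. w \<nu> m - a j)"
    unfolding J_term_factorization by (simp add: prod.distrib mult_ac)
  have "(\<Prod>m=1..n. J_single q n \<alpha> (\<beta>(j := \<beta> j + 1)) \<tau> (\<xi> m + of_int (\<nu> m)))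
      = (\<Prod>m=1..n. (w \<nu> m - B j) * J_single q n \<alpha> \<beta> \<tau> (\<xi> m + of_int (\<nu> m)))"
    unfolding w_def by (intro prod.cong refl J_single_shift_beta[OF q assms])
  then show "J_term q n \<alpha> (\<beta>(j := \<beta> j + 1)) \<tau> \<xi> \<nu> = J \<nu> * (\<Prod>m=1..n. w \<nu> m - B j)"
    unfolding J_term_factorization by (simp add: prod.distrib mult_ac)
qed

end

section \<open>The difference equation for the lattice sum\<close>

lemma has_sum_sum_finite:
  fixes f :: "'k \<Rightarrow> 'b \<Rightarrow> 'a::{topological_comm_monoid_add, comm_monoid_add}"
  assumes "finite K" "\<And>k. k \<in> K \<Longrightarrow> (f k has_sum s k) A"
  shows "((\<lambda>x. \<Sum>k\<in>K. f k x) has_sum (\<Sum>k\<in>K. s k)) A"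
  using assms by (induction K rule: finite_induct) (auto intro: has_sum_add)

text \<open>Convergence is imposed on the sum with \<open>\<alpha> 1\<close> raised, whose summand
  is \<open>J\<close> times the product of the w_m - a_1. This is the largest growth that occurs
  below, because on the support each |w_m| is bounded away from 0.\<close>

locale convergent_jackson_sum = jackson_point +
  assumes support: "\<And>\<nu> m. J_term q n \<alpha> \<beta> \<tau> \<xi> \<nu> \<noteq> 0 \<Longrightarrow> m \<in> {1..n} \<Longrightarrow> 0 \<le> \<nu> m"
    and converges: "J_converges q n (\<alpha>(1 := \<alpha> 1 + 1)) \<beta> \<tau> \<xi>"
begin

section \<open>Estimates on the cone and summability\<close>

definition in_cone :: "(nat \<Rightarrow> int) \<Rightarrow> bool" where
  "in_cone \<nu> \<longleftrightarrow> (\<forall>m\<in>{1..n}. 0 \<le> \<nu> m)"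

text \<open>A crude common bound for the coordinates on the cone. In the form 1 \<le> Z |w_m| it
  lets every constant be absorbed into a multiple of |w_m|.\<close>

definition Z :: real where
  "Z = (\<Sum>m=1..n. norm (qpow q (\<xi> m)))"

lemma Z_nonneg: "0 \<le> Z"
  unfolding Z_def by (simp add: sum_nonneg)

lemma norm_point_le_Z:
  assumes "in_cone \<nu>" "m \<in> {1..n}"
  shows "norm (qpow q (\<xi> m + of_int (\<nu> m))) \<le> Z"
proof -
  have "0 \<le> \<nu> m" using assms by (simp add: in_cone_def)
  then have "q powi \<nu> m = q ^ nat (\<nu> m)" by (simp add: power_int_def)
  also have "\<dots> \<le> 1" using q by (simp add: power_le_one)
  finally have "norm (qpow q (\<xi> m + of_int (\<nu> m))) \<le> norm (qpow q (\<xi> m)) * 1"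
    unfolding qpow_point norm_mult using q by (intro mult_left_mono) (auto simp: norm_power_int)
  also have "\<dots> \<le> Z"
    unfolding Z_def mult_1_right using assms(2) by (intro member_le_sum) auto
  finally show ?thesis .
qed

lemma one_le_Z_norm_w:
  assumes "in_cone \<nu>" "m \<in> {1..n}"
  shows "1 \<le> Z * norm (w \<nu> m)"
proof -
  have "1 = norm (qpow q (\<xi> m + of_int (\<nu> m))) * norm (w \<nu> m)"
    unfolding w_def norm_mult[symmetric] using q by simp
  also have "\<dots> \<le> Z * norm (w \<nu> m)"
    using norm_point_le_Z[OF assms] by (intro mult_right_mono) auto
  finally show ?thesis .
qed

lemma const_bound:
  assumes "in_cone \<nu>" "m \<in> {1..n}"
  shows "norm c \<le> norm c * Z * norm (w \<nu> m)"
  using mult_left_mono[OF one_le_Z_norm_w[OF assms], of "norm c"] by (simp add: mult.assoc)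

lemma linear_bound:
  assumes "in_cone \<nu>" "m \<in> {1..n}"
  shows "norm (w \<nu> m - c) \<le> (1 + norm c * Z) * norm (w \<nu> m)"
  using norm_triangle_ineq4[of "w \<nu> m" c] const_bound[OF assms, of c] by (simp add: distrib_right)

text \<open>With u = z_k / z_m the quotient is -1 + (1 - s) / (1 - u). As \<nu> varies, u stays in
  an orbit x q^l that avoids 1, so 1 - u is bounded away from 0 uniformly in \<nu>.\<close>

lemma ratio_bound:
  assumes "k \<in> {1..n}" "m \<in> {1..n}" "m \<noteq> k"
  shows "\<exists>C\<ge>0. \<forall>\<nu>. norm ((w \<nu> m - s * w \<nu> k) / (w \<nu> k - w \<nu> m)) \<le> C"
proof -
  obtain \<delta> where \<delta>: "\<delta> > 0" "\<And>l. \<delta> \<le> norm (1 - qpow q (\<xi> k) / qpow q (\<xi> m) * complex_of_real q powi l)"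
    using bounded_away_from_lattice[OF q ratio_not_lattice[OF assms(2,1,3)]] by blast
  have "norm ((w \<nu> m - s * w \<nu> k) / (w \<nu> k - w \<nu> m)) \<le> 1 + norm (1 - s) / \<delta>" for \<nu>
  proof -
    define u where "u = qpow q (\<xi> k + of_int (\<nu> k)) / qpow q (\<xi> m + of_int (\<nu> m))"
    have u: "\<delta> \<le> norm (1 - u)" unfolding u_def point_ratio by (rule \<delta>)
    then have u1: "1 - u \<noteq> 0" using \<delta>(1) by auto
    have wm: "w \<nu> m = u * w \<nu> k" using q by (simp add: w_def u_def field_simps)
    have "(w \<nu> m - s * w \<nu> k) / (w \<nu> k - w \<nu> m) = (w \<nu> k * (u - s)) / (w \<nu> k * (1 - u))"
      unfolding wm by (simp add: algebra_simps)
    also have "\<dots> = -1 + (1 - s) / (1 - u)"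
      using u1 w_nonzero[of \<nu> k] by (simp add: divide_simps)
    finally have "norm ((w \<nu> m - s * w \<nu> k) / (w \<nu> k - w \<nu> m)) = norm (-1 + (1 - s) / (1 - u))"
      by (rule arg_cong)
    also have "\<dots> \<le> 1 + norm (1 - s) / norm (1 - u)"
      using norm_triangle_ineq[of "-1" "(1 - s) / (1 - u)"] by (simp add: norm_divide)
    also have "\<dots> \<le> 1 + norm (1 - s) / \<delta>"
      using u \<delta>(1) u1 by (intro add_left_mono divide_left_mono mult_pos_pos) auto
    finally show ?thesis .
  qed
  then show ?thesis using \<delta>(1) by (intro exI[of _ "1 + norm (1 - s) / \<delta>"]) auto
qed

text \<open>Since w - a_1 = w (1 - a_1 z) and 1 - a_1 z is bounded away from 0 on the lattice, |w|
  is at most a constant times |w - a_1|. The sum with raised \<open>\<alpha> 1\<close> is therefore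
  a majorant.\<close>

lemma prod_w_summable: "(\<lambda>\<nu>. norm (J \<nu> * (\<Prod>m=1..n. w \<nu> m))) summable_on lattice"
proof -
  have "\<exists>\<delta>>0. \<forall>l. \<delta> \<le> norm (1 - a 1 * qpow q (\<xi> m) * complex_of_real q powi l)" if "m \<in> {1..n}" for m
    using bounded_away_from_lattice[OF q a_pole[OF _ that]] by simp
  then obtain \<delta> where \<delta>: "\<And>m. m \<in> {1..n} \<Longrightarrow> \<delta> m > 0"
    "\<And>m l. m \<in> {1..n} \<Longrightarrow> \<delta> m \<le> norm (1 - a 1 * qpow q (\<xi> m) * complex_of_real q powi l)"
    by metis
  have w_le: "norm (w \<nu> m) \<le> 1 / \<delta> m * norm (w \<nu> m - a 1)" if m: "m \<in> {1..n}" for \<nu> m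
  proof -
    have "w \<nu> m - a 1 = w \<nu> m * (1 - a 1 * qpow q (\<xi> m) * complex_of_real q powi \<nu> m)"
      unfolding w_def mult.assoc qpow_point[symmetric] using q by (simp add: field_simps)
    then have "norm (w \<nu> m) * \<delta> m \<le> norm (w \<nu> m - a 1)"
      using \<delta>(2)[OF m, of "\<nu> m"] by (simp add: norm_mult mult_left_mono)
    then show ?thesis using \<delta>(1)[OF m] by (simp add: field_simps)
  qed
  have "(\<lambda>\<nu>. (\<Prod>m=1..n. 1 / \<delta> m) * norm (J_term q n (\<alpha>(1 := \<alpha> 1 + 1)) \<beta> \<tau> \<xi> \<nu>)) summable_on lattice"
    using converges unfolding J_converges_def by (rule summable_on_cmult_right)
  then show ?thesis
  proof (rule Infinite_Sum.abs_summable_on_comparison_test')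
    fix \<nu>
    have "(\<Prod>m=1..n. norm (w \<nu> m)) \<le> (\<Prod>m=1..n. 1 / \<delta> m * norm (w \<nu> m - a 1))"
      using w_le by (intro prod_mono) auto
    then have "norm (J \<nu>) * (\<Prod>m=1..n. norm (w \<nu> m)) \<le> norm (J \<nu>) * ((\<Prod>m=1..n. 1 / \<delta> m) * (\<Prod>m=1..n. norm (w \<nu> m - a 1)))"
      unfolding prod.distrib by (intro mult_left_mono) auto
    then show "norm (J \<nu> * (\<Prod>m=1..n. w \<nu> m)) \<le> (\<Prod>m=1..n. 1 / \<delta> m) * norm (J_term q n (\<alpha>(1 := \<alpha> 1 + 1)) \<beta> \<tau> \<xi> \<nu>)"
      using J_shift_parameters(1)[of 1 \<nu>] by (simp add: norm_mult prod_norm mult_ac)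
  qed
qed

lemma summable_prod:
  assumes "\<And>m. m \<in> {1..n} \<Longrightarrow> \<exists>C. \<forall>\<nu>. in_cone \<nu> \<longrightarrow> norm (f \<nu> m) \<le> C * norm (w \<nu> m)"
  shows "(\<lambda>\<nu>. J \<nu> * (\<Prod>m=1..n. f \<nu> m)) summable_on lattice"
proof -
  obtain C where C: "\<And>m \<nu>. m \<in> {1..n} \<Longrightarrow> in_cone \<nu> \<Longrightarrow> norm (f \<nu> m) \<le> C m * norm (w \<nu> m)"
    using assms by metis
  have "(\<lambda>\<nu>. (\<Prod>m=1..n. C m) * norm (J \<nu> * (\<Prod>m=1..n. w \<nu> m))) summable_on lattice"
    using prod_w_summable by (rule summable_on_cmult_right)
  then have "(\<lambda>\<nu>. norm (J \<nu> * (\<Prod>m=1..n. f \<nu> m))) summable_on lattice"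
  proof (rule Infinite_Sum.abs_summable_on_comparison_test')
    fix \<nu>
    show "norm (J \<nu> * (\<Prod>m=1..n. f \<nu> m)) \<le> (\<Prod>m=1..n. C m) * norm (J \<nu> * (\<Prod>m=1..n. w \<nu> m))"
    proof (cases "J \<nu> = 0")
      case False
      then have "in_cone \<nu>" using support by (auto simp: in_cone_def)
      then have "(\<Prod>m=1..n. norm (f \<nu> m)) \<le> (\<Prod>m=1..n. C m * norm (w \<nu> m))"
        using C by (intro prod_mono) auto
      then have "norm (J \<nu>) * (\<Prod>m=1..n. norm (f \<nu> m)) \<le> norm (J \<nu>) * ((\<Prod>m=1..n. C m) * (\<Prod>m=1..n. norm (w \<nu> m)))"
        unfolding prod.distrib by (intro mult_left_mono) auto
      then show ?thesis by (simp add: norm_mult prod_norm mult_ac)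
    qed simp
  qed
  then show ?thesis by (rule abs_summable_summable)
qed

text \<open>The factor of coordinate k is quadratic in w_k divided by w_k, hence of order |w_k|. In
  every other factor the quotient of differences is bounded, which leaves order |w_m|.\<close>

lemma R_summable:
  assumes k: "k \<in> {1..n}"
  shows "(\<lambda>\<nu>. J \<nu> * R c k \<nu>) summable_on lattice"
proof -
  define f where "f \<nu> m = (if m = k then (w \<nu> k - B 1) * (w \<nu> k - B 2) / w \<nu> k
    else (w \<nu> m - t * w \<nu> k) / (w \<nu> k - w \<nu> m) * (w \<nu> m - c))" for \<nu> m
  have "R c k \<nu> = (\<Prod>m=1..n. f \<nu> m)" for \<nu>
  proof -
    have "(\<Prod>m\<in>{1..n} - {k}. f \<nu> m) = (\<Prod>m\<in>{1..n} - {k}. (w \<nu> m - t * w \<nu> k) / (w \<nu> k - w \<nu> m) * (w \<nu> m - c))"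
      by (intro prod.cong) (auto simp: f_def)
    then show ?thesis unfolding R_def prod.remove[OF finite_atLeastAtMost k] by (simp add: f_def)
  qed
  moreover have "(\<lambda>\<nu>. J \<nu> * (\<Prod>m=1..n. f \<nu> m)) summable_on lattice"
  proof (rule summable_prod)
    fix m assume m: "m \<in> {1..n}"
    show "\<exists>C. \<forall>\<nu>. in_cone \<nu> \<longrightarrow> norm (f \<nu> m) \<le> C * norm (w \<nu> m)"
    proof (cases "m = k")
      case True
      have "norm (f \<nu> m) \<le> (1 + norm (B 1) * Z) * (1 + norm (B 2) * Z) * norm (w \<nu> m)" if "in_cone \<nu>" for \<nu>
      proof -
        have "norm (f \<nu> m) = norm (w \<nu> m - B 1) * norm (w \<nu> m - B 2) / norm (w \<nu> m)"
          using True by (simp add: f_def norm_mult norm_divide)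
        also have "\<dots> \<le> ((1 + norm (B 1) * Z) * norm (w \<nu> m)) * ((1 + norm (B 2) * Z) * norm (w \<nu> m)) / norm (w \<nu> m)"
          using linear_bound[OF that m] Z_nonneg by (intro divide_right_mono mult_mono) auto
        also have "\<dots> = (1 + norm (B 1) * Z) * (1 + norm (B 2) * Z) * norm (w \<nu> m)"
          using w_nonzero by simp
        finally show ?thesis .
      qed
      then show ?thesis by blast
    next
      case False
      obtain C where C: "C \<ge> 0" "\<And>\<nu>. norm ((w \<nu> m - t * w \<nu> k) / (w \<nu> k - w \<nu> m)) \<le> C"
        using ratio_bound[OF k m False] by blast
      have "norm (f \<nu> m) \<le> C * (1 + norm c * Z) * norm (w \<nu> m)" if "in_cone \<nu>" for \<nu>
      proof -
        have "norm (f \<nu> m) = norm ((w \<nu> m - t * w \<nu> k) / (w \<nu> k - w \<nu> m)) * norm (w \<nu> m - c)"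
          using False unfolding f_def by (simp only: if_False norm_mult)
        also have "\<dots> \<le> C * ((1 + norm c * Z) * norm (w \<nu> m))"
          using C linear_bound[OF that m] by (intro mult_mono) auto
        finally show ?thesis by (simp add: mult.assoc)
      qed
      then show ?thesis by blast
    qed
  qed
  ultimately show ?thesis by simp
qed

definition G :: "complex \<Rightarrow> complex" where
  "G c = (\<Sum>\<^sub>\<infinity>\<nu>\<in>lattice. J \<nu> * (\<Prod>m=1..n. w \<nu> m - c))"

lemma G_has_sum: "((\<lambda>\<nu>. J \<nu> * (\<Prod>m=1..n. w \<nu> m - c)) has_sum G c) lattice"
  unfolding G_def using linear_bound by (intro has_sum_infsum summable_prod) blast

lemma R_R'_has_sum:
  assumes k: "k \<in> {1..n}"
  shows "((\<lambda>\<nu>. J \<nu> * (R c k \<nu> - R' c k \<nu>)) has_sum 0) lattice"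
proof -
  obtain s where s: "((\<lambda>\<nu>. J \<nu> * R c k \<nu>) has_sum s) lattice"
    using R_summable[OF k] by (auto simp: summable_on_def)
  \<comment> \<open>By \<open>J_shift\<close> the two families differ by the translation of
    coordinate k, so the summability of the second is inherited from the first.\<close>
  have "((\<lambda>\<nu>. J \<nu> * R' c k \<nu>) has_sum s) lattice \<longleftrightarrow> ((\<lambda>\<nu>. J \<nu> * R c k \<nu>) has_sum s) lattice"
    using k by (intro has_sum_reindex_bij_witness[of _ "\<lambda>\<nu>. \<nu>(k := \<nu> k - 1)" "\<lambda>\<nu>. \<nu>(k := \<nu> k + 1)"])
      (auto simp: J_shift PiE_def extensional_def)
  then have "((\<lambda>\<nu>. J \<nu> * R c k \<nu> + - (J \<nu> * R' c k \<nu>)) has_sum (s + - s)) lattice"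
    using s by (intro has_sum_add has_sum_uminusI) auto
  then show ?thesis by (simp add: right_diff_distrib)
qed

lemma G_t_difference:
  "(c - B 1) * (c - B 2) * G (t * c) + \<kappa> * t ^ n * ((c - a 1) * (c - a 2)) * G (c / t)
    = (B 1 * B 2 * (1 + t) - (B 1 + B 2 + \<kappa> * t ^ n * (a 1 + a 2)) * c + (t ^ n + \<kappa>) * c\<^sup>2) * G c"
proof -
  define A where "A = (c - B 1) * (c - B 2)"
  define C where "C = \<kappa> * t ^ n * ((c - a 1) * (c - a 2))"
  define L where "L = B 1 * B 2 * (1 + t) - (B 1 + B 2 + \<kappa> * t ^ n * (a 1 + a 2)) * c + (t ^ n + \<kappa>) * c\<^sup>2"
  define F where "F c \<nu> = J \<nu> * (\<Prod>m=1..n. w \<nu> m - c)" for c \<nu>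
  have "((\<lambda>\<nu>. A * F (t * c) \<nu> + C * F (c / t) \<nu> + (- L) * F c \<nu>) has_sum (A * G (t * c) + C * G (c / t) + (- L) * G c)) lattice"
    unfolding F_def by (intro has_sum_add has_sum_cmult_right G_has_sum)
  moreover have "((\<lambda>\<nu>. A * F (t * c) \<nu> + C * F (c / t) \<nu> + (- L) * F c \<nu>) has_sum 0) lattice"
  proof -
    \<comment> \<open>A finite combination of the vanishing sums of \<open>R_R'_has_sum\<close>; the
      prefactor squares away the sign in \<open>sum_R_diff\<close>.\<close>
    have "((\<lambda>\<nu>. (-1) ^ (n - 1) * ((1 - t) * c\<^sup>2) * (\<Sum>k=1..n. J \<nu> * (R c k \<nu> - R' c k \<nu>)))
        has_sum ((-1) ^ (n - 1) * ((1 - t) * c\<^sup>2) * (\<Sum>k=1..n. 0))) lattice"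
      by (intro has_sum_cmult_right has_sum_sum_finite R_R'_has_sum) auto
    also have "(\<lambda>\<nu>. (-1) ^ (n - 1) * ((1 - t) * c\<^sup>2) * (\<Sum>k=1..n. J \<nu> * (R c k \<nu> - R' c k \<nu>)))
        = (\<lambda>\<nu>. A * F (t * c) \<nu> + C * F (c / t) \<nu> + (- L) * F c \<nu>)"
    proof
      fix \<nu>
      have "(\<Prod>m=1..n. t * w \<nu> m - c) = (\<Prod>m=1..n. t * (w \<nu> m - c / t))"
        using q by (intro prod.cong) (auto simp: right_diff_distrib)
      then have tc: "(\<Prod>m=1..n. t * w \<nu> m - c) = t ^ n * (\<Prod>m=1..n. w \<nu> m - c / t)"
        by (simp add: prod.distrib)
      have "(-1) ^ (n - 1) * ((1 - t) * c\<^sup>2) * (\<Sum>k=1..n. J \<nu> * (R c k \<nu> - R' c k \<nu>))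
          = (-1) ^ (n - 1) * J \<nu> * ((1 - t) * c\<^sup>2 * (\<Sum>k=1..n. R c k \<nu> - R' c k \<nu>))"
        unfolding sum_distrib_left[symmetric] by (simp only: mult_ac)
      also have "\<dots> = ((-1) ^ (n - 1) * (-1) ^ (n - 1)) * (A * F (t * c) \<nu> + C * F (c / t) \<nu> + (- L) * F c \<nu>)"
        unfolding sum_R_diff tc F_def A_def C_def L_def[symmetric] by (simp add: algebra_simps)
      also have "(-1) ^ (n - 1) * (-1) ^ (n - 1) = (1::complex)"
        by (simp flip: power_mult_distrib)
      finally show "(-1) ^ (n - 1) * ((1 - t) * c\<^sup>2) * (\<Sum>k=1..n. J \<nu> * (R c k \<nu> - R' c k \<nu>))
          = A * F (t * c) \<nu> + C * F (c / t) \<nu> + (- L) * F c \<nu>" by simp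
    qed
    finally show ?thesis by simp
  qed
  ultimately have "A * G (t * c) + C * G (c / t) + (- L) * G c = 0"
    using has_sum_unique by blast
  then have "A * G (t * c) + C * G (c / t) = L * G c" by algebra
  then show ?thesis unfolding A_def C_def L_def .
qed

text \<open>Expanding the product over subsets X of the coordinates splits \<open>G\<close> into
  finitely many lattice sums, each summable because 1 \<le> Z |w_m| fills the places outside X. The
  empty X alone contributes to c^n.\<close>

lemma G_polynomial:
  "\<exists>p. degree p \<le> n \<and> coeff p n = (-1) ^ n * (\<Sum>\<^sub>\<infinity>\<nu>\<in>lattice. J \<nu>) \<and> (\<forall>c. poly p c = G c)"
proof -
  define L where "L X = (\<Sum>\<^sub>\<infinity>\<nu>\<in>lattice. J \<nu> * (\<Prod>m\<in>X. w \<nu> m))" for X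
  have L: "((\<lambda>\<nu>. J \<nu> * (\<Prod>m\<in>X. w \<nu> m)) has_sum L X) lattice" if X: "X \<subseteq> {1..n}" for X
  proof -
    have "(\<Prod>m\<in>X. w \<nu> m) = (\<Prod>m=1..n. if m \<in> X then w \<nu> m else 1)" for \<nu>
      using X by (subst prod.inter_restrict[symmetric]) (auto simp: Int_absorb1)
    moreover have "(\<lambda>\<nu>. J \<nu> * (\<Prod>m=1..n. if m \<in> X then w \<nu> m else 1)) summable_on lattice"
    proof (rule summable_prod)
      fix m assume m: "m \<in> {1..n}"
      show "\<exists>C. \<forall>\<nu>. in_cone \<nu> \<longrightarrow> norm (if m \<in> X then w \<nu> m else 1) \<le> C * norm (w \<nu> m)"
      proof (cases "m \<in> X")
        case True
        then show ?thesis by (intro exI[of _ 1]) simp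
      next
        case False
        then show ?thesis using one_le_Z_norm_w[OF _ m] by (intro exI[of _ Z]) simp
      qed
    qed
    ultimately show ?thesis unfolding L_def by (intro has_sum_infsum) simp
  qed
  define p where "p = (\<Sum>X\<in>Pow {1..n}. monom ((-1) ^ card ({1..n} - X) * L X) (card ({1..n} - X)))"
  have card_le: "card ({1..n} - X) \<le> n" for X
    using card_mono[of "{1..n}" "{1..n} - X"] by simp
  have "degree p \<le> n"
    unfolding p_def by (intro degree_sum_le order.trans[OF degree_monom_le card_le]) simp
  moreover have "coeff p n = (-1) ^ n * (\<Sum>\<^sub>\<infinity>\<nu>\<in>lattice. J \<nu>)"
  proof -
    have "coeff p n = (\<Sum>X\<in>{{}}. coeff (monom ((-1) ^ card ({1..n} - X) * L X) (card ({1..n} - X))) n)"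
      unfolding p_def coeff_sum
    proof (rule sum.mono_neutral_right)
      show "\<forall>X\<in>Pow {1..n} - {{}}. coeff (monom ((-1) ^ card ({1..n} - X) * L X) (card ({1..n} - X))) n = 0"
      proof
        fix X assume "X \<in> Pow {1..n} - {{}}"
        then have "card ({1..n} - X) < card {1..n}" by (intro psubset_card_mono) auto
        then show "coeff (monom ((-1) ^ card ({1..n} - X) * L X) (card ({1..n} - X))) n = 0" by simp
      qed
    qed auto
    then show ?thesis by (simp add: L_def)
  qed
  moreover have "poly p c = G c" for c
  proof -
    have "((\<lambda>\<nu>. \<Sum>X\<in>Pow {1..n}. (- c) ^ card ({1..n} - X) * (J \<nu> * (\<Prod>m\<in>X. w \<nu> m)))
        has_sum (\<Sum>X\<in>Pow {1..n}. (- c) ^ card ({1..n} - X) * L X)) lattice"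
      by (intro has_sum_sum_finite has_sum_cmult_right L) auto
    also have "(\<lambda>\<nu>. \<Sum>X\<in>Pow {1..n}. (- c) ^ card ({1..n} - X) * (J \<nu> * (\<Prod>m\<in>X. w \<nu> m)))
        = (\<lambda>\<nu>. J \<nu> * (\<Prod>m=1..n. w \<nu> m - c))"
      using prod_add[of "{1..n}" "w _" "\<lambda>_. - c"] by (simp add: sum_distrib_left mult_ac)
    finally have "G c = (\<Sum>X\<in>Pow {1..n}. (- c) ^ card ({1..n} - X) * L X)"
      using G_has_sum has_sum_unique by blast
    also have "\<dots> = poly p c"
      unfolding p_def poly_sum poly_monom by (simp add: power_minus[of c] mult_ac)
    finally show ?thesis ..
  qed
  ultimately show ?thesis by blast
qed

end

section \<open>Values of \<open>G\<close> at the parameters\<close>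

context convergent_jackson_sum
begin

lemma J_bar_shift_parameters:
  assumes "j \<in> {1, 2}"
  shows "J_bar q n (\<alpha>(j := \<alpha> j + 1)) \<beta> \<tau> \<xi> = (1 - complex_of_real q) ^ n * G (a j)"
    and "J_bar q n \<alpha> (\<beta>(j := \<beta> j + 1)) \<tau> \<xi> = (1 - complex_of_real q) ^ n * G (B j)"
  unfolding J_bar_def G_def
  by (rule arg_cong2[where f="(*)", OF refl infsum_cong], rule J_shift_parameters[OF assms])+

lemma \<kappa>_eq:
  defines "M \<equiv> B 1 * B 2 / (a 1 * a 2)"
  shows "\<kappa> * t ^ n = t * M" "\<kappa> = M * t / t ^ n"
proof -
  show 1: "\<kappa> * t ^ n = t * M"
    using \<kappa>_relation q unfolding M_def by (simp add: field_simps)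
  then show "\<kappa> = M * t / t ^ n"
    using q by (simp add: eq_divide_eq mult.commute)
qed

text \<open>In \<open>t_difference_special_value\<close> the Newton nodes start at the first of the
  two B-parameters. The equation is symmetric in them, so exchanging the two covers j = 2.\<close>

lemma G_at_B:
  assumes t: "\<And>m. m \<in> {1..n} \<Longrightarrow> t ^ m \<noteq> 1" and j: "j \<in> {1, 2}"
  defines "M \<equiv> B 1 * B 2 / (a 1 * a 2)"
  shows "G (B j) * (\<Prod>r<n. 1 - t ^ (n + r) / (M * t))
    = (-1) ^ n * (\<Sum>\<^sub>\<infinity>\<nu>\<in>lattice. J \<nu>) * (B j ^ n * (\<Prod>r<n. (1 - a 1 * t ^ r / B j) * (1 - a 2 * t ^ r / B j)))"
proof -
  obtain p where p: "degree p \<le> n" "coeff p n = (-1) ^ n * (\<Sum>\<^sub>\<infinity>\<nu>\<in>lattice. J \<nu>)" "\<And>c. poly p c = G c"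
    using G_polynomial by blast
  have eq: "(c - B 1) * (c - B 2) * poly p (t * c) + t * M * ((c - a 1) * (c - a 2)) * poly p (c / t)
       = (B 1 * B 2 * (1 + t) - (B 1 + B 2 + t * M * (a 1 + a 2)) * c + (t ^ n + M * t / t ^ n) * c\<^sup>2) * poly p c" for c
    using G_t_difference[of c] unfolding p \<kappa>_eq(1)[folded M_def] unfolding \<kappa>_eq(2)[folded M_def] .
  note main = t_difference_special_value[OF p(1), of t "a 1" "a 2", unfolded p]
  from j consider "j = 1" | "j = 2" by auto
  then show ?thesis
  proof cases
    case 1
    show ?thesis
      unfolding 1
    proof (rule main[OF _ _ _ _ _ t])
      show "(c - B 1) * (c - B 2) * G (t * c) + t * M * ((c - a 1) * (c - a 2)) * G (c / t)
       = (B 1 * B 2 * (1 + t) - (B 1 + B 2 + t * M * (a 1 + a 2)) * c + (t ^ n + M * t / t ^ n) * c\<^sup>2) * G c" for c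
        using eq[of c] unfolding p .
    qed (use q in \<open>auto simp: M_def\<close>)
  next
    case 2
    show ?thesis
      unfolding 2
    proof (rule main[OF _ _ _ _ _ t])
      show "(c - B 2) * (c - B 1) * G (t * c) + t * M * ((c - a 1) * (c - a 2)) * G (c / t)
       = (B 2 * B 1 * (1 + t) - (B 2 + B 1 + t * M * (a 1 + a 2)) * c + (t ^ n + M * t / t ^ n) * c\<^sup>2) * G c" for c
        using eq[of c] unfolding p by (simp only: mult_ac add_ac)
    qed (use q in \<open>auto simp: M_def\<close>)
  qed
qed

text \<open>The \<open>t\<close>-difference equation is invariant under \<open>t \<mapsto> 1 / t\<close> combined with the exchange of
  the roles of \<open>a\<close> and \<open>B\<close>.\<close>

lemma G_at_a:
  assumes t: "\<And>m. m \<in> {1..n} \<Longrightarrow> t ^ m \<noteq> 1" and j: "j \<in> {1, 2}"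
  defines "N \<equiv> a 1 * a 2 / (B 1 * B 2)"
  shows "G (a j) * (\<Prod>r<n. 1 - (1 / t) ^ (n + r) / (N * (1 / t)))
    = (-1) ^ n * (\<Sum>\<^sub>\<infinity>\<nu>\<in>lattice. J \<nu>) * (a j ^ n * (\<Prod>r<n. (1 - B 1 * (1 / t) ^ r / a j) * (1 - B 2 * (1 / t) ^ r / a j)))"
proof -
  obtain p where p: "degree p \<le> n" "coeff p n = (-1) ^ n * (\<Sum>\<^sub>\<infinity>\<nu>\<in>lattice. J \<nu>)" "\<And>c. poly p c = G c"
    using G_polynomial by blast
  define M where "M = B 1 * B 2 / (a 1 * a 2)"
  have NM: "N = 1 / M" "M \<noteq> 0" "t \<noteq> 0" "B 1 * B 2 = M * (a 1 * a 2)"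
    using q by (simp_all add: N_def M_def)
  have eq: "(c - a 1) * (c - a 2) * G (1 / t * c) + 1 / t * N * ((c - B 1) * (c - B 2)) * G (c / (1 / t))
       = (a 1 * a 2 * (1 + 1 / t) - (a 1 + a 2 + 1 / t * N * (B 1 + B 2)) * c + ((1 / t) ^ n + N * (1 / t) / (1 / t) ^ n) * c\<^sup>2) * G c" for c
  proof -
    \<comment> \<open>Multiplication by the nonzero t M interchanges the two shifted terms and turns
      the equation with parameters 1/t and 1/M back into the one with t and M.\<close>
    have cancel: "x = y" if "t * M * x = t * M * y" for x y :: complex using that NM by simp
    have l: "t * M * (u * g + 1 / t * N * v * h) = v * h + t * M * u * g" for u v g h :: complex
      using NM by (simp add: field_simps)
    have r: "t * M * ((a 1 * a 2 * (1 + 1 / t) - (a 1 + a 2 + 1 / t * N * s) * c + ((1 / t) ^ n + N * (1 / t) / (1 / t) ^ n) * c\<^sup>2) * g)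
       = (M * (a 1 * a 2) * (1 + t) - (s + t * M * (a 1 + a 2)) * c + (t ^ n + M * t / t ^ n) * c\<^sup>2) * g" for g s :: complex
      using NM(2,3) unfolding NM(1) by (simp add: field_simps power_one_over)
    have G: "(c - B 1) * (c - B 2) * G (t * c) + t * M * ((c - a 1) * (c - a 2)) * G (c / t)
       = (B 1 * B 2 * (1 + t) - (B 1 + B 2 + t * M * (a 1 + a 2)) * c + (t ^ n + M * t / t ^ n) * c\<^sup>2) * G c"
      using G_t_difference[of c] unfolding \<kappa>_eq(1)[folded M_def] unfolding \<kappa>_eq(2)[folded M_def] .
    show ?thesis
      by (rule cancel, unfold l r)
        (use G[unfolded NM(4)] in \<open>simp add: mult.commute\<close>)
  qed
  have t': "(1 / t) ^ m \<noteq> 1" if "m \<in> {1..n}" for m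
    using t[OF that] NM(3) by (simp add: power_one_over)
  note main = t_difference_special_value[OF p(1), of "1 / t" "B 1" "B 2", unfolded p]
  from j consider "j = 1" | "j = 2" by auto
  then show ?thesis
  proof cases
    case 1
    show ?thesis
      unfolding 1 by (rule main[OF _ _ _ _ _ t' _ eq]) (use q in \<open>auto simp: N_def\<close>)
  next
    case 2
    show ?thesis
      unfolding 2
    proof (rule main[OF _ _ _ _ _ t'])
      show "(c - a 2) * (c - a 1) * G (1 / t * c) + 1 / t * N * ((c - B 1) * (c - B 2)) * G (c / (1 / t))
       = (a 2 * a 1 * (1 + 1 / t) - (a 2 + a 1 + 1 / t * N * (B 1 + B 2)) * c + ((1 / t) ^ n + N * (1 / t) / (1 / t) ^ n) * c\<^sup>2) * G c" for c
        using eq[of c] by (simp only: mult_ac add_ac)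
    qed (use q in \<open>auto simp: N_def\<close>)
  qed
qed

lemma t_power_pred: "t ^ (n + r - 1) = t ^ (n + r) / t"
  using n q by (cases "n + r") auto

lemma J_bar_T_a:
  assumes t: "\<And>m. m \<in> {1..n} \<Longrightarrow> t ^ m \<noteq> 1" and j: "j \<in> {1, 2}"
    and nz: "\<And>r. r < n \<Longrightarrow> a 1 * a 2 * qpow q (\<beta> 1) * qpow q (\<beta> 2) * t ^ (n + r - 1) \<noteq> 1"
  shows "J_bar q n (\<alpha>(j := \<alpha> j + 1)) \<beta> \<tau> \<xi> = (- a j) ^ n
    * (\<Prod>r<n. (1 - inverse (a j) * B 1 * inverse (t ^ r)) * (1 - inverse (a j) * B 2 * inverse (t ^ r))
        / (1 - inverse (a 1) * inverse (a 2) * B 1 * B 2 * inverse (t ^ (n + r - 1))))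
    * J_bar q n \<alpha> \<beta> \<tau> \<xi>"
proof -
  define D where "D r = 1 - inverse (a 1) * inverse (a 2) * B 1 * B 2 * inverse (t ^ (n + r - 1))" for r
  define U where "U r = (1 - inverse (a j) * B 1 * inverse (t ^ r)) * (1 - inverse (a j) * B 2 * inverse (t ^ r))" for r
  have D: "1 - (1 / t) ^ (n + r) / (a 1 * a 2 / (B 1 * B 2) * (1 / t)) = D r" for r
    unfolding D_def t_power_pred using q by (simp add: field_simps)
  have U: "(1 - B 1 * (1 / t) ^ r / a j) * (1 - B 2 * (1 / t) ^ r / a j) = U r" for r
    unfolding U_def by (simp add: field_simps power_one_over)
  have D0: "D r \<noteq> 0" if "r < n" for r
    using nz[OF that] q unfolding D_def by (simp add: field_simps)
  then have "(\<Prod>r<n. D r) \<noteq> 0" by simp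
  then have "G (a j) = (-1) ^ n * (\<Sum>\<^sub>\<infinity>\<nu>\<in>lattice. J \<nu>) * (a j ^ n * (\<Prod>r<n. U r)) / (\<Prod>r<n. D r)"
    using G_at_a[OF t j] unfolding D U by (simp add: eq_divide_eq)
  then have G: "G (a j) = (- a j) ^ n * (\<Prod>r<n. U r / D r) * (\<Sum>\<^sub>\<infinity>\<nu>\<in>lattice. J \<nu>)"
    by (simp add: power_minus[of "a j"] prod_dividef)
  show ?thesis
    unfolding J_bar_shift_parameters(1)[OF j] G unfolding J_bar_def D_def[symmetric] U_def[symmetric] by (simp only: mult_ac)
qed

lemma J_bar_T_b:
  assumes t: "\<And>m. m \<in> {1..n} \<Longrightarrow> t ^ m \<noteq> 1" and j: "j \<in> {1, 2}"
    and nz: "\<And>r. r < n \<Longrightarrow> a 1 * a 2 * qpow q (\<beta> 1) * qpow q (\<beta> 2) * t ^ (n + r - 1) \<noteq> 1"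
  shows "J_bar q n \<alpha> (\<beta>(j := \<beta> j + 1)) \<tau> \<xi> = (- B j) ^ n
    * (\<Prod>r<n. (1 - a 1 * qpow q (\<beta> j) * t ^ r) * (1 - a 2 * qpow q (\<beta> j) * t ^ r)
        / (1 - a 1 * a 2 * qpow q (\<beta> 1) * qpow q (\<beta> 2) * t ^ (n + r - 1)))
    * J_bar q n \<alpha> \<beta> \<tau> \<xi>"
proof -
  define D where "D r = 1 - a 1 * a 2 * qpow q (\<beta> 1) * qpow q (\<beta> 2) * t ^ (n + r - 1)" for r
  define U where "U r = (1 - a 1 * qpow q (\<beta> j) * t ^ r) * (1 - a 2 * qpow q (\<beta> j) * t ^ r)" for r
  have D: "1 - t ^ (n + r) / (B 1 * B 2 / (a 1 * a 2) * t) = D r" for r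
    unfolding D_def t_power_pred using q by (simp add: field_simps)
  have U: "(1 - a 1 * t ^ r / B j) * (1 - a 2 * t ^ r / B j) = U r" for r
    unfolding U_def by (simp add: field_simps)
  have D0: "D r \<noteq> 0" if "r < n" for r
    using nz[OF that] unfolding D_def by simp
  then have "(\<Prod>r<n. D r) \<noteq> 0" by simp
  then have "G (B j) = (-1) ^ n * (\<Sum>\<^sub>\<infinity>\<nu>\<in>lattice. J \<nu>) * (B j ^ n * (\<Prod>r<n. U r)) / (\<Prod>r<n. D r)"
    using G_at_B[OF t j] unfolding D U by (simp add: eq_divide_eq)
  then have G: "G (B j) = (- B j) ^ n * (\<Prod>r<n. U r / D r) * (\<Sum>\<^sub>\<infinity>\<nu>\<in>lattice. J \<nu>)"
    by (simp add: power_minus[of "B j"] prod_dividef)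
  show ?thesis
    unfolding J_bar_shift_parameters(2)[OF j] G unfolding J_bar_def D_def[symmetric] U_def[symmetric] by (simp only: mult_ac)
qed

end

text \<open>The summation points form the same set for base points that differ by integers in the
  exponents. The witnesses are restricted to 1..n so that they stay in the extensional function
  space.\<close>

lemma J_bar_lattice_shift:
  assumes "\<And>m. m \<in> {1..n} \<Longrightarrow> \<xi>' m = \<xi> m + of_int (d m)"
  shows "J_bar q n \<alpha> \<beta> \<tau> \<xi>' = J_bar q n \<alpha> \<beta> \<tau> \<xi>"
  unfolding J_bar_def
  by (intro arg_cong2[where f="(*)"] refl infsum_reindex_bij_witness
      [of _ "\<lambda>\<nu>. restrict (\<lambda>m. \<nu> m - d m) {1..n}" "\<lambda>\<nu>. restrict (\<lambda>m. \<nu> m + d m) {1..n}"] J_term_cong)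
    (auto simp: assms PiE_def extensional_def fun_eq_iff)

section \<open>Quasi-periodicity of the regularizing factor\<close>

definition h_single ::
    "real \<Rightarrow> nat \<Rightarrow> (nat \<Rightarrow> complex) \<Rightarrow> (nat \<Rightarrow> complex) \<Rightarrow> complex \<Rightarrow> complex \<Rightarrow> complex" where
  "h_single q n \<alpha> \<beta> \<tau> x = qpow q (lead_exponent n \<alpha> \<beta> \<tau> * x)
     / (qtheta q (qpow q (\<alpha> 1) * qpow q x) * qtheta q (qpow q (\<alpha> 2) * qpow q x))"

definition h_pair :: "real \<Rightarrow> complex \<Rightarrow> complex \<Rightarrow> complex \<Rightarrow> complex" where
  "h_pair q \<tau> x y = qpow q (2 * \<tau> * x) * qtheta q (qpow q y / qpow q x) / qtheta q (qpow q \<tau> * qpow q y / qpow q x)"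

lemma h_bar_factorization:
  "h_bar q n \<alpha> \<beta> \<tau> \<xi> = (\<Prod>m=1..n. h_single q n \<alpha> \<beta> \<tau> (\<xi> m)) * (\<Prod>j=1..n. \<Prod>l=Suc j..n. h_pair q \<tau> (\<xi> j) (\<xi> l))"
  unfolding h_bar_def Let_def h_single_def h_pair_def ..

lemma h_bar_cong:
  assumes "\<And>m. m \<in> {1..n} \<Longrightarrow> \<xi> m = \<xi>' m"
  shows "h_bar q n \<alpha> \<beta> \<tau> \<xi> = h_bar q n \<alpha> \<beta> \<tau> \<xi>'"
  unfolding h_bar_factorization using assms by (intro arg_cong2[where f="(*)"] prod.cong) auto

text \<open>In each of the n single factors the theta function contributes -a z and the exponent
  1/z. The product (-a)^n is the factor by which the formulas for the sum and for its regularization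
  differ.\<close>

lemma h_bar_shift_alpha:
  assumes q: "0 < q" "q < 1" and j: "j \<in> {1, 2}"
  shows "h_bar q n (\<alpha>(j := \<alpha> j + 1)) \<beta> \<tau> \<xi> = (- qpow q (\<alpha> j)) ^ n * h_bar q n \<alpha> \<beta> \<tau> \<xi>"
proof -
  have "h_single q n (\<alpha>(j := \<alpha> j + 1)) \<beta> \<tau> x = - qpow q (\<alpha> j) * h_single q n \<alpha> \<beta> \<tau> x" for x
  proof -
    let ?z = "qpow q x" and ?a = "qpow q (\<alpha> j)" and ?l = "lead_exponent n \<alpha> \<beta> \<tau>"
    have l: "qpow q ((?l - 1) * x) = qpow q (?l * x) / ?z"
      by (simp add: left_diff_distrib qpow_diff)
    have e: "qpow q (\<alpha> j + 1) * ?z = complex_of_real q * (?a * ?z)"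
      using q by (simp add: qpow_add)
    have p: "qtheta q (qpow q (\<alpha> j + 1) * ?z) = - qtheta q (?a * ?z) / (?a * ?z)"
      unfolding e using q by (intro qtheta_shift) auto
    have nz: "?a \<noteq> 0" "?z \<noteq> 0" using q by auto
    have cancel: "(e / z) / ((- T / (a * z)) * S) = - a * (e / (T * S))"
      "(e / z) / (S * (- T / (a * z))) = - a * (e / (S * T))" if "a \<noteq> 0" "z \<noteq> 0" for e z a T S :: complex
      using that by simp_all
    from j consider "j = 1" | "j = 2" by auto
    then show ?thesis
    proof cases
      case 1
      show ?thesis unfolding h_single_def lead_exponent_shift(1)[OF j] l
        using p nz cancel[OF nz] unfolding 1 by (simp only: fun_upd_apply if_True) simp
    next
      case 2
      show ?thesis unfolding h_single_def lead_exponent_shift(1)[OF j] l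
        using p nz cancel[OF nz] unfolding 2 by (simp only: fun_upd_apply if_True) simp
    qed
  qed
  then show ?thesis unfolding h_bar_factorization by (simp only: prod.distrib prod_constant card_atLeastAtMost) simp
qed

lemma h_bar_shift_beta:
  assumes j: "j \<in> {1, 2}"
  shows "h_bar q n \<alpha> (\<beta>(j := \<beta> j + 1)) \<tau> \<xi> = (\<Prod>m=1..n. inverse (qpow q (\<xi> m))) * h_bar q n \<alpha> \<beta> \<tau> \<xi>"
proof -
  have "h_single q n \<alpha> (\<beta>(j := \<beta> j + 1)) \<tau> x = inverse (qpow q x) * h_single q n \<alpha> \<beta> \<tau> x" for x
    unfolding h_single_def lead_exponent_shift(2)[OF j] by (simp add: left_diff_distrib qpow_diff field_simps)
  then show ?thesis unfolding h_bar_factorization by (simp add: prod.distrib)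
qed

text \<open>The single factor gives q^lead a_1 a_2 z^2, where lead is the lead exponent, and the a's
  cancel against that power. A pair gives t in either position: as first coordinate, t^2 from the
  power times 1/t from the thetas; as second coordinate, t from the thetas.\<close>

lemma h_bar_shift_coordinate:
  assumes q: "0 < q" "q < 1" and k: "k \<in> {1..n}"
  shows "h_bar q n \<alpha> \<beta> \<tau> (\<xi>(k := \<xi> k + 1))
    = complex_of_real q * (qpow q (\<xi> k))\<^sup>2 / (qpow q (\<beta> 1) * qpow q (\<beta> 2) * qpow q \<tau> ^ (n - 1)) * h_bar q n \<alpha> \<beta> \<tau> \<xi>"
proof -
  let ?Q = "complex_of_real q" and ?l = "lead_exponent n \<alpha> \<beta> \<tau>" and ?a = "\<lambda>j. qpow q (\<alpha> j)"
  let ?t = "qpow q \<tau>" and ?\<xi> = "\<xi>(k := \<xi> k + 1)"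
  have single: "h_single q n \<alpha> \<beta> \<tau> (x + 1) = qpow q ?l * (?a 1 * ?a 2 * (qpow q x)\<^sup>2) * h_single q n \<alpha> \<beta> \<tau> x" for x
  proof -
    have e: "?a j * qpow q (x + 1) = ?Q * (?a j * qpow q x)" for j
      using q by (simp add: qpow_add)
    have th: "qtheta q (?a j * qpow q (x + 1)) = - qtheta q (?a j * qpow q x) / (?a j * qpow q x)" for j
      unfolding e using q by (intro qtheta_shift) auto
    have l: "qpow q (?l * (x + 1)) = qpow q (?l * x) * qpow q ?l"
      by (simp add: distrib_left qpow_add)
    have cancel: "e * l / ((- T / (a * z)) * (- S / (b * z))) = l * (a * b * z\<^sup>2) * (e / (T * S))"
      if "a \<noteq> 0" "b \<noteq> 0" "z \<noteq> 0" for e l T S a b z :: complex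
      using that by (simp add: power2_eq_square)
    show ?thesis
      unfolding h_single_def l th by (rule cancel) (use q in auto)
  qed
  have pair_fst: "h_pair q \<tau> (x + 1) y = h_pair q \<tau> x y * ?t" for x y
  proof -
    define u where "u = qpow q y / qpow q (x + 1)"
    have u: "u \<noteq> 0" "qpow q y / qpow q x = ?Q * u" "?t * qpow q y / qpow q (x + 1) = ?t * u"
      "?t * qpow q y / qpow q x = ?Q * (?t * u)"
      using q by (simp_all add: u_def qpow_add)
    have "qpow q (2 * \<tau> * (x + 1)) = qpow q (2 * \<tau> * x + (\<tau> + \<tau>))" by (simp add: distrib_left)
    then have l: "qpow q (2 * \<tau> * (x + 1)) = qpow q (2 * \<tau> * x) * (?t * ?t)" unfolding qpow_add .
    have th: "qtheta q (?Q * u) = - qtheta q u / u" "qtheta q (?Q * (?t * u)) = - qtheta q (?t * u) / (?t * u)"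
      by (rule qtheta_shift[OF q u(1)], rule qtheta_shift[OF q]) (use q u in simp)
    have cancel: "e * (s * s) * T / S = e * (- T / u) / (- S / (s * u)) * s"
      if "s \<noteq> 0" "u \<noteq> 0" for e s T S u :: complex
      using that by simp
    show ?thesis
      unfolding h_pair_def u(2-4) u_def[symmetric] l th by (rule cancel) (use q u in auto)
  qed
  have pair_snd: "h_pair q \<tau> y (x + 1) = h_pair q \<tau> y x * ?t" for x y
  proof -
    define u where "u = qpow q x / qpow q y"
    have u: "u \<noteq> 0" "qpow q (x + 1) / qpow q y = ?Q * u" "?t * qpow q x / qpow q y = ?t * u"
      "?t * qpow q (x + 1) / qpow q y = ?Q * (?t * u)"
      using q by (simp_all add: u_def qpow_add)
    have th: "qtheta q (?Q * u) = - qtheta q u / u" "qtheta q (?Q * (?t * u)) = - qtheta q (?t * u) / (?t * u)"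
      by (rule qtheta_shift[OF q u(1)], rule qtheta_shift[OF q]) (use q u in simp)
    have cancel: "e * (- T / u) / (- S / (s * u)) = e * T / S * s"
      if "s \<noteq> 0" "u \<noteq> 0" for e s T S u :: complex
      using that by simp
    show ?thesis
      unfolding h_pair_def u(2-4) u_def[symmetric] th by (rule cancel) (use q u in auto)
  qed
  have P1: "(\<Prod>m=1..n. h_single q n \<alpha> \<beta> \<tau> (?\<xi> m))
      = qpow q ?l * (?a 1 * ?a 2 * (qpow q (\<xi> k))\<^sup>2) * (\<Prod>m=1..n. h_single q n \<alpha> \<beta> \<tau> (\<xi> m))"
  proof -
    have "(\<Prod>m\<in>{1..n} - {k}. h_single q n \<alpha> \<beta> \<tau> (?\<xi> m)) = (\<Prod>m\<in>{1..n} - {k}. h_single q n \<alpha> \<beta> \<tau> (\<xi> m))"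
      by (intro prod.cong) auto
    then show ?thesis unfolding prod.remove[OF finite_atLeastAtMost k] by (simp add: single)
  qed
  have "(\<Prod>j=1..n. \<Prod>l=Suc j..n. h_pair q \<tau> (?\<xi> j) (?\<xi> l)) * (\<Prod>m\<in>{1..n} - {k}. 1)
      = (\<Prod>j=1..n. \<Prod>l=Suc j..n. h_pair q \<tau> (\<xi> j) (\<xi> l)) * (\<Prod>m\<in>{1..n} - {k}. ?t)"
    by (rule prod_pairs_shift[OF k]) (auto simp: pair_fst pair_snd)
  then have P2: "(\<Prod>j=1..n. \<Prod>l=Suc j..n. h_pair q \<tau> (?\<xi> j) (?\<xi> l))
      = ?t ^ (n - 1) * (\<Prod>j=1..n. \<Prod>l=Suc j..n. h_pair q \<tau> (\<xi> j) (\<xi> l))"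
    using k by simp
  have n: "1 \<le> n" using k by simp
  have c: "qpow q ?l * (?a 1 * ?a 2 * z) * ?t ^ (n - 1) = ?Q * z / (qpow q (\<beta> 1) * qpow q (\<beta> 2) * ?t ^ (n - 1))" for z
    unfolding qpow_lead_exponent[OF q(1) n] using q by (simp add: field_simps power2_eq_square)
  show ?thesis
    unfolding h_bar_factorization P1 P2 c[symmetric] by (simp only: mult_ac)
qed

lemma h_bar_shift_coordinates:
  assumes q: "0 < q" "q < 1" and K: "finite K" "K \<subseteq> {1..n}"
  shows "h_bar q n \<alpha> \<beta> \<tau> (\<lambda>m. \<xi> m + of_bool (m \<in> K))
    = (\<Prod>m\<in>K. complex_of_real q * (qpow q (\<xi> m))\<^sup>2 / (qpow q (\<beta> 1) * qpow q (\<beta> 2) * qpow q \<tau> ^ (n - 1))) * h_bar q n \<alpha> \<beta> \<tau> \<xi>"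
  using K
proof (induction K rule: finite_induct)
  case (insert k K)
  define \<eta> where "\<eta> = (\<lambda>m. \<xi> m + of_bool (m \<in> K))"
  \<comment> \<open>Each coordinate moves at most once, so the formula for one step is applied at
    the original value \<open>\<xi> k\<close>.\<close>
  have "(\<lambda>m. \<xi> m + of_bool (m \<in> insert k K)) = \<eta>(k := \<eta> k + 1)" "\<eta> k = \<xi> k"
    using insert by (auto simp: fun_eq_iff \<eta>_def)
  then show ?case
    using insert h_bar_shift_coordinate[OF q, of k n \<alpha> \<beta> \<tau> \<eta>] by (simp add: \<eta>_def mult.assoc)
qed simp

section \<open>Truncation at the point zeta\<close>

lemma qpow_nat_mult: "0 < q \<Longrightarrow> qpow q (of_nat k * s) = qpow q s ^ k"
  using qpow_int_mult[of q "int k" s] by simp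

lemma qpow_zeta_pt:
  assumes "0 < q" "1 \<le> m"
  shows "qpow q (zeta_pt i \<tau> x y m)
    = (if m \<le> i then qpow q x * qpow q \<tau> ^ (m - 1) else qpow q y * qpow q \<tau> ^ (m - i - 1))"
proof (cases "m \<le> i")
  case True
  have "(of_nat m - 1) * \<tau> = of_nat (m - 1) * \<tau>" using assms(2) by (simp add: of_nat_diff)
  then show ?thesis
    unfolding zeta_pt_def using True by (simp only: if_True qpow_add qpow_nat_mult[OF assms(1)])
next
  case False
  then have "(of_nat m - of_nat i - 1) * \<tau> = of_nat (m - i - 1) * \<tau>" by (simp add: of_nat_diff)
  then show ?thesis
    unfolding zeta_pt_def using False by (simp only: if_False qpow_add qpow_nat_mult[OF assms(1)])
qed

text \<open>The exponent s = 0 excludes collisions, s = 1 excludes poles of the pair factors. Within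
  a block the ratio is t^(l-j), a positive power because j < l; across the blocks it is the inverse
  of b_1 / b_2 times a power of t, of exponent at most n in absolute value once t^s is
  included.\<close>

lemma zeta_pt_ratio_not_lattice:
  fixes \<beta> :: "nat \<Rightarrow> complex"
  assumes q: "0 < q" and i: "i \<le> n"
    and t: "\<forall>m\<in>{1..n}. qpow q \<tau> ^ m \<notin> q_lattice q"
    and b: "\<forall>m::int. \<bar>m\<bar> \<le> int n \<longrightarrow> qpow q (\<beta> 1) / qpow q (\<beta> 2) * qpow q \<tau> powi m \<notin> q_lattice q"
    and jl: "1 \<le> j" "j < l" "l \<le> n" and s: "s \<le> 1"
  defines "x \<equiv> \<lambda>m. qpow q (zeta_pt i \<tau> (\<beta> 1) (\<beta> 2) m)"
  shows "qpow q \<tau> ^ s * (x l / x j) \<notin> q_lattice q"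
proof -
  let ?t = "qpow q \<tau>"
  have nz: "?t \<noteq> 0" "qpow q (\<beta> 1) \<noteq> 0" "qpow q (\<beta> 2) \<noteq> 0" using q by auto
  have xl: "x l = (if l \<le> i then qpow q (\<beta> 1) * ?t ^ (l - 1) else qpow q (\<beta> 2) * ?t ^ (l - i - 1))"
    and xj: "x j = (if j \<le> i then qpow q (\<beta> 1) * ?t ^ (j - 1) else qpow q (\<beta> 2) * ?t ^ (j - i - 1))"
    unfolding x_def by (rule qpow_zeta_pt[OF q], use jl in simp)+
  show ?thesis
  proof (cases "j \<le> i \<and> i < l")
    case True
    define e where "e = int (j - 1) - int (l - i - 1) - int s"
    have te: "?t powi e = ?t ^ (j - 1) / ?t ^ (l - i - 1) / ?t ^ s"
      unfolding e_def by (simp only: power_int_diff[OF disjI1[OF nz(1)]] power_int_of_nat)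
    have "?t ^ s * (x l / x j) = inverse (qpow q (\<beta> 1) / qpow q (\<beta> 2) * ?t powi e)"
    proof -
      have eq: "S * (c * L / (b * K)) = inverse (b / c * (K / L / S))" for S c L b K :: complex
        by (simp add: field_simps)
      have "j \<le> i" "\<not> l \<le> i" using True by auto
      then show ?thesis unfolding xl xj te by (simp only: if_True if_False eq)
    qed
    moreover have "\<bar>e\<bar> \<le> int n"
      unfolding e_def using True jl i s by (auto simp: of_nat_diff abs_le_iff)
    ultimately show ?thesis using b q_lattice_inverse_iff by metis
  next
    case False
    have quot: "b * y / (b * z) = u" if "y = u * z" "b \<noteq> 0" "z \<noteq> 0" for b y z u :: complex
      using that by simp
    have "x l / x j = ?t ^ (l - j)"
    proof (cases "l \<le> i")
      case True
      have "?t ^ (l - 1) = ?t ^ (l - j) * ?t ^ (j - 1)" using jl by (simp flip: power_add)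
      moreover have "j \<le> i" using True jl by simp
      ultimately show ?thesis unfolding xl xj if_P[OF True] if_P[OF \<open>j \<le> i\<close>] using nz by (intro quot) auto
    next
      case l: False
      then have "\<not> j \<le> i" using False by simp
      moreover from this have "?t ^ (l - i - 1) = ?t ^ (l - j) * ?t ^ (j - i - 1)"
        using jl by (simp flip: power_add)
      ultimately show ?thesis unfolding xl xj if_not_P[OF l] if_not_P[OF \<open>\<not> j \<le> i\<close>] using nz by (intro quot) auto
    qed
    then have "?t ^ s * (x l / x j) = ?t ^ (s + (l - j))" by (simp add: power_add)
    moreover have "s + (l - j) \<in> {1..n}" using jl s by auto
    ultimately show ?thesis using t by auto
  qed
qed

text \<open>At the start of a block the numerator contains (q^(1 + \<nu> k))_\<infinity>, which
  vanishes for negative \<nu> k. Inside a block the pair (k, k+1) contains (q^(1 + \<nu>(k+1) -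
  \<nu> k))_\<infinity>, which forces \<nu> to be nondecreasing.\<close>

lemma J_term_zeta_support:
  assumes q: "0 < q" "q < 1" and J: "J_term q n \<alpha> \<beta> \<tau> (zeta_pt i \<tau> (\<beta> 1) (\<beta> 2)) \<nu> \<noteq> 0"
    and m: "m \<in> {1..n}"
  shows "0 \<le> \<nu> m"
proof -
  let ?\<xi> = "zeta_pt i \<tau> (\<beta> 1) (\<beta> 2)" and ?Q = "complex_of_real q" and ?t = "qpow q \<tau>"
  have z: "qpow q (x + of_int l) = qpow q x * ?Q powi l" for x l
    using q by (simp add: qpow_add qpow_of_int)
  have first: "0 \<le> \<nu> k" if k: "k \<in> {1..n}" "k = 1 \<or> k = i + 1" for k
  proof (rule ccontr)
    assume neg: "\<not> 0 \<le> \<nu> k"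
    define b where "b = (if k \<le> i then \<beta> 1 else \<beta> 2)"
    have "?\<xi> k = b" using k by (auto simp: zeta_pt_def b_def)
    then have "?Q * inverse (qpow q b) * qpow q (?\<xi> k + of_int (\<nu> k)) = ?Q powi (1 + \<nu> k)"
      unfolding z using q by (simp add: power_int_add)
    then have "qpoch_inf q (?Q * inverse (qpow q b) * qpow q (?\<xi> k + of_int (\<nu> k))) = 0"
      using neg qpoch_inf_eq_0[OF q, of "1 + \<nu> k"] by simp
    then have "J_single q n \<alpha> \<beta> \<tau> (?\<xi> k + of_int (\<nu> k)) = 0"
      unfolding J_single_def b_def by (auto split: if_splits)
    then have "(\<Prod>m=1..n. J_single q n \<alpha> \<beta> \<tau> (?\<xi> m + of_int (\<nu> m))) = 0"
      using k(1) by (intro prod_zero) auto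
    then show False using J unfolding J_term_factorization by simp
  qed
  have step: "\<nu> k \<le> \<nu> (Suc k)" if k: "1 \<le> k" "Suc k \<le> n" "k \<noteq> i" for k
  proof (rule ccontr)
    assume neg: "\<not> \<nu> k \<le> \<nu> (Suc k)"
    have "qpow q (?\<xi> (Suc k)) = qpow q (?\<xi> k) * ?t"
    proof (cases "k < i")
      case True
      have "?t ^ k = ?t ^ (k - 1) * ?t" using k by (metis One_nat_def Suc_pred less_eq_Suc_le mult.commute power_Suc)
      then show ?thesis using True k q by (simp add: qpow_zeta_pt)
    next
      case False
      then have "k - i = Suc (k - i - 1)" using k by simp
      then have "?t ^ (k - i) = ?t ^ (k - i - 1) * ?t" by (metis mult.commute power_Suc)
      then show ?thesis using False k q by (simp add: qpow_zeta_pt)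
    qed
    then have "?Q * inverse ?t * qpow q (?\<xi> (Suc k) + of_int (\<nu> (Suc k))) / qpow q (?\<xi> k + of_int (\<nu> k))
        = ?Q powi (1 + \<nu> (Suc k) - \<nu> k)"
      unfolding z using q by (simp add: power_int_add power_int_diff)
    then have "qpoch_inf q (?Q * inverse ?t * qpow q (?\<xi> (Suc k) + of_int (\<nu> (Suc k))) / qpow q (?\<xi> k + of_int (\<nu> k))) = 0"
      using neg qpoch_inf_eq_0[OF q, of "1 + \<nu> (Suc k) - \<nu> k"] by simp
    then have "J_pair q \<tau> (?\<xi> k + of_int (\<nu> k)) (?\<xi> (Suc k) + of_int (\<nu> (Suc k))) = 0"
      unfolding J_pair_def by simp
    then have "(\<Prod>l=Suc k..n. J_pair q \<tau> (?\<xi> k + of_int (\<nu> k)) (?\<xi> l + of_int (\<nu> l))) = 0"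
      using k by (intro prod_zero bexI[of _ "Suc k"]) auto
    then have "\<exists>j\<in>{1..n}. (\<Prod>l=Suc j..n. J_pair q \<tau> (?\<xi> j + of_int (\<nu> j)) (?\<xi> l + of_int (\<nu> l))) = 0"
      by (rule bexI) (use k in simp)
    then have "(\<Prod>j=1..n. \<Prod>l=Suc j..n. J_pair q \<tau> (?\<xi> j + of_int (\<nu> j)) (?\<xi> l + of_int (\<nu> l))) = 0"
      by (rule prod_zero[OF finite_atLeastAtMost])
    then show False using J unfolding J_term_factorization by simp
  qed
  from m show ?thesis
  proof (induction m)
    case (Suc k)
    show ?case
    proof (cases "k = 0 \<or> k = i")
      case True
      then show ?thesis using first[of "Suc k"] Suc.prems by auto
    next
      case False
      then show ?thesis using step[of k] Suc by auto
    qed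
  qed simp
qed

text \<open>The locale predicate carries no \<open>\<beta>\<close> because the assumptions of the
  locale do not mention it; here \<open>\<beta>\<close> enters through the point.\<close>

lemma zeta_jackson_point:
  assumes q: "0 < q" "q < 1" and n: "1 \<le> n" and i: "i \<le> n" and gen: "generic_params q n \<alpha> \<beta> \<tau>"
  shows "jackson_point q n \<alpha> \<tau> (zeta_pt i \<tau> (\<beta> 1) (\<beta> 2))"
proof
  have ab: "\<forall>j\<in>{1,2}. \<forall>k\<in>{1,2}. \<forall>m<n. qpow q (\<alpha> j) * qpow q (\<beta> k) * qpow q \<tau> ^ m \<notin> q_lattice q"
    and t: "\<forall>m\<in>{1..n}. qpow q \<tau> ^ m \<notin> q_lattice q"
    and b: "\<forall>m::int. \<bar>m\<bar> \<le> int n \<longrightarrow> qpow q (\<beta> 1) / qpow q (\<beta> 2) * qpow q \<tau> powi m \<notin> q_lattice q"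
    using gen unfolding generic_params_def Let_def by auto
  show "qpow q (\<alpha> j) * qpow q (zeta_pt i \<tau> (\<beta> 1) (\<beta> 2) m) \<notin> q_lattice q"
    if "j \<in> {1, 2}" "m \<in> {1..n}" for j m
  proof -
    have "m - 1 < n" "m - i - 1 < n" using that by auto
    moreover have "1 \<in> {1, 2::nat}" "2 \<in> {1, 2::nat}" by auto
    ultimately show ?thesis
      using ab that by (simp only: qpow_zeta_pt[OF q(1)] atLeastAtMost_iff mult.assoc split: if_split) blast
  qed
  fix j l :: nat assume jl: "1 \<le> j" "j < l" "l \<le> n"
  show "qpow q \<tau> * (qpow q (zeta_pt i \<tau> (\<beta> 1) (\<beta> 2) l) / qpow q (zeta_pt i \<tau> (\<beta> 1) (\<beta> 2) j)) \<notin> q_lattice q"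
    using zeta_pt_ratio_not_lattice[OF q(1) i t b jl, of 1] by simp
  show "qpow q (zeta_pt i \<tau> (\<beta> 1) (\<beta> 2) l) / qpow q (zeta_pt i \<tau> (\<beta> 1) (\<beta> 2) j) \<notin> q_lattice q"
    using zeta_pt_ratio_not_lattice[OF q(1) i t b jl, of 0] by simp
qed (use q n in auto)

lemma zeta_pt_shift_beta:
  fixes \<beta> :: "nat \<Rightarrow> complex"
  assumes "j \<in> {1, 2}" "i \<le> n" "m \<in> {1..n}"
  shows "zeta_pt i \<tau> ((\<beta>(j := \<beta> j + 1)) 1) ((\<beta>(j := \<beta> j + 1)) 2) m
    = zeta_pt i \<tau> (\<beta> 1) (\<beta> 2) m + of_bool (m \<in> (if j = 1 then {1..i} else {Suc i..n}))"
  using assms by (auto simp: zeta_pt_def)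

lemma prod_split_at:
  fixes f :: "nat \<Rightarrow> 'a::comm_monoid_mult"
  assumes "i \<le> n"
  shows "(\<Prod>m=1..n. f m) = (\<Prod>r<i. f (Suc r)) * (\<Prod>r<n - i. f (Suc (i + r)))"
proof -
  have "(\<Prod>m=1..n. f m) = (\<Prod>r<i + (n - i). f (Suc r))"
    using assms by (simp add: prod.atLeast1_atMost_eq)
  also have "\<dots> = (\<Prod>r<i. f (Suc r)) * (\<Prod>r=i..<i + (n - i). f (Suc r))"
    by (subst prod.atLeastLessThan_concat[of 0 i "i + (n - i)", symmetric] | simp add: lessThan_atLeast0)+
  also have "(\<Prod>r=i..<i + (n - i). f (Suc r)) = (\<Prod>r<n - i. f (Suc (i + r)))"
    using prod.shift_bounds_nat_ivl[of "\<lambda>r. f (Suc r)" 0 i "n - i"] by (simp add: lessThan_atLeast0 add.commute)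
  finally show ?thesis .
qed

text \<open>The i largest indices, read downwards, and the n - i smallest exhaust 0..n-1. These are
  the exponents of t that the two blocks of zeta leave behind.\<close>

lemma prod_rev_tail:
  fixes f :: "nat \<Rightarrow> 'a::comm_monoid_mult"
  assumes "i \<le> n"
  shows "(\<Prod>r<i. f (n - Suc r)) * (\<Prod>r<n - i. f r) = (\<Prod>r<n. f r)"
proof -
  have "(\<Prod>r<n. f r) = (\<Prod>r<n. f (n - Suc r))"
    by (rule prod.nat_diff_reindex[symmetric])
  also have "\<dots> = (\<Prod>r<i. f (n - Suc r)) * (\<Prod>r<n - i. f (n - Suc (i + r)))"
    using prod_split_at[OF assms, of "\<lambda>m. f (n - m)"] by (simp add: prod.atLeast1_atMost_eq)
  also have "(\<Prod>r<n - i. f (n - Suc (i + r))) = (\<Prod>r<n - i. f r)"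
    using prod.nat_diff_reindex[of f "n - i"] by (simp add: algebra_simps)
  finally show ?thesis ..
qed

text \<open>A moved coordinate b_j t^r is divided by b_1 b_2 t^(n-1), which leaves the inverse of b
  t^(n-1-r), where b is the other parameter, of index 3 - j. An unmoved coordinate b t^r contributes
  its inverse. All exponents 0..n-1 occur once, so the factor does not depend on i.\<close>

lemma h_bar_zeta_shift_beta:
  fixes \<beta> :: "nat \<Rightarrow> complex"
  assumes q: "0 < q" "q < 1" and n: "1 \<le> n" and i: "i \<le> n" and j: "j \<in> {1, 2}"
  defines "\<beta>' \<equiv> \<beta>(j := \<beta> j + 1)"
  shows "h_bar q n \<alpha> \<beta>' \<tau> (zeta_pt i \<tau> (\<beta>' 1) (\<beta>' 2))
    = (\<Prod>r<n. inverse (qpow q (\<beta> (3 - j)) * qpow q \<tau> ^ r)) * h_bar q n \<alpha> \<beta> \<tau> (zeta_pt i \<tau> (\<beta> 1) (\<beta> 2))"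
proof -
  let ?Q = "complex_of_real q" and ?t = "qpow q \<tau>"
  define \<xi> where "\<xi> = zeta_pt i \<tau> (\<beta> 1) (\<beta> 2)"
  define x where "x m = qpow q (\<xi> m)" for m
  define b1 where "b1 = qpow q (\<beta> 1)"
  define b2 where "b2 = qpow q (\<beta> 2)"
  define K where "K = (if j = 1 then {1..i} else {Suc i..n})"
  have nz: "?t \<noteq> 0" "b1 \<noteq> 0" "b2 \<noteq> 0" "?Q \<noteq> 0" "\<And>m. x m \<noteq> 0"
    using q by (auto simp: x_def b1_def b2_def)
  have K: "finite K" "K \<subseteq> {1..n}" using i by (auto simp: K_def)
  \<comment> \<open>The coordinate formula is applied with \<open>\<beta>'\<close>, hence the extra
    q, which cancels the q in its numerator.\<close>
  have b': "qpow q (\<beta>' 1) * qpow q (\<beta>' 2) = ?Q * (b1 * b2)"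
    using j q by (auto simp: \<beta>'_def qpow_add b1_def b2_def)
  have "h_bar q n \<alpha> \<beta>' \<tau> (zeta_pt i \<tau> (\<beta>' 1) (\<beta>' 2)) = h_bar q n \<alpha> \<beta>' \<tau> (\<lambda>m. \<xi> m + of_bool (m \<in> K))"
    unfolding \<beta>'_def \<xi>_def K_def by (rule h_bar_cong, rule zeta_pt_shift_beta[OF j i])
  also have "\<dots> = (\<Prod>m\<in>K. ?Q * (x m)\<^sup>2 / (?Q * (b1 * b2) * ?t ^ (n - 1))) * h_bar q n \<alpha> \<beta>' \<tau> \<xi>"
    unfolding h_bar_shift_coordinates[OF q K] b' x_def ..
  also have "h_bar q n \<alpha> \<beta>' \<tau> \<xi> = (\<Prod>m=1..n. inverse (x m)) * h_bar q n \<alpha> \<beta> \<tau> \<xi>"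
    unfolding \<beta>'_def x_def by (rule h_bar_shift_beta[OF j])
  also have "(\<Prod>m\<in>K. ?Q * (x m)\<^sup>2 / (?Q * (b1 * b2) * ?t ^ (n - 1))) * ((\<Prod>m=1..n. inverse (x m)) * h_bar q n \<alpha> \<beta> \<tau> \<xi>)
      = (\<Prod>m=1..n. if m \<in> K then x m / (b1 * b2 * ?t ^ (n - 1)) else inverse (x m)) * h_bar q n \<alpha> \<beta> \<tau> \<xi>"
  proof -
    have "(\<Prod>m\<in>K. ?Q * (x m)\<^sup>2 / (?Q * (b1 * b2) * ?t ^ (n - 1)))
        = (\<Prod>m=1..n. if m \<in> K then (x m)\<^sup>2 / (b1 * b2 * ?t ^ (n - 1)) else 1)"
      using K nz by (subst prod.inter_restrict[symmetric]) (auto simp: Int_absorb1 mult.assoc)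
    also have "\<dots> * (\<Prod>m=1..n. inverse (x m))
        = (\<Prod>m=1..n. if m \<in> K then x m / (b1 * b2 * ?t ^ (n - 1)) else inverse (x m))"
      unfolding prod.distrib[symmetric] using nz by (intro prod.cong) (auto simp: power2_eq_square field_simps)
    finally show ?thesis unfolding mult.assoc[symmetric] by simp
  qed
  also have "(\<Prod>m=1..n. if m \<in> K then x m / (b1 * b2 * ?t ^ (n - 1)) else inverse (x m))
      = (\<Prod>r<n. inverse (qpow q (\<beta> (3 - j)) * ?t ^ r))"
  proof -
    have x1: "x (Suc r) = b1 * ?t ^ r" if "r < i" for r
      unfolding x_def \<xi>_def b1_def using that q by (subst qpow_zeta_pt) auto
    have x2: "x (Suc (i + r)) = b2 * ?t ^ r" for r
      unfolding x_def \<xi>_def b2_def using q by (subst qpow_zeta_pt) auto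
    have split_t: "?t ^ (n - 1) = ?t ^ r * ?t ^ (n - Suc r)" if "r < n" for r
      using that by (simp flip: power_add)
    have quot: "b * ?t ^ r / (b * c * ?t ^ (n - 1)) = inverse (c * ?t ^ (n - Suc r))"
      if "r < n" "b \<noteq> 0" for b c r
      unfolding split_t[OF that(1)] using that nz by (simp add: field_simps)
    from j consider "j = 1" | "j = 2" by auto
    then show ?thesis
    proof cases
      case 1
      have "(\<Prod>r<i. if Suc r \<in> K then x (Suc r) / (b1 * b2 * ?t ^ (n - 1)) else inverse (x (Suc r)))
          = (\<Prod>r<i. inverse (b2 * ?t ^ (n - Suc r)))"
      proof (intro prod.cong refl)
        fix r assume "r \<in> {..<i}"
        then have "Suc r \<in> K" "r < i" "r < n" using 1 i by (auto simp: K_def)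
        then show "(if Suc r \<in> K then x (Suc r) / (b1 * b2 * ?t ^ (n - 1)) else inverse (x (Suc r)))
            = inverse (b2 * ?t ^ (n - Suc r))"
          by (simp only: if_True x1 quot nz not_False_eq_True)
      qed
      moreover have "(\<Prod>r<n - i. if Suc (i + r) \<in> K then x (Suc (i + r)) / (b1 * b2 * ?t ^ (n - 1)) else inverse (x (Suc (i + r))))
          = (\<Prod>r<n - i. inverse (b2 * ?t ^ r))"
        using 1 by (intro prod.cong refl) (auto simp: K_def x2)
      ultimately show ?thesis
        unfolding prod_split_at[OF i] using prod_rev_tail[OF i, of "\<lambda>r. inverse (b2 * ?t ^ r)"] 1
        by (simp only:) (simp add: b2_def numeral_2_eq_2)
    next
      case 2
      have ni: "n - i \<le> n" "n - (n - i) = i" using i by auto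
      have "(\<Prod>r<i. if Suc r \<in> K then x (Suc r) / (b1 * b2 * ?t ^ (n - 1)) else inverse (x (Suc r)))
          = (\<Prod>r<i. inverse (b1 * ?t ^ r))"
        using 2 by (intro prod.cong refl) (auto simp: K_def x1)
      moreover have "(\<Prod>r<n - i. if Suc (i + r) \<in> K then x (Suc (i + r)) / (b1 * b2 * ?t ^ (n - 1)) else inverse (x (Suc (i + r))))
          = (\<Prod>r<n - i. inverse (b1 * ?t ^ (n - Suc r)))"
      proof (intro prod.cong refl)
        fix r assume "r \<in> {..<n - i}"
        then have "Suc (i + r) \<in> K" "r < n" using 2 i by (auto simp: K_def)
        then show "(if Suc (i + r) \<in> K then x (Suc (i + r)) / (b1 * b2 * ?t ^ (n - 1)) else inverse (x (Suc (i + r))))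
            = inverse (b1 * ?t ^ (n - Suc r))"
          by (simp only: if_True x2 mult.commute[of b1 b2] quot nz not_False_eq_True)
      qed
      ultimately show ?thesis
        unfolding prod_split_at[OF i] using prod_rev_tail[OF ni(1), of "\<lambda>r. inverse (b1 * ?t ^ r)"] 2 unfolding ni(2)
        by (simp only: mult.commute[of "\<Prod>r<i. _ r"]) (simp add: b1_def)
    qed
  qed
  finally show ?thesis unfolding \<xi>_def .
qed

text \<open>Passing to inverse parameters takes p out of each 1 - p. Since n + r - 1 = 2r + (n - 1 -
  r), the monomials combine to 1 / (b' t^(n-1-r)), so the prefactor has to be matched in reversed
  order. It is then the factor of \<open>h_bar_zeta_shift_beta\<close>.\<close>

lemma prod_quadratic_quotient_inversion:
  fixes a1 a2 b b' t :: complex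
  assumes nz: "a1 \<noteq> 0" "a2 \<noteq> 0" "b \<noteq> 0" "b' \<noteq> 0" "t \<noteq> 0" and n: "1 \<le> n"
    and D: "\<And>r. r < n \<Longrightarrow> a1 * a2 * (b * b') * t ^ (n + r - 1) \<noteq> 1"
  shows "(- inverse b) ^ n * (\<Prod>r<n. (1 - a1 * b * t ^ r) * (1 - a2 * b * t ^ r) / (1 - a1 * a2 * (b * b') * t ^ (n + r - 1)))
    = (\<Prod>r<n. inverse (b' * t ^ r))
      * (\<Prod>r<n. (1 - inverse a1 * inverse b * inverse (t ^ r)) * (1 - inverse a2 * inverse b * inverse (t ^ r))
          / (1 - inverse a1 * inverse a2 * inverse (b * b') * inverse (t ^ (n + r - 1))))"
proof -
  have factor: "- inverse b * ((1 - a1 * b * t ^ r) * (1 - a2 * b * t ^ r) / (1 - a1 * a2 * (b * b') * t ^ (n + r - 1)))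
    = inverse (b' * t ^ (n - Suc r))
      * ((1 - inverse a1 * inverse b * inverse (t ^ r)) * (1 - inverse a2 * inverse b * inverse (t ^ r))
          / (1 - inverse a1 * inverse a2 * inverse (b * b') * inverse (t ^ (n + r - 1))))" if r: "r < n" for r
  proof -
    define u where "u = t ^ r"
    define v where "v = t ^ (n - Suc r)"
    have "n + r - 1 = (r + r) + (n - Suc r)" using r by simp
    then have e: "t ^ (n + r - 1) = u * u * v" by (simp only: power_add u_def v_def)
    have uv: "u \<noteq> 0" "v \<noteq> 0" using nz by (auto simp: u_def v_def)
    define p where "p = a1 * a2 * (b * b') * (u * u * v)"
    have p: "p \<noteq> 0" "1 - p \<noteq> 0" using nz uv D[OF r] unfolding e p_def by auto
    have i: "1 - inverse a1 * inverse a2 * inverse (b * b') * inverse (u * u * v) = - (1 - p) / p"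
      unfolding diff_divide_distrib minus_diff_eq using p by (simp add: p_def divide_inverse mult_ac)
    have i1: "1 - inverse a1 * inverse b * inverse u = - (1 - a1 * b * u) / (a1 * b * u)"
      "1 - inverse a2 * inverse b * inverse u = - (1 - a2 * b * u) / (a2 * b * u)"
      using nz uv by (simp_all add: field_simps)
    define x where "x = 1 - a1 * b * u"
    define y where "y = 1 - a2 * b * u"
    define z where "z = 1 - p"
    have "- inverse b * (x * y / z) = inverse (b' * v) * ((- x / (a1 * b * u)) * (- y / (a2 * b * u)) / (- z / p))"
      using p nz uv unfolding z_def[symmetric] p_def by (simp add: field_simps)
    then show ?thesis
      unfolding e i p_def[symmetric] u_def[symmetric] v_def[symmetric] i1 x_def y_def z_def .
  qed
  have rev: "(\<Prod>r<n. inverse (b' * t ^ r)) = (\<Prod>r<n. inverse (b' * t ^ (n - Suc r)))"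
    by (rule prod.nat_diff_reindex[symmetric])
  have const: "(- inverse b) ^ n = (\<Prod>r<n. - inverse b)" by simp
  show ?thesis
    unfolding rev const prod.distrib[symmetric] by (rule prod.cong[OF refl], rule factor) simp
qed

section \<open>The shift formulas at the point zeta, with product index r = k - 1\<close>

lemma zeta_shift_formulas:
  fixes \<alpha> \<beta> :: "nat \<Rightarrow> complex"
  assumes q: "0 < q" "q < 1" and n: "1 \<le> n" and i: "i \<le> n" and gen: "generic_params q n \<alpha> \<beta> \<tau>"
    and conv: "J_converges q n (\<alpha>(1 := \<alpha> 1 + 1)) \<beta> \<tau> (zeta_pt i \<tau> (\<beta> 1) (\<beta> 2))" and j: "j \<in> {1, 2}"
  defines "\<xi> \<equiv> zeta_pt i \<tau> (\<beta> 1) (\<beta> 2)"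
    and "\<alpha>' \<equiv> \<alpha>(j := \<alpha> j + 1)" and "\<beta>' \<equiv> \<beta>(j := \<beta> j + 1)"
    and "Pa \<equiv> (\<Prod>r<n. (1 - inverse (qpow q (\<alpha> j)) * inverse (qpow q (\<beta> 1)) * inverse (qpow q \<tau> ^ r))
              * (1 - inverse (qpow q (\<alpha> j)) * inverse (qpow q (\<beta> 2)) * inverse (qpow q \<tau> ^ r))
        / (1 - inverse (qpow q (\<alpha> 1)) * inverse (qpow q (\<alpha> 2)) * inverse (qpow q (\<beta> 1)) * inverse (qpow q (\<beta> 2))
              * inverse (qpow q \<tau> ^ (n + r - 1))))"
    and "Pb \<equiv> (\<Prod>r<n. (1 - qpow q (\<alpha> 1) * qpow q (\<beta> j) * qpow q \<tau> ^ r) * (1 - qpow q (\<alpha> 2) * qpow q (\<beta> j) * qpow q \<tau> ^ r)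
        / (1 - qpow q (\<alpha> 1) * qpow q (\<alpha> 2) * qpow q (\<beta> 1) * qpow q (\<beta> 2) * qpow q \<tau> ^ (n + r - 1)))"
    and "Pb' \<equiv> (\<Prod>r<n. (1 - inverse (qpow q (\<alpha> 1)) * inverse (qpow q (\<beta> j)) * inverse (qpow q \<tau> ^ r))
              * (1 - inverse (qpow q (\<alpha> 2)) * inverse (qpow q (\<beta> j)) * inverse (qpow q \<tau> ^ r))
        / (1 - inverse (qpow q (\<alpha> 1)) * inverse (qpow q (\<alpha> 2)) * inverse (qpow q (\<beta> 1)) * inverse (qpow q (\<beta> 2))
              * inverse (qpow q \<tau> ^ (n + r - 1))))"
  shows "J_bar q n \<alpha>' \<beta> \<tau> \<xi> = (- qpow q (\<alpha> j)) ^ n * Pa * J_bar q n \<alpha> \<beta> \<tau> \<xi>"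
    and "J_bar q n \<alpha> \<beta>' \<tau> (zeta_pt i \<tau> (\<beta>' 1) (\<beta>' 2)) = (- inverse (qpow q (\<beta> j))) ^ n * Pb * J_bar q n \<alpha> \<beta> \<tau> \<xi>"
    and "J_reg q n \<alpha>' \<beta> \<tau> \<xi> = Pa * J_reg q n \<alpha> \<beta> \<tau> \<xi>"
    and "J_reg q n \<alpha> \<beta>' \<tau> (zeta_pt i \<tau> (\<beta>' 1) (\<beta>' 2)) = Pb' * J_reg q n \<alpha> \<beta> \<tau> \<xi>"
proof -
  interpret convergent_jackson_sum q n \<alpha> \<beta> \<tau> \<xi>
    unfolding \<xi>_def
    by (intro convergent_jackson_sum.intro convergent_jackson_sum_axioms.intro zeta_jackson_point[OF q n i gen] conv
        J_term_zeta_support[OF q])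
  have t: "qpow q \<tau> ^ m \<noteq> 1" if "m \<in> {1..n}" for m
    using gen that one_in_q_lattice[of q] unfolding generic_params_def Let_def by metis
  have nz: "qpow q (\<alpha> 1) * qpow q (\<alpha> 2) * qpow q (\<beta> 1) * qpow q (\<beta> 2) * qpow q \<tau> ^ (n + r - 1) \<noteq> 1" if "r < n" for r
  proof -
    have "Suc r \<in> {1..n}" "n + Suc r - 2 = n + r - 1" using that by auto
    then show ?thesis using gen unfolding generic_params_def Let_def by metis
  qed
  show Ja: "J_bar q n \<alpha>' \<beta> \<tau> \<xi> = (- qpow q (\<alpha> j)) ^ n * Pa * J_bar q n \<alpha> \<beta> \<tau> \<xi>"
    unfolding \<alpha>'_def Pa_def by (rule J_bar_T_a[OF t j nz])
  \<comment> \<open>The shift of b_j also moves one block of the point, but only along the lattice;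
    so the parameter shift at the fixed point suffices.\<close>
  have "J_bar q n \<alpha> \<beta>' \<tau> (zeta_pt i \<tau> (\<beta>' 1) (\<beta>' 2)) = J_bar q n \<alpha> \<beta>' \<tau> \<xi>"
    using zeta_pt_shift_beta[OF j i] unfolding \<beta>'_def \<xi>_def
    by (intro J_bar_lattice_shift[of _ _ _ "\<lambda>m. of_bool (m \<in> (if j = 1 then {1..i} else {Suc i..n}))"]) simp
  then show Jb: "J_bar q n \<alpha> \<beta>' \<tau> (zeta_pt i \<tau> (\<beta>' 1) (\<beta>' 2))
      = (- inverse (qpow q (\<beta> j))) ^ n * Pb * J_bar q n \<alpha> \<beta> \<tau> \<xi>"
    unfolding \<beta>'_def Pb_def using J_bar_T_b[OF t j nz] by simp
  show "J_reg q n \<alpha>' \<beta> \<tau> \<xi> = Pa * J_reg q n \<alpha> \<beta> \<tau> \<xi>"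
    unfolding J_reg_def Ja unfolding \<alpha>'_def h_bar_shift_alpha[OF q j] using q by simp
  have bb: "qpow q (\<beta> 1) * qpow q (\<beta> 2) = qpow q (\<beta> j) * qpow q (\<beta> (3 - j))"
    using j by (auto simp: numeral_3_eq_3 numeral_2_eq_2)
  define H where "H = (\<Prod>r<n. inverse (qpow q (\<beta> (3 - j)) * qpow q \<tau> ^ r))"
  have "(- inverse (qpow q (\<beta> j))) ^ n * Pb = H * Pb'"
    using prod_quadratic_quotient_inversion[of "qpow q (\<alpha> 1)" "qpow q (\<alpha> 2)" "qpow q (\<beta> j)" "qpow q (\<beta> (3 - j))" "qpow q \<tau>" n]
      nz q n unfolding bb[symmetric] Pb_def Pb'_def H_def by (simp add: mult.assoc)
  moreover have "H \<noteq> 0" unfolding H_def using q by simp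
  ultimately show "J_reg q n \<alpha> \<beta>' \<tau> (zeta_pt i \<tau> (\<beta>' 1) (\<beta>' 2)) = Pb' * J_reg q n \<alpha> \<beta> \<tau> \<xi>"
    unfolding J_reg_def Jb unfolding \<beta>'_def h_bar_zeta_shift_beta[OF q n i j] \<xi>_def H_def[symmetric] by simp
qed

theorem proposition4p20:
  fixes q :: real and n i :: nat
    and \<alpha> \<beta> :: "nat \<Rightarrow> complex" and \<tau> :: complex
    and a b :: "nat \<Rightarrow> complex" and t :: complex
    and J \<J> :: "(nat \<Rightarrow> complex) \<Rightarrow> (nat \<Rightarrow> complex) \<Rightarrow> complex"
    and conv :: "(nat \<Rightarrow> complex) \<Rightarrow> (nat \<Rightarrow> complex) \<Rightarrow> bool"
  defines "a \<equiv> \<lambda>j. qpow q (\<alpha> j)"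
    and "b \<equiv> \<lambda>j. qpow q (\<beta> j)"
    and "t \<equiv> qpow q \<tau>"
    and "J \<equiv> \<lambda>\<alpha> \<beta>. J_bar q n \<alpha> \<beta> \<tau> (zeta_pt i \<tau> (\<beta> 1) (\<beta> 2))"
    and "\<J> \<equiv> \<lambda>\<alpha> \<beta>. J_reg q n \<alpha> \<beta> \<tau> (zeta_pt i \<tau> (\<beta> 1) (\<beta> 2))"
    and "conv \<equiv> \<lambda>\<alpha> \<beta>. J_converges q n \<alpha> \<beta> \<tau> (zeta_pt i \<tau> (\<beta> 1) (\<beta> 2))"
  assumes "0 < q" and "q < 1" and "1 \<le> n" and "i \<le> n"
    and "generic_params q n \<alpha> \<beta> \<tau>"
    and "conv \<alpha> \<beta>"
    and "\<forall>j\<in>{1,2}. T_a j conv \<alpha> \<beta> \<and> T_b j conv \<alpha> \<beta>"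
  shows "\<forall>j\<in>{1,2}.
      T_a j J \<alpha> \<beta> =
        (- a j) ^ n
        * (\<Prod>k=1..n. (1 - inverse (a j) * inverse (b 1) * t powi (- (int k - 1)))
                   * (1 - inverse (a j) * inverse (b 2) * t powi (- (int k - 1)))
                   / (1 - inverse (a 1) * inverse (a 2) * inverse (b 1) * inverse (b 2)
                          * t powi (- (int n + int k - 2))))
        * J \<alpha> \<beta>
    \<and> T_b j J \<alpha> \<beta> =
        (- inverse (b j)) ^ n
        * (\<Prod>k=1..n. (1 - a 1 * b j * t ^ (k - 1)) * (1 - a 2 * b j * t ^ (k - 1))
                   / (1 - a 1 * a 2 * b 1 * b 2 * t ^ (n + k - 2)))
        * J \<alpha> \<beta>
    \<and> T_a j \<J> \<alpha> \<beta> =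
        (\<Prod>k=1..n. (1 - inverse (a j) * inverse (b 1) * t powi (- (int k - 1)))
                 * (1 - inverse (a j) * inverse (b 2) * t powi (- (int k - 1)))
                 / (1 - inverse (a 1) * inverse (a 2) * inverse (b 1) * inverse (b 2)
                        * t powi (- (int n + int k - 2))))
        * \<J> \<alpha> \<beta>
    \<and> T_b j \<J> \<alpha> \<beta> =
        (\<Prod>k=1..n. (1 - inverse (a 1) * inverse (b j) * t powi (- (int k - 1)))
                 * (1 - inverse (a 2) * inverse (b j) * t powi (- (int k - 1)))
                 / (1 - inverse (a 1) * inverse (a 2) * inverse (b 1) * inverse (b 2)
                        * t powi (- (int n + int k - 2))))
        * \<J> \<alpha> \<beta>"
proof
  fix j :: nat assume j: "j \<in> {1, 2}"
  have conv1: "J_converges q n (\<alpha>(1 := \<alpha> 1 + 1)) \<beta> \<tau> (zeta_pt i \<tau> (\<beta> 1) (\<beta> 2))"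
    using \<open>\<forall>j\<in>{1,2}. T_a j conv \<alpha> \<beta> \<and> T_b j conv \<alpha> \<beta>\<close> by (simp add: T_a_def conv_def)
  note formulas = zeta_shift_formulas[OF \<open>0 < q\<close> \<open>q < 1\<close> \<open>1 \<le> n\<close> \<open>i \<le> n\<close> \<open>generic_params q n \<alpha> \<beta> \<tau>\<close> conv1 j]
  \<comment> \<open>With k = r + 1 all integer exponents become natural; \<open>1 \<le> n\<close>
    makes the truncated difference n + r - 1 the true one.\<close>
  have e: "t powi (- (int (Suc r) - 1)) = inverse (t ^ r)"
    "t powi (- (int n + int (Suc r) - 2)) = inverse (t ^ (n + r - 1))"
    "t ^ (Suc r - 1) = t ^ r" "t ^ (n + Suc r - 2) = t ^ (n + r - 1)" for r
  proof -
    have "int n + int (Suc r) - 2 = int (n + r - 1)" using \<open>1 \<le> n\<close> by simp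
    then show "t powi (- (int n + int (Suc r) - 2)) = inverse (t ^ (n + r - 1))"
      by (simp only: power_int_minus power_int_of_nat)
    have "int (Suc r) - 1 = int r" by simp
    then show "t powi (- (int (Suc r) - 1)) = inverse (t ^ r)"
      by (simp only: power_int_minus power_int_of_nat)
  qed simp_all
  have shift: "(\<Prod>k=1..n. f k) = (\<Prod>r<n. f (Suc r))" for f :: "nat \<Rightarrow> complex"
    by (simp add: prod.atLeast1_atMost_eq)
  show "T_a j J \<alpha> \<beta> =
        (- a j) ^ n
        * (\<Prod>k=1..n. (1 - inverse (a j) * inverse (b 1) * t powi (- (int k - 1)))
                   * (1 - inverse (a j) * inverse (b 2) * t powi (- (int k - 1)))
                   / (1 - inverse (a 1) * inverse (a 2) * inverse (b 1) * inverse (b 2)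
                          * t powi (- (int n + int k - 2))))
        * J \<alpha> \<beta>
    \<and> T_b j J \<alpha> \<beta> =
        (- inverse (b j)) ^ n
        * (\<Prod>k=1..n. (1 - a 1 * b j * t ^ (k - 1)) * (1 - a 2 * b j * t ^ (k - 1))
                   / (1 - a 1 * a 2 * b 1 * b 2 * t ^ (n + k - 2)))
        * J \<alpha> \<beta>
    \<and> T_a j \<J> \<alpha> \<beta> =
        (\<Prod>k=1..n. (1 - inverse (a j) * inverse (b 1) * t powi (- (int k - 1)))
                 * (1 - inverse (a j) * inverse (b 2) * t powi (- (int k - 1)))
                 / (1 - inverse (a 1) * inverse (a 2) * inverse (b 1) * inverse (b 2)
                        * t powi (- (int n + int k - 2))))
        * \<J> \<alpha> \<beta>
    \<and> T_b j \<J> \<alpha> \<beta> =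
        (\<Prod>k=1..n. (1 - inverse (a 1) * inverse (b j) * t powi (- (int k - 1)))
                 * (1 - inverse (a 2) * inverse (b j) * t powi (- (int k - 1)))
                 / (1 - inverse (a 1) * inverse (a 2) * inverse (b 1) * inverse (b 2)
                        * t powi (- (int n + int k - 2))))
        * \<J> \<alpha> \<beta>"
    unfolding shift e unfolding T_a_def T_b_def J_def \<J>_def a_def b_def t_def
    by (intro conjI formulas)
qed

end
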